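(* Suppose the network configuration $\chi=\{(M_1,N_1,d_1),\dots,(M_K,N_K,d_K)\}$ satisfies: 1) $d_k=d$ for all $k$; and 2) $d\mid N_k$ for all $k$, or $d\mid M_k$ for all $k$. Then the interference alignment (IA) problem has a solution almost surely if and only if $$\sum_{j\in T(\mathcal{J}_{\mathrm{sub}})}(M_j-d)+\sum_{k\in R(\mathcal{J}_{\mathrm{sub}})}(N_k-d)\ \ge\ d\,|\mathcal{J}_{\mathrm{sub}}|\qquad\text{for all }\mathcal{J}_{\mathrm{sub}}\subseteq\mathcal{J}.$$
   Context: A MIMO interference network has $K$ transmitter-receiver pairs; transmitter $k$ has $M_k$ antennas, receiver $k$ has $N_k$ antennas, and transmitter $k$ sends $d_k$ independent data streams to receiver $k$ ($M_k,N_k,d_k$ positive integers). The channel matrix from transmitter $j$ to receiver $k$ is $\mathbf{H}_{kj}\in\mathbb{C}^{N_k\times M_j}$, $k,j\in\{1,\dots,K\}$; the entries of the channel matrices are independent random variables drawn from continuous distributions, and "almost surely" refers to this randomness. IA problem: given $\{\mathbf{H}_{kj}\}$, find $\mathbf{U}_k\in\mathbb{C}^{N_k\times d_k}$ and $\mathbf{V}_k\in\mathbb{C}^{M_k\times d_k}$, $k\in\{1,\dots,K\}$, such that $\mathrm{rank}(\mathbf{U}_k^H\mathbf{H}_{kk}\mathbf{V}_k)=d_k$ for all $k$, and $\mathbf{U}_k^H\mathbf{H}_{kj}\mathbf{V}_j=\mathbf{0}$ for all $k\ne j$. Here $(\cdot)^H$ is the Hermitian transpose. $\mathcal{J}=\{(k,j):k,j\in\{1,\dots,K\},\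 k\ne j\}$. For $\mathcal{J}_{\mathrm{sub}}\subseteq\mathcal{J}$, $T(\mathcal{J}_{\mathrm{sub}})=\{j:\exists k,\ (k,j)\in\mathcal{J}_{\mathrm{sub}}\}$, $R(\mathcal{J}_{\mathrm{sub}})=\{k:\exists j,\ (k,j)\in\mathcal{J}_{\mathrm{sub}}\}$, and $|\mathcal{J}_{\mathrm{sub}}|$ is the cardinality of $\mathcal{J}_{\mathrm{sub}}$. The notation $n\mid m$ means that $n$ divides $m$.
   Formalization: The formal theorem adds the assumption d_k ≤ min(M_k, N_k) for all k; without it the claim fails, e.g. K=1, M_1=1, N_1=d=2, where the inequality holds vacuously but the rank condition cannot be met. *)

theory Defs
  imports
    "HOL-Probability.Probability"
    "Jordan_Normal_Form.Schur_Decomposition"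
    "Jordan_Normal_Form.DL_Rank"
begin

(* A configuration is given by K and by functions M, N, ds, of which only the values
   on {1..K} matter; users are numbered from 1, matrix rows and columns from 0.
   H k j is the channel from transmitter j to receiver k. *)

definition network_config ::
  "nat \<Rightarrow> (nat \<Rightarrow> nat) \<Rightarrow> (nat \<Rightarrow> nat) \<Rightarrow> (nat \<Rightarrow> nat) \<Rightarrow> bool"
  where "network_config K M N ds \<longleftrightarrow>
    0 < K \<and> (\<forall>k\<in>{1..K}. 0 < M k \<and> 0 < N k \<and> 0 < ds k)"

definition IA_solution ::
  "nat \<Rightarrow> (nat \<Rightarrow> nat) \<Rightarrow> (nat \<Rightarrow> nat) \<Rightarrow> (nat \<Rightarrow> nat) \<Rightarrow>
   (nat \<Rightarrow> nat \<Rightarrow> complex mat) \<Rightarrow> (nat \<Rightarrow> complex mat) \<Rightarrow> (nat \<Rightarrow> complex mat) \<Rightarrow> bool"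
  where "IA_solution K M N ds H U V \<longleftrightarrow>
    (\<forall>k\<in>{1..K}. U k \<in> carrier_mat (N k) (ds k) \<and> V k \<in> carrier_mat (M k) (ds k)) \<and>
    (\<forall>k\<in>{1..K}. vec_space.rank (ds k) (mat_adjoint (U k) * H k k * V k) = ds k) \<and>
    (\<forall>k\<in>{1..K}. \<forall>j\<in>{1..K}. k \<noteq> j \<longrightarrow>
       mat_adjoint (U k) * H k j * V j = 0\<^sub>m (ds k) (ds j))"

definition IA_solvable ::
  "nat \<Rightarrow> (nat \<Rightarrow> nat) \<Rightarrow> (nat \<Rightarrow> nat) \<Rightarrow> (nat \<Rightarrow> nat) \<Rightarrow> (nat \<Rightarrow> nat \<Rightarrow> complex mat) \<Rightarrow> bool"
  where "IA_solvable K M N ds H \<longleftrightarrow> (\<exists>U V. IA_solution K M N ds H U V)"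

definition cross_links :: "nat \<Rightarrow> (nat \<times> nat) set"
  where "cross_links K = {(k, j). k \<in> {1..K} \<and> j \<in> {1..K} \<and> k \<noteq> j}"

definition Tx_of :: "(nat \<times> nat) set \<Rightarrow> nat set"
  where "Tx_of J = {j. \<exists>k. (k, j) \<in> J}"

definition Rx_of :: "(nat \<times> nat) set \<Rightarrow> nat set"
  where "Rx_of J = {k. \<exists>j. (k, j) \<in> J}"

(* Continuity is taken in the weakest sense, absence of atoms; it is implied by the
   existence of a density and by the continuity of the joint distribution function
   of the real and imaginary parts. *)
definition continuous_distr :: "complex measure \<Rightarrow> bool"
  where "continuous_distr D \<longleftrightarrow> (\<forall>z. emeasure D {z} = 0)"

definition channel_entries ::
  "nat \<Rightarrow> (nat \<Rightarrow> nat) \<Rightarrow> (nat \<Rightarrow> nat) \<Rightarrow> (nat \<times> nat \<times> nat \<times> nat) set"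
  where "channel_entries K M N =
    {(k, j, a, b). k \<in> {1..K} \<and> j \<in> {1..K} \<and> a < N k \<and> b < M j}"

definition channel_entry ::
  "('w \<Rightarrow> nat \<Rightarrow> nat \<Rightarrow> complex mat) \<Rightarrow> nat \<times> nat \<times> nat \<times> nat \<Rightarrow> 'w \<Rightarrow> complex"
  where "channel_entry H = (\<lambda>(k, j, a, b) \<omega>. H \<omega> k j $$ (a, b))"

definition random_channels ::
  "'w measure \<Rightarrow> nat \<Rightarrow> (nat \<Rightarrow> nat) \<Rightarrow> (nat \<Rightarrow> nat) \<Rightarrow>
   ('w \<Rightarrow> nat \<Rightarrow> nat \<Rightarrow> complex mat) \<Rightarrow> bool"
  where "random_channels P K M N H \<longleftrightarrow>
    (\<forall>\<omega>\<in>space P. \<forall>k\<in>{1..K}. \<forall>j\<in>{1..K}. H \<omega> k j \<in> carrier_mat (N k) (M j)) \<and>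
    prob_space.indep_vars P (\<lambda>_. borel) (channel_entry H) (channel_entries K M N) \<and>
    (\<forall>e\<in>channel_entries K M N. continuous_distr (distr P borel (channel_entry H e)))"

end

(*
  Polynomials are treated as functions, and a nonzero polynomial in independent variables without
  atoms is almost surely nonzero (Fubini); so everything reduces to finding such polynomials in the
  channel entries.

  After a row permutation the leading d rows of every beamformer can be normalized to the identity.
  The alignment equations then express the leading d x d block of each cross channel through the
  other channel entries and the remaining beamformer entries. If the condition fails for J, this
  parametrizes the solvable channels by fewer variables than there are channel entries, so the
  channel entries satisfy a nontrivial algebraic relation (counting monomials).

  Conversely, Hall's theorem applied to the rows of the cross links yields a channel at which the
  linear part of the parametrization is onto. Hence the parametrization is given by algebraically
  independent polynomials in equally many variables; adjoining these variables one at a time to the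
  ring generated by the polynomials, and extending homomorphisms to the complex numbers at each
  step, shows that its image contains the complement of a hypersurface. The rank condition is one
  more polynomial that must not vanish.
*)

theory Submission
  imports Defs
begin

section \<open>Polynomial functions\<close>


text \<open>The divisibility hypothesis enters only where the linear part is shown to be onto. To
  first order, equation \<open>(k, j, p, q)\<close> sums \<open>H2 k j p b * xV j b q\<close> over
  \<open>b\<close> and \<open>xU k p a * H3 k j a q\<close> over \<open>a\<close>: the unknowns of
  transmitter \<open>j\<close> are shared by all rows \<open>p\<close>, those of receiver
  \<open>k\<close> by all columns \<open>q\<close>. Hall's theorem needs resources that can be
  handed out separately. If \<open>d\<close> divides every \<open>N k - d\<close>, the coordinates
  of a receiver can be dealt out evenly to the \<open>d\<close> columns. A whole row
  \<open>(k, j, p)\<close> of equations then costs one unit of capacity, taken either from row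
  \<open>p\<close> of receiver \<open>k\<close> or from transmitter \<open>j\<close>, and this is a
  matching problem. The case of divisible transmitters is its transpose.

  The extension of homomorphisms needs every variable to be algebraic over the ring generated by the
  map, hence no more variables than channel entries; surplus beamformer entries are set to zero. The
  direct channels occur in no alignment equation, so they stay free parameters, and the polynomial
  expressing the rank condition is not identically zero.\<close>

inductive_set polyfuns :: "'v set \<Rightarrow> (('v \<Rightarrow> complex) \<Rightarrow> complex) set" for V where
  const: "(\<lambda>_. c) \<in> polyfuns V"
| var: "i \<in> V \<Longrightarrow> (\<lambda>z. z i) \<in> polyfuns V"
| add: "f \<in> polyfuns V \<Longrightarrow> g \<in> polyfuns V \<Longrightarrow> (\<lambda>z. f z + g z) \<in> polyfuns V"
| mult: "f \<in> polyfuns V \<Longrightarrow> g \<in> polyfuns V \<Longrightarrow> (\<lambda>z. f z * g z) \<in> polyfuns V"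

lemma polyfuns_minus: "f \<in> polyfuns V \<Longrightarrow> (\<lambda>z. - f z) \<in> polyfuns V"
  using polyfuns.mult[OF polyfuns.const[of "-1"], of f] by simp

lemma polyfuns_diff: "f \<in> polyfuns V \<Longrightarrow> g \<in> polyfuns V \<Longrightarrow> (\<lambda>z. f z - g z) \<in> polyfuns V"
  using polyfuns.add[OF _ polyfuns_minus, of f V g] by simp

lemma polyfuns_sum: "(\<And>i. i \<in> I \<Longrightarrow> f i \<in> polyfuns V) \<Longrightarrow> (\<lambda>z. \<Sum>i\<in>I. f i z) \<in> polyfuns V"
  by (induction I rule: infinite_finite_induct) (auto intro: polyfuns.intros)

lemma polyfuns_prod: "(\<And>i. i \<in> I \<Longrightarrow> f i \<in> polyfuns V) \<Longrightarrow> (\<lambda>z. \<Prod>i\<in>I. f i z) \<in> polyfuns V"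
  by (induction I rule: infinite_finite_induct) (auto intro: polyfuns.intros)

lemma polyfuns_power: "f \<in> polyfuns V \<Longrightarrow> (\<lambda>z. f z ^ n) \<in> polyfuns V"
  by (induction n) (auto intro: polyfuns.intros)

lemmas polyfuns_intros = polyfuns.intros polyfuns_minus polyfuns_diff polyfuns_sum polyfuns_prod
  polyfuns_power

lemma polyfuns_cong:
  assumes "f \<in> polyfuns V" "\<And>i. i \<in> V \<Longrightarrow> z i = z' i"
  shows "f z = f z'"
  using assms by (induction) auto

lemma polyfuns_compose:
  assumes "f \<in> polyfuns V" "\<And>i. i \<in> V \<Longrightarrow> (\<lambda>x. G x i) \<in> polyfuns W"
  shows "(\<lambda>x. f (G x)) \<in> polyfuns W"
  using assms by (induction) (auto intro: polyfuns.intros)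

text \<open>Reduces questions about zeros to univariate polynomials: lines serve for the integral
  domain property, a single moving coordinate for Fubini.\<close>

lemma polyfuns_along_line:
  assumes "f \<in> polyfuns V"
  shows "\<exists>P :: complex poly. \<forall>t. f (\<lambda>i. poly (p i) t) = poly P t"
  using assms
proof induction
    case (const c) then show ?case by (intro exI[of _ "[:c:]"]) simp
  next
    case (add f g) then show ?case by (metis poly_add)
  next
    case (mult f g) then show ?case by (metis poly_mult)
  qed auto

text \<open>On the line joining a point where \<open>f\<close> is nonzero to one where
  \<open>g\<close> is nonzero, both restrict to nonzero univariate polynomials, whose product cannot
  vanish.\<close>

lemma polyfuns_mult_eq_0:
  assumes "f \<in> polyfuns V" "g \<in> polyfuns W" "\<And>x. f x * g x = 0"
  shows "(\<forall>x. f x = 0) \<or> (\<forall>x. g x = 0)"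
proof (rule ccontr)
  assume "\<not> ?thesis"
  then obtain a b where ab: "f a \<noteq> 0" "g b \<noteq> 0" by blast
  define p where "p = (\<lambda>i. [:a i, b i - a i:])"
  obtain P where P: "\<And>t. f (\<lambda>i. poly (p i) t) = poly P t"
    using polyfuns_along_line[OF assms(1), of p] by blast
  obtain Q where Q: "\<And>t. g (\<lambda>i. poly (p i) t) = poly Q t"
    using polyfuns_along_line[OF assms(2), of p] by blast
  have "poly P 0 = f a" "poly Q 1 = g b" by (simp_all add: P[symmetric] Q[symmetric] p_def)
  with ab have "P \<noteq> 0" "Q \<noteq> 0" by auto
  moreover have "poly (P * Q) t = 0" for t
    by (simp add: P[symmetric] Q[symmetric] assms(3))
  then have "P * Q = 0" using poly_all_0_iff_0 by blast
  ultimately show False by simp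
qed

lemma polyfuns_prod_nonzero:
  assumes "finite I" "\<And>i. i \<in> I \<Longrightarrow> f i \<in> polyfuns V" "\<And>i. i \<in> I \<Longrightarrow> \<exists>x. f i x \<noteq> 0"
  shows "\<exists>x. (\<Prod>i\<in>I. f i x) \<noteq> 0"
  using assms
proof (induction I)
  case (insert i I)
  then have "\<exists>x. f i x \<noteq> 0" "\<exists>x. (\<Prod>i\<in>I. f i x) \<noteq> 0" by auto
  with polyfuns_mult_eq_0[of "f i" V "\<lambda>x. \<Prod>i\<in>I. f i x" V] insert show ?case
    by (simp add: polyfuns_prod) blast
qed auto

text \<open>Stands for the polynomial ring over the function ring \<open>C\<close>: a family of
  univariate polynomials whose coefficients depend on the point through \<open>C\<close>. The degree
  at a single point may drop, so only a uniform bound is asked for.\<close>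

definition polys_over :: "('a \<Rightarrow> complex) set \<Rightarrow> ('a \<Rightarrow> complex poly) set" where
  "polys_over C = {p. (\<forall>i. (\<lambda>z. coeff (p z) i) \<in> C) \<and> (\<exists>n. \<forall>z. degree (p z) \<le> n)}"

text \<open>Kept abstract because the coefficients are polynomial functions in the elimination
  argument, but in the homogeneous expansion they are functions of a pair that ignore its first
  component.\<close>

definition subalgebra :: "('a \<Rightarrow> complex) set \<Rightarrow> bool" where
  "subalgebra C \<longleftrightarrow> (\<forall>c. (\<lambda>_. c) \<in> C) \<and> (\<forall>f\<in>C. \<forall>g\<in>C. (\<lambda>z. f z + g z) \<in> C)
     \<and> (\<forall>f\<in>C. \<forall>g\<in>C. (\<lambda>z. f z * g z) \<in> C)"

lemma subalgebra_polyfuns: "subalgebra (polyfuns V)"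
  by (auto simp: subalgebra_def intro: polyfuns.intros)

lemma polys_over_coeff: "p \<in> polys_over C \<Longrightarrow> (\<lambda>z. coeff (p z) i) \<in> C"
  by (auto simp: polys_over_def)

context
  fixes C :: "('a \<Rightarrow> complex) set"
  assumes C: "subalgebra C"
begin

lemma subalgebra_sum: "(\<And>i. i \<in> I \<Longrightarrow> f i \<in> C) \<Longrightarrow> (\<lambda>z. \<Sum>i\<in>I. f i z) \<in> C"
  using C by (induction I rule: infinite_finite_induct) (auto simp: subalgebra_def)

lemma subalgebra_power: "f \<in> C \<Longrightarrow> (\<lambda>z. f z ^ n) \<in> C"
  using C by (induction n) (auto simp: subalgebra_def)

lemma polys_over_add:
  assumes "p \<in> polys_over C" "q \<in> polys_over C" shows "(\<lambda>z. p z + q z) \<in> polys_over C"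
proof -
  from assms obtain m n where "\<forall>z. degree (p z) \<le> m" "\<forall>z. degree (q z) \<le> n"
    by (auto simp: polys_over_def)
  then have "\<forall>z. degree (p z + q z) \<le> max m n"
    by (meson degree_add_le max.coboundedI1 max.coboundedI2)
  then show ?thesis using assms C by (auto simp: polys_over_def subalgebra_def)
qed

lemma polys_over_mult:
  assumes "p \<in> polys_over C" "q \<in> polys_over C" shows "(\<lambda>z. p z * q z) \<in> polys_over C"
proof -
  from assms obtain m n where "\<forall>z. degree (p z) \<le> m" "\<forall>z. degree (q z) \<le> n"
    by (auto simp: polys_over_def)
  then have "\<forall>z. degree (p z * q z) \<le> m + n"
    by (meson degree_mult_le add_mono order_trans)
  moreover have "(\<lambda>z. coeff (p z * q z) i) \<in> C" for i
    unfolding coeff_mult using assms C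
    by (intro subalgebra_sum) (auto simp: polys_over_def subalgebra_def)
  ultimately show ?thesis by (auto simp: polys_over_def)
qed

lemma polys_over_monom: "f \<in> C \<Longrightarrow> (\<lambda>z. monom (f z) n) \<in> polys_over C"
proof -
  assume f: "f \<in> C"
  have "(\<lambda>z. coeff (monom (f z) n) i) \<in> C" for i
    using C f by (cases "n = i") (auto simp: subalgebra_def)
  then show ?thesis by (auto simp: polys_over_def intro: exI[of _ n] degree_monom_le)
qed

lemma polys_over_pCons: "f \<in> C \<Longrightarrow> (\<lambda>z. [:f z:]) \<in> polys_over C"
  using polys_over_monom[of f 0] by (simp add: monom_0)

lemma polys_over_smult: "f \<in> C \<Longrightarrow> p \<in> polys_over C \<Longrightarrow> (\<lambda>z. Polynomial.smult (f z) (p z)) \<in> polys_over C"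
  using polys_over_mult[OF polys_over_pCons[of f], of p] by simp

lemma polys_over_minus: "p \<in> polys_over C \<Longrightarrow> (\<lambda>z. - p z) \<in> polys_over C"
  using polys_over_smult[of "\<lambda>_. -1" p] C by (simp add: subalgebra_def)

lemma polys_over_diff:
  "p \<in> polys_over C \<Longrightarrow> q \<in> polys_over C \<Longrightarrow> (\<lambda>z. p z - q z) \<in> polys_over C"
  using polys_over_add[OF _ polys_over_minus, of p q] by simp

text \<open>Multiplying by the coefficient of formal degree \<open>n\<close> lets the top term of
  \<open>r\<close> be cancelled without leaving \<open>C\<close>. That coefficient may vanish at
  some points, so nothing is divided by it. With \<open>n > 0\<close> a zero remainder also has
  degree below \<open>n\<close>.\<close>

lemma polys_over_pseudo_division:
  assumes p: "p \<in> polys_over C" "\<And>z. degree (p z) \<le> n" and r: "r \<in> polys_over C" and n: "n > 0"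
  shows "\<exists>k s t. s \<in> polys_over C \<and> t \<in> polys_over C \<and> (\<forall>z. degree (t z) < n) \<and>
    (\<forall>z. Polynomial.smult (coeff (p z) n ^ k) (r z) = p z * s z + t z)"
proof -
  from r obtain l where "\<forall>z. degree (r z) \<le> l" by (auto simp: polys_over_def)
  then have "\<exists>m. \<forall>z. degree (r z) < m" by (intro exI[of _ "Suc l"]) (simp add: less_Suc_eq_le)
  then obtain m where "\<forall>z. degree (r z) < m" ..
  then show ?thesis using r
  proof (induction m arbitrary: r)
    case 0 then show ?case by simp
  next
    case (Suc m)
    show ?case
    proof (cases "m < n")
      case True
      then have "\<forall>z. degree (r z) < n" using Suc.prems(1) by (meson less_Suc_eq_le order_le_less_trans)
      then show ?thesis using Suc.prems C
        by (intro exI[of _ 0] exI[of _ "\<lambda>_. 0"] exI[of _ r]) (auto simp: polys_over_def subalgebra_def)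
    next
      case False
      define l where "l = (\<lambda>z. monom (coeff (r z) m) (m - n))"
      have l: "l \<in> polys_over C"
        unfolding l_def by (intro polys_over_monom polys_over_coeff Suc.prems)
      define r' where "r' = (\<lambda>z. Polynomial.smult (coeff (p z) n) (r z) - p z * l z)"
      have r': "r' \<in> polys_over C" unfolding r'_def
        by (intro polys_over_diff polys_over_mult polys_over_smult polys_over_coeff Suc.prems p l)
      have "degree (r' z) < m" for z
      proof -
        have "coeff (r' z) i = 0" if "i \<ge> m" for i
        proof (cases "i = m")
          case True
          have "coeff (p z * l z) m = coeff (p z) n * coeff (r z) m"
            using False by (simp add: l_def mult.commute[of "p z"] coeff_monom_mult)
          then show ?thesis using True by (simp add: r'_def)
        next
          case False2: False
          have "degree (p z * l z) \<le> n + (m - n)"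
            using degree_mult_le[of "p z" "l z"] p(2)[of z] degree_monom_le[of "coeff (r z) m" "m-n"]
            unfolding l_def by linarith
          then have "coeff (p z * l z) i = 0" using False that False2 by (intro coeff_eq_0) auto
          moreover have "degree (r z) < i" using Suc.prems(1)[rule_format, of z] that False2 by linarith
          then have "coeff (r z) i = 0" by (rule coeff_eq_0)
          ultimately show ?thesis by (simp add: r'_def)
        qed
        moreover have "m > 0" using n False by simp
        ultimately show ?thesis by (metis (no_types) degree_0 leading_coeff_0_iff not_le_imp_less)
      qed
      from Suc.IH[OF _ r'] this obtain k s t where kst: "s \<in> polys_over C" "t \<in> polys_over C"
        "\<forall>z. degree (t z) < n" "\<forall>z. Polynomial.smult (coeff (p z) n ^ k) (r' z) = p z * s z + t z" by blast
      have "Polynomial.smult (coeff (p z) n ^ Suc k) (r z) =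
          p z * (s z + Polynomial.smult (coeff (p z) n ^ k) (l z)) + t z" for z
        using kst(4)[rule_format, of z]
        by (simp add: r'_def smult_diff_right algebra_simps)
      then show ?thesis using kst l p
        by (intro exI[of _ "Suc k"] exI[of _ "\<lambda>z. s z + Polynomial.smult (coeff (p z) n ^ k) (l z)"] exI[of _ t])
          (auto intro!: polys_over_add polys_over_smult subalgebra_power polys_over_coeff)
    qed
  qed
qed

end

lemma polyfuns_insert_poly:
  assumes "f \<in> polyfuns (insert w W)"
  obtains p where "p \<in> polys_over (polyfuns W)" "\<And>z. f z = poly (p z) (z w)"
proof -
  have "\<exists>p\<in>polys_over (polyfuns W). \<forall>z. f z = poly (p z) (z w)"
    using assms
  proof induction
    case (const c)
    then show ?case
      by (intro bexI[of _ "\<lambda>_. [:c:]"] polys_over_pCons subalgebra_polyfuns)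
        (auto intro: polyfuns_intros)
  next
    case (var i)
    show ?case
    proof (cases "i = w")
      case True
      then show ?thesis
        by (intro bexI[of _ "\<lambda>_. monom 1 1"] polys_over_monom subalgebra_polyfuns)
        (auto intro: polyfuns_intros simp: poly_monom)
    next
      case False
      then show ?thesis using var
        by (intro bexI[of _ "\<lambda>z. [:z i:]"] polys_over_pCons subalgebra_polyfuns)
        (auto intro: polyfuns_intros)
    qed
  next
    case (add f g)
    then obtain p q where "p \<in> polys_over (polyfuns W)" "\<And>z. f z = poly (p z) (z w)"
      "q \<in> polys_over (polyfuns W)" "\<And>z. g z = poly (q z) (z w)" by blast
    then show ?case
      by (intro bexI[OF _ polys_over_add[OF subalgebra_polyfuns, of p W q]]) auto
  next
    case (mult f g)
    then obtain p q where "p \<in> polys_over (polyfuns W)" "\<And>z. f z = poly (p z) (z w)"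
      "q \<in> polys_over (polyfuns W)" "\<And>z. g z = poly (q z) (z w)" by blast
    then show ?case
      by (intro bexI[OF _ polys_over_mult[OF subalgebra_polyfuns, of p W q]]) auto
  qed
  then show ?thesis using that by blast
qed

section \<open>Algebraic dependence by counting monomials\<close>


text \<open>Gaussian elimination: equation \<open>b\<close> serves to eliminate an unknown
  \<open>k\<close> that occurs in it, which leaves one equation and one unknown fewer.\<close>

lemma homogeneous_system_nontrivial_solution:
  fixes a :: "'b \<Rightarrow> 'a \<Rightarrow> complex"
  assumes "finite B" "finite A" "card B < card A"
  shows "\<exists>c. (\<exists>i\<in>A. c i \<noteq> 0) \<and> (\<forall>b\<in>B. (\<Sum>i\<in>A. a b i * c i) = 0)"
  using assms
proof (induction B arbitrary: A a)
  case empty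
  then show ?case by (intro exI[of _ "\<lambda>_. 1"]) (auto simp: card_gt_0_iff)
next
  case (insert b B)
  show ?case
  proof (cases "\<forall>i\<in>A. a b i = 0")
    case True
    have "card B < card A" using insert by simp
    from insert.IH[OF insert.prems(1) this, of a] True show ?thesis by auto
  next
    case False
    then obtain k where k: "k \<in> A" "a b k \<noteq> 0" by auto
    define A' where "A' = A - {k}"
    have A': "finite A'" "card B < card A'" "k \<notin> A'" "A = insert k A'"
      using insert k by (auto simp: A'_def)
    define a' where "a' = (\<lambda>b' i. a b' i - a b' k * a b i / a b k)"
    obtain c where c: "\<exists>i\<in>A'. c i \<noteq> 0" "\<forall>b\<in>B. (\<Sum>i\<in>A'. a' b i * c i) = 0"
      using insert.IH[OF A'(1,2), of a'] by auto
    define c' where "c' = c(k := - (\<Sum>i\<in>A'. a b i * c i) / a b k)"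
    have s: "(\<Sum>i\<in>A. a b' i * c' i) =
        (\<Sum>i\<in>A'. a b' i * c i) - a b' k * (\<Sum>i\<in>A'. a b i * c i) / a b k" for b'
    proof -
      have "(\<Sum>i\<in>A'. a b' i * c' i) = (\<Sum>i\<in>A'. a b' i * c i)"
        using A'(3) by (intro sum.cong) (auto simp: c'_def)
      then show ?thesis using A' by (simp add: c'_def)
    qed
    have "(\<Sum>i\<in>A. a b' i * c' i) = 0" if "b' \<in> insert b B" for b'
    proof (cases "b' = b")
      case True then show ?thesis using k by (simp add: s)
    next
      case False
      then have "0 = (\<Sum>i\<in>A'. a' b' i * c i)" using c(2) that by auto
      also have "\<dots> = (\<Sum>i\<in>A. a b' i * c' i)"
        unfolding s a'_def sum_distrib_left sum_divide_distrib
        by (simp add: algebra_simps sum_subtractf)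
      finally show ?thesis by simp
    qed
    moreover have "\<exists>i\<in>A. c' i \<noteq> 0" using c(1) A' by (auto simp: c'_def)
    ultimately show ?thesis by blast
  qed
qed

text \<open>\<open>B\<close> indexes the equations and \<open>A\<close> the unknowns. The index sets
  are arbitrary because they will also be sets of channel entries and of beamformer
  variables.\<close>

definition onto_on :: "'b set \<Rightarrow> 'a set \<Rightarrow> ('b \<Rightarrow> 'a \<Rightarrow> complex) \<Rightarrow> bool" where
  "onto_on B A a \<longleftrightarrow> (\<forall>w. \<exists>x. \<forall>b\<in>B. (\<Sum>i\<in>A. a b i * x i) = w b)"

text \<open>A smallest set of columns that still spans is independent: subtracting a suitable
  multiple of a linear relation would make a column dispensable. Hence it has at most as many
  elements as there are equations.\<close>

lemma onto_on_column_basis: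
  assumes "finite A" "finite B" "onto_on B A a"
  obtains A' where "A' \<subseteq> A" "card A' \<le> card B" "onto_on B A' a"
proof -
  define P where "P = (\<lambda>A'. A' \<subseteq> A \<and> onto_on B A' a)"
  have "P A" using assms by (simp add: P_def)
  then obtain A' where A': "P A'" and min: "\<And>A''. P A'' \<Longrightarrow> card A' \<le> card A''"
    using ex_has_least_nat[of P A card] by blast
  have fin: "finite A'" using A' assms(1) by (auto simp: P_def intro: finite_subset)
  have "card A' \<le> card B"
  proof (rule ccontr)
    assume "\<not> ?thesis"
    then obtain c k where k: "k \<in> A'" "c k \<noteq> 0" and c: "\<forall>b\<in>B. (\<Sum>i\<in>A'. a b i * c i) = 0"
      using homogeneous_system_nontrivial_solution[OF assms(2) fin, of a] by auto
    define A'' where "A'' = A' - {k}"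
    have A'': "finite A''" "k \<notin> A''" "A' = insert k A''" using fin k by (auto simp: A''_def)
    have "\<exists>x. \<forall>b\<in>B. (\<Sum>i\<in>A''. a b i * x i) = w b" for w
    proof -
      obtain x where x: "\<forall>b\<in>B. (\<Sum>i\<in>A'. a b i * x i) = w b"
        using A' unfolding P_def onto_on_def by blast
      have "(\<Sum>i\<in>A''. a b i * (x i - x k / c k * c i)) = w b" if "b \<in> B" for b
      proof -
        have 1: "(\<Sum>i\<in>A''. a b i * c i) = - a b k * c k"
          using c[rule_format, OF that] A'' by (simp add: add_eq_0_iff)
        have 2: "(\<Sum>i\<in>A''. a b i * x i) = w b - a b k * x k"
          using x[rule_format, OF that] A'' by (simp add: algebra_simps)
        have "(\<Sum>i\<in>A''. a b i * (x i - x k / c k * c i)) =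
          (\<Sum>i\<in>A''. a b i * x i) - x k / c k * (\<Sum>i\<in>A''. a b i * c i)"
          unfolding sum_distrib_left by (simp add: algebra_simps sum_subtractf)
        then show ?thesis using k by (simp add: 1 2)
      qed
      then show ?thesis by (intro exI[of _ "\<lambda>i. x i - x k / c k * c i"]) blast
    qed
    then have "P A''" using A' by (auto simp: P_def onto_on_def A''_def)
    then have "card A' \<le> card A''" by (rule min)
    then show False using A'' by simp
  qed
  then show ?thesis using A' that by (auto simp: P_def)
qed

section \<open>Spans of monomials with bounded exponents\<close>

definition multidegrees :: "'v set \<Rightarrow> nat \<Rightarrow> ('v \<Rightarrow> nat) set" where
  "multidegrees V D = PiE V (\<lambda>_. {..D})"

definition mono_fun :: "'v set \<Rightarrow> ('v \<Rightarrow> nat) \<Rightarrow> ('v \<Rightarrow> complex) \<Rightarrow> complex" where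
  "mono_fun V \<beta> z = (\<Prod>v\<in>V. z v ^ \<beta> v)"

definition mono_span :: "'v set \<Rightarrow> nat \<Rightarrow> (('v \<Rightarrow> complex) \<Rightarrow> complex) set" where
  "mono_span V D = {f. \<exists>c. \<forall>z. f z = (\<Sum>\<beta>\<in>multidegrees V D. c \<beta> * mono_fun V \<beta> z)}"

lemma finite_multidegrees: "finite V \<Longrightarrow> finite (multidegrees V D)"
  by (simp add: multidegrees_def finite_PiE)

text \<open>This exact count is the reason for bounding each exponent separately instead of the
  total degree.\<close>

lemma card_multidegrees: "finite V \<Longrightarrow> card (multidegrees V D) = Suc D ^ card V"
  by (simp add: multidegrees_def card_PiE)

lemma mono_span_add: "f \<in> mono_span V D \<Longrightarrow> g \<in> mono_span V D \<Longrightarrow> (\<lambda>z. f z + g z) \<in> mono_span V D"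
proof -
  assume "f \<in> mono_span V D" "g \<in> mono_span V D"
  then obtain c d where "\<forall>z. f z = (\<Sum>\<beta>\<in>multidegrees V D. c \<beta> * mono_fun V \<beta> z)"
    "\<forall>z. g z = (\<Sum>\<beta>\<in>multidegrees V D. d \<beta> * mono_fun V \<beta> z)" by (auto simp: mono_span_def)
  then have "\<forall>z. f z + g z = (\<Sum>\<beta>\<in>multidegrees V D. (c \<beta> + d \<beta>) * mono_fun V \<beta> z)"
    by (simp add: sum.distrib algebra_simps)
  then show ?thesis by (auto simp: mono_span_def)
qed

lemma mono_span_scale: "f \<in> mono_span V D \<Longrightarrow> (\<lambda>z. a * f z) \<in> mono_span V D"
proof -
  assume "f \<in> mono_span V D"
  then obtain c where "\<forall>z. f z = (\<Sum>\<beta>\<in>multidegrees V D. c \<beta> * mono_fun V \<beta> z)"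
    by (auto simp: mono_span_def)
  then have "\<forall>z. a * f z = (\<Sum>\<beta>\<in>multidegrees V D. (a * c \<beta>) * mono_fun V \<beta> z)"
    by (simp add: sum_distrib_left algebra_simps)
  then show ?thesis by (auto simp: mono_span_def)
qed

lemma mono_span_sum:
  "(\<And>i. i \<in> I \<Longrightarrow> f i \<in> mono_span V D) \<Longrightarrow> (\<lambda>z. \<Sum>i\<in>I. f i z) \<in> mono_span V D"
proof (induction I rule: infinite_finite_induct)
  case (insert i I)
  then show ?case by (auto intro!: mono_span_add)
qed (auto simp: mono_span_def intro!: exI[of _ "\<lambda>_. 0"])

lemma mono_span_mono_fun:
  assumes "finite V" "\<And>v. v \<in> V \<Longrightarrow> \<beta> v \<le> D"
  shows "mono_fun V \<beta> \<in> mono_span V D"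
proof -
  define \<beta>' where "\<beta>' = restrict \<beta> V"
  have "\<beta>' \<in> multidegrees V D" using assms by (auto simp: \<beta>'_def multidegrees_def)
  moreover have "mono_fun V \<beta>' = mono_fun V \<beta>" by (simp add: mono_fun_def fun_eq_iff \<beta>'_def)
  ultimately have "mono_fun V \<beta> z = (\<Sum>\<gamma>\<in>multidegrees V D. (if \<gamma> = \<beta>' then 1 else 0) * mono_fun V \<gamma> z)" for z
    using finite_multidegrees[OF assms(1), of D]
    by (simp add: if_distrib[of "\<lambda>x. x * _"] sum.delta cong: if_cong)
  then show ?thesis unfolding mono_span_def by (auto intro!: exI[of _ "\<lambda>\<gamma>. if \<gamma> = \<beta>' then 1 else 0"])
qed

lemma mono_span_mult:
  assumes "finite V" "f \<in> mono_span V D" "g \<in> mono_span V D'"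
  shows "(\<lambda>z. f z * g z) \<in> mono_span V (D + D')"
proof -
  obtain c d where *: "\<forall>z. f z = (\<Sum>\<beta>\<in>multidegrees V D. c \<beta> * mono_fun V \<beta> z)"
    "\<forall>z. g z = (\<Sum>\<beta>\<in>multidegrees V D'. d \<beta> * mono_fun V \<beta> z)"
    using assms by (auto simp: mono_span_def)
  have "(\<lambda>z. f z * g z) = (\<lambda>z. \<Sum>\<beta>\<in>multidegrees V D. \<Sum>\<gamma>\<in>multidegrees V D'.
      (c \<beta> * d \<gamma>) * mono_fun V (\<lambda>v. \<beta> v + \<gamma> v) z)"
    by (simp add: * sum_product mono_fun_def power_add prod.distrib algebra_simps)
  also have "\<dots> \<in> mono_span V (D + D')"
    using assms(1)
    by (intro mono_span_sum mono_span_scale mono_span_mono_fun)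
      (auto simp: multidegrees_def PiE_iff intro!: add_mono)
  finally show ?thesis .
qed

lemma mono_span_le:
  assumes "finite V" "f \<in> mono_span V D" "D \<le> D'" shows "f \<in> mono_span V D'"
proof -
  obtain c where "\<forall>z. f z = (\<Sum>\<beta>\<in>multidegrees V D. c \<beta> * mono_fun V \<beta> z)"
    using assms by (auto simp: mono_span_def)
  then have "f = (\<lambda>z. \<Sum>\<beta>\<in>multidegrees V D. c \<beta> * mono_fun V \<beta> z)" by blast
  also have "\<dots> \<in> mono_span V D'"
    using assms(1,3)
    by (intro mono_span_sum mono_span_scale mono_span_mono_fun)
      (auto simp: multidegrees_def PiE_iff)
  finally show ?thesis .
qed

lemma mono_span_const: "finite V \<Longrightarrow> (\<lambda>_. c) \<in> mono_span V D"
  using mono_span_scale[OF mono_span_mono_fun[of V "\<lambda>_. 0" D], of c] by (simp add: mono_fun_def)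

lemma mono_span_power:
  assumes "finite V" "f \<in> mono_span V D" shows "(\<lambda>z. f z ^ n) \<in> mono_span V (n * D)"
  by (induction n) (use assms in \<open>auto intro: mono_span_const mono_span_mult\<close>)

lemma mono_span_prod:
  assumes "finite V" "finite I" "\<And>i. i \<in> I \<Longrightarrow> f i \<in> mono_span V D"
  shows "(\<lambda>z. \<Prod>i\<in>I. f i z) \<in> mono_span V (card I * D)"
  using assms(2,3)
  by (induction I) (use assms(1) in \<open>auto intro: mono_span_const mono_span_mult\<close>)

lemma polyfuns_mono_span:
  assumes "finite V" "f \<in> polyfuns V"
  shows "\<exists>D. f \<in> mono_span V D"
  using assms(2)
proof induction
  case (const c) then show ?case using mono_span_const[OF assms(1)] by blast
next
  case (var i)
  have "mono_fun V (\<lambda>v. if v = i then 1 else 0) = (\<lambda>z. z i)"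
    using var assms(1)
    by (auto simp: mono_fun_def fun_eq_iff if_distrib[of "\<lambda>n. _ ^ n"] prod.delta cong: if_cong)
  then show ?case
    using mono_span_mono_fun[OF assms(1), of "\<lambda>v. if v = i then 1 else 0" 1] by fastforce
next
  case (add f g)
  then obtain D D' where "f \<in> mono_span V D" "g \<in> mono_span V D'" by blast
  then have "f \<in> mono_span V (max D D')" "g \<in> mono_span V (max D D')"
    using mono_span_le[OF assms(1)] by auto
  then show ?case using mono_span_add by blast
next
  case (mult f g) then show ?case using mono_span_mult[OF assms(1)] by blast
qed

text \<open>With the other variables frozen, the sum is a univariate polynomial in the variable
  \<open>i\<close> that vanishes everywhere. Its coefficients are sums of the same kind in one
  variable fewer.\<close>

lemma mono_funs_independent:
  assumes "finite E" "\<And>y. (\<Sum>\<alpha>\<in>multidegrees E L. c \<alpha> * mono_fun E \<alpha> y) = 0" "\<alpha> \<in> multidegrees E L"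
  shows "c \<alpha> = 0"
  using assms
proof (induction E arbitrary: c \<alpha>)
  case empty
  then show ?case by (simp add: multidegrees_def mono_fun_def)
next
  case (insert i E)
  have eq: "multidegrees (insert i E) L = (\<lambda>(l, \<alpha>). \<alpha>(i := l)) ` ({..L} \<times> multidegrees E L)"
    by (simp add: multidegrees_def PiE_insert_eq)
  have inj: "inj_on (\<lambda>(l, \<alpha>). \<alpha>(i := l)) ({..L} \<times> multidegrees E L)"
    unfolding multidegrees_def by (rule inj_combinator[OF insert.hyps(2)])
  define d where "d = (\<lambda>y l. \<Sum>\<alpha>\<in>multidegrees E L. c (\<alpha>(i := l)) * mono_fun E \<alpha> y)"
  have "d y l = 0" if "l \<le> L" for y l
  proof -
    have "(\<Sum>l\<le>L. d y l * t ^ l) = 0" for t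
    proof -
      have m: "mono_fun (insert i E) (\<alpha>(i := l)) (y(i := t)) = mono_fun E \<alpha> y * t ^ l" for \<alpha> l
      proof -
        have "(\<Prod>v\<in>E. (y(i := t)) v ^ (\<alpha>(i := l)) v) = (\<Prod>v\<in>E. y v ^ \<alpha> v)"
          using insert.hyps by (intro prod.cong) auto
        then show ?thesis using insert.hyps by (simp add: mono_fun_def)
      qed
      have "0 = (\<Sum>(l,\<alpha>)\<in>{..L} \<times> multidegrees E L.
                 c (\<alpha>(i := l)) * mono_fun (insert i E) (\<alpha>(i := l)) (y(i := t)))"
        using insert.prems(1)[of "y(i := t)"] unfolding eq
        by (subst (asm) sum.reindex[OF inj]) (simp add: case_prod_unfold)
      also have "\<dots> = (\<Sum>l\<le>L. \<Sum>\<alpha>\<in>multidegrees E L. (c (\<alpha>(i := l)) * mono_fun E \<alpha> y) * t ^ l)"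
        by (simp add: sum.cartesian_product m algebra_simps)
      finally show ?thesis by (simp add: d_def sum_distrib_right)
    qed
    then show ?thesis using polyfun_eq_0[of "d y" L] that by auto
  qed
  moreover obtain l \<alpha>' where "\<alpha> = \<alpha>'(i := l)" "l \<le> L" "\<alpha>' \<in> multidegrees E L"
    using insert.prems(2) unfolding eq by auto
  ultimately show ?case using insert.IH[of "\<lambda>\<alpha>. c (\<alpha>(i := l))" \<alpha>'] unfolding d_def by blast
qed

text \<open>Counting argument: products of the \<open>F e\<close> with exponents at most \<open>L\<close> are roughly
  \<open>L ^ card E\<close> many, but lie in a space of dimension \<open>O(L ^ card V)\<close>.\<close>

theorem algebraic_dependence:
  assumes fin: "finite V" "finite E" and less: "card V < card E"
    and F: "\<And>e. e \<in> E \<Longrightarrow> F e \<in> polyfuns V"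
  obtains Q where "Q \<in> polyfuns E" "\<exists>y. Q y \<noteq> 0" "\<And>x. Q (\<lambda>e. F e x) = 0"
proof -
  have "\<forall>e\<in>E. \<exists>D. F e \<in> mono_span V D" using polyfuns_mono_span[OF fin(1) F] by blast
  then obtain D' where D': "\<forall>e\<in>E. F e \<in> mono_span V (D' e)" by metis
  define D where "D = Max (D' ` E)"
  have D: "F e \<in> mono_span V D" if "e \<in> E" for e
    using D' that fin(2) by (intro mono_span_le[OF fin(1), of _ "D' e" D]) (auto simp: D_def)
  define m where "m = card E"
  \<comment> \<open>Chosen to absorb the constant factor: with \<open>v = card V\<close>, the
    dimension is at most \<open>(Suc (m * D) * Suc L) ^ v = L * Suc L ^ v\<close>, which is below
    \<open>Suc L ^ Suc v\<close>.\<close>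
  define L where "L = Suc (m * D) ^ card V"
  have "\<exists>c. \<forall>z. mono_fun E \<alpha> (\<lambda>e. F e z) = (\<Sum>\<beta>\<in>multidegrees V (m * (L * D)). c \<beta> * mono_fun V \<beta> z)"
    if "\<alpha> \<in> multidegrees E L" for \<alpha>
  proof -
    have "(\<lambda>z. \<Prod>e\<in>E. F e z ^ \<alpha> e) \<in> mono_span V (m * (L * D))"
      unfolding m_def
    proof (intro mono_span_prod fin)
      fix e assume e: "e \<in> E"
      then have "\<alpha> e \<le> L" using that by (auto simp: multidegrees_def)
      then show "(\<lambda>z. F e z ^ \<alpha> e) \<in> mono_span V (L * D)"
        by (intro mono_span_le[OF fin(1) mono_span_power[OF fin(1) D[OF e]]]) simp
    qed
    then show ?thesis by (simp add: mono_span_def mono_fun_def)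
  qed
  then obtain a where a: "\<And>\<alpha> z. \<alpha> \<in> multidegrees E L \<Longrightarrow>
    mono_fun E \<alpha> (\<lambda>e. F e z) = (\<Sum>\<beta>\<in>multidegrees V (m * (L * D)). a \<alpha> \<beta> * mono_fun V \<beta> z)"
    by metis
  have "card (multidegrees V (m * (L * D))) = Suc (m * (L * D)) ^ card V"
    by (rule card_multidegrees[OF fin(1)])
  also have "\<dots> \<le> (Suc (m * D) * Suc L) ^ card V"
    by (intro power_mono) (auto simp: algebra_simps)
  also have "\<dots> = L * Suc L ^ card V" by (simp only: power_mult_distrib L_def)
  also have "\<dots> < Suc L ^ Suc (card V)" by simp
  also have "\<dots> \<le> Suc L ^ card E" using less by (intro power_increasing) auto
  also have "\<dots> = card (multidegrees E L)" by (rule card_multidegrees[OF fin(2), symmetric])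
  finally have "card (multidegrees V (m * (L * D))) < card (multidegrees E L)" .
  from homogeneous_system_nontrivial_solution[OF finite_multidegrees[OF fin(1)]
      finite_multidegrees[OF fin(2)] this, of "\<lambda>\<beta> \<alpha>. a \<alpha> \<beta>"]
  obtain c where c: "\<exists>\<alpha>\<in>multidegrees E L. c \<alpha> \<noteq> 0"
    "\<forall>\<beta>\<in>multidegrees V (m * (L * D)). (\<Sum>\<alpha>\<in>multidegrees E L. a \<alpha> \<beta> * c \<alpha>) = 0"
    by (elim exE conjE)
  define Q where "Q = (\<lambda>y. \<Sum>\<alpha>\<in>multidegrees E L. c \<alpha> * mono_fun E \<alpha> y)"
  have "Q \<in> polyfuns E" unfolding Q_def mono_fun_def by (intro polyfuns_intros)
  moreover have "\<exists>y. Q y \<noteq> 0"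
    using mono_funs_independent[OF fin(2), where L = L and c = c] c(1) unfolding Q_def by blast
  moreover have "Q (\<lambda>e. F e x) = 0" for x
  proof -
    have "Q (\<lambda>e. F e x) = (\<Sum>\<beta>\<in>multidegrees V (m * (L * D)).
        (\<Sum>\<alpha>\<in>multidegrees E L. a \<alpha> \<beta> * c \<alpha>) * mono_fun V \<beta> x)"
      unfolding Q_def sum_distrib_right
      by (subst sum.swap) (simp add: a sum_distrib_left algebra_simps)
    then show ?thesis using c(2) by simp
  qed
  ultimately show ?thesis using that by blast
qed

section \<open>Images of dominant polynomial maps\<close>


definition alg_indep :: "'e set \<Rightarrow> ('e \<Rightarrow> ('v \<Rightarrow> complex) \<Rightarrow> complex) \<Rightarrow> bool" where
  "alg_indep E F \<longleftrightarrow> (\<forall>Q\<in>polyfuns E. (\<forall>x. Q (\<lambda>e. F e x) = 0) \<longrightarrow> (\<forall>y. Q y = 0))"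

text \<open>\<open>card_le\<close> leaves no room for a further independent function, so every
  polynomial function of the variables is algebraic over the ring generated by the
  \<open>F e\<close>.\<close>

locale square_alg_indep =
  fixes E :: "'e set" and V :: "'v set" and F :: "'e \<Rightarrow> ('v \<Rightarrow> complex) \<Rightarrow> complex"
  assumes finE: "finite E" and finV: "finite V" and card_le: "card V \<le> card E"
    and F: "\<And>e. e \<in> E \<Longrightarrow> F e \<in> polyfuns V"
    and indep: "alg_indep E F"
begin

text \<open>The family \<open>F\<close> with \<open>v\<close> adjoined at index \<open>None\<close>
  has more members than variables and so satisfies a relation, read as a polynomial in the slot of
  \<open>v\<close>. Independence of \<open>F\<close> prevents all its coefficients from vanishing
  along \<open>F\<close>.\<close>

lemma polyfun_algebraic:
  assumes v: "v \<in> polyfuns V"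
  obtains p where "p \<in> polys_over (polyfuns E)" "\<And>x. poly (p (\<lambda>e. F e x)) (v x) = 0"
    "\<exists>x. p (\<lambda>e. F e x) \<noteq> 0"
proof -
  define G where "G = (\<lambda>i x. case i of Some e \<Rightarrow> F e x | None \<Rightarrow> v x)"
  obtain Q where Q: "Q \<in> polyfuns (insert None (Some ` E))" "\<exists>y. Q y \<noteq> 0" "\<And>x. Q (\<lambda>i. G i x) = 0"
  proof (rule algebraic_dependence[of V "insert None (Some ` E)" G])
    show "card V < card (insert None (Some ` E))"
      using finE card_le by (simp add: card_insert_if card_image)
    show "G e \<in> polyfuns V" if "e \<in> insert None (Some ` E)" for e
      using that F v by (auto simp: G_def)
  qed (use finE finV in auto)
  obtain p' where p': "p' \<in> polys_over (polyfuns (Some ` E))" "\<And>z. Q z = poly (p' z) (z None)"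
    using polyfuns_insert_poly[OF Q(1)] by auto
  define p where "p = (\<lambda>y. p' (case_option 0 y))"
  have p: "p \<in> polys_over (polyfuns E)"
  proof -
    have "(\<lambda>y. coeff (p y) i) \<in> polyfuns E" for i
      unfolding p_def
      by (rule polyfuns_compose[OF polys_over_coeff[OF p'(1)]]) (auto intro: polyfuns_intros)
    moreover have "\<exists>n. \<forall>y. degree (p y) \<le> n"
      using p'(1) by (auto simp: polys_over_def p_def)
    ultimately show ?thesis by (auto simp: polys_over_def)
  qed
  have p'_eq: "p' z = p (\<lambda>e. z (Some e))" for z
    unfolding p_def
    by (rule poly_eqI, rule polyfuns_cong[OF polys_over_coeff[OF p'(1)]]) auto
  have "poly (p (\<lambda>e. F e x)) (v x) = 0" for x
    using Q(3)[of x] p'(2) by (simp add: p'_eq G_def)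
  moreover have "\<exists>x. p (\<lambda>e. F e x) \<noteq> 0"
  proof (rule ccontr)
    assume "\<nexists>x. p (\<lambda>e. F e x) \<noteq> 0"
    then have "\<forall>x. coeff (p (\<lambda>e. F e x)) i = 0" for i by simp
    then have "\<forall>y. coeff (p y) i = 0" for i
      using indep polys_over_coeff[OF p, of i] unfolding alg_indep_def by blast
    then have "p y = 0" for y by (intro poly_eqI) simp
    then show False using Q(2) by (simp add: p'(2) p'_eq)
  qed
  ultimately show ?thesis using that p by blast
qed

text \<open>The powers of the unknown common to all terms of an algebraic relation are cancelled,
  which is legitimate since polynomial functions form an integral domain and \<open>v\<close> is
  nonzero. Where the constant coefficient does not vanish, zero is no root.\<close>

lemma polyfun_algebraic_nonzero_const:
  assumes v: "v \<in> polyfuns V" "\<exists>x. v x \<noteq> 0"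
  obtains p where "p \<in> polys_over (polyfuns E)" "\<And>x. poly (p (\<lambda>e. F e x)) (v x) = 0"
    "\<exists>y. coeff (p y) 0 \<noteq> 0"
proof -
  obtain q where q: "q \<in> polys_over (polyfuns E)" "\<And>x. poly (q (\<lambda>e. F e x)) (v x) = 0"
    "\<exists>x. q (\<lambda>e. F e x) \<noteq> 0"
    using polyfun_algebraic[OF v(1)] by blast
  then have "\<exists>i y. coeff (q y) i \<noteq> 0" by (metis coeff_0 poly_eqI)
  define i where "i = (LEAST i. \<exists>y. coeff (q y) i \<noteq> 0)"
  have i: "\<exists>y. coeff (q y) i \<noteq> 0"
    unfolding i_def by (rule LeastI_ex) fact
  have less: "coeff (q y) j = 0" if "j < i" for y j
    using not_less_Least[of j "\<lambda>i. \<exists>y. coeff (q y) i \<noteq> 0"] that by (auto simp: i_def)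
  define p where "p = (\<lambda>y. poly_shift i (q y))"
  have qp: "q y = monom 1 i * p y" for y
    by (rule poly_eqI) (simp add: coeff_monom_mult p_def coeff_poly_shift less)
  have p: "p \<in> polys_over (polyfuns E)"
  proof -
    obtain n where n: "\<forall>y. degree (q y) \<le> n" using q(1) by (auto simp: polys_over_def)
    have "degree (p y) \<le> n" for y
      using n[rule_format, of y] by (intro degree_le) (auto simp: p_def coeff_poly_shift intro!: coeff_eq_0)
    then show ?thesis using q(1) by (auto simp: polys_over_def p_def coeff_poly_shift)
  qed
  define r where "r = (\<lambda>x. poly (p (\<lambda>e. F e x)) (v x))"
  obtain n where n: "\<forall>y. degree (p y) \<le> n" using p by (auto simp: polys_over_def)
  have r_eq: "r x = (\<Sum>j\<le>n. coeff (p (\<lambda>e. F e x)) j * v x ^ j)" for x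
    unfolding r_def using n by (subst poly_altdef)
      (auto intro!: sum.mono_neutral_left intro: coeff_eq_0 le_degree)
  have "r \<in> polyfuns V"
    unfolding r_eq[abs_def]
    by (intro polyfuns_sum polyfuns.mult polyfuns_power v
        polyfuns_compose[OF polys_over_coeff[OF p]]) (use F in auto)
  moreover have "v x ^ i * r x = 0" for x
    using q(2)[of x] by (simp add: qp r_def poly_monom)
  ultimately have "(\<forall>x. v x ^ i = 0) \<or> (\<forall>x. r x = 0)"
    using polyfuns_mult_eq_0[OF polyfuns_power[OF v(1), of i], of r V] by blast
  then have "r x = 0" for x using v(2) by auto
  moreover have "\<exists>y. coeff (p y) 0 \<noteq> 0" using i by (simp add: p_def coeff_poly_shift)
  ultimately show ?thesis using that p by (simp add: r_def)
qed

text \<open>Points of \<open>rel_zeros W\<close> are the ring homomorphisms to the complex numbers from the ring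
  generated by the \<open>F e\<close> and the coordinates in \<open>W\<close>.\<close>

definition graph :: "('v \<Rightarrow> complex) \<Rightarrow> 'e + 'v \<Rightarrow> complex" where
  "graph x = case_sum (\<lambda>e. F e x) x"

definition coords :: "'v set \<Rightarrow> ('e + 'v) set" where
  "coords W = Inl ` E \<union> Inr ` W"

definition rel_zeros :: "'v set \<Rightarrow> ('e + 'v \<Rightarrow> complex) set" where
  "rel_zeros W = {z. \<forall>Q\<in>polyfuns (coords W). (\<forall>x. Q (graph x) = 0) \<longrightarrow> Q z = 0}"

lemma graph_coord: "W \<subseteq> V \<Longrightarrow> i \<in> coords W \<Longrightarrow> (\<lambda>x. graph x i) \<in> polyfuns V"
  using F by (auto simp: graph_def coords_def intro!: polyfuns.var)

lemma polyfuns_Inl: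
  "f \<in> polyfuns E \<Longrightarrow> (\<lambda>z. f (\<lambda>e. z (Inl e))) \<in> polyfuns (coords W)"
  by (erule polyfuns_compose) (auto simp: coords_def intro: polyfuns_intros)

text \<open>The relation satisfied by \<open>l\<close> over the ring of the \<open>F e\<close>
  persists at every point of \<open>rel_zeros W\<close>. Thus a condition on the
  \<open>E\<close>-coordinates alone, nonvanishing of the constant coefficient, keeps
  \<open>l\<close> from vanishing.\<close>

lemma nonvanishing_condition:
  assumes l: "l \<in> polyfuns (coords W)" "\<exists>x. l (graph x) \<noteq> 0" and W: "W \<subseteq> V"
  obtains c where "c \<in> polyfuns E" "\<exists>y. c y \<noteq> 0"
    "\<And>z. z \<in> rel_zeros W \<Longrightarrow> c (\<lambda>e. z (Inl e)) \<noteq> 0 \<Longrightarrow> l z \<noteq> 0"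
proof -
  define v where "v = (\<lambda>x. l (graph x))"
  have v: "v \<in> polyfuns V" "\<exists>x. v x \<noteq> 0"
    using l(2) polyfuns_compose[OF l(1) graph_coord[OF W]] by (auto simp: v_def)
  obtain p where p: "p \<in> polys_over (polyfuns E)" "\<And>x. poly (p (\<lambda>e. F e x)) (v x) = 0"
    "\<exists>y. coeff (p y) 0 \<noteq> 0" using polyfun_algebraic_nonzero_const[OF v] by blast
  obtain n where n: "\<forall>y. degree (p y) \<le> n" using p(1) by (auto simp: polys_over_def)
  define Q where "Q = (\<lambda>z. \<Sum>j\<le>n. coeff (p (\<lambda>e. z (Inl e))) j * l z ^ j)"
  have Q_eq: "Q z = poly (p (\<lambda>e. z (Inl e))) (l z)" for z
    unfolding Q_def using n by (subst poly_altdef)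
      (auto intro!: sum.mono_neutral_right intro: coeff_eq_0 le_degree)
  have "Q \<in> polyfuns (coords W)"
    unfolding Q_def by (intro polyfuns_sum polyfuns.mult polyfuns_power l
      polyfuns_Inl[OF polys_over_coeff[OF p(1)]])
  moreover have "Q (graph x) = 0" for x using p(2)[of x] by (simp add: Q_eq v_def graph_def)
  ultimately have Q0: "Q z = 0" if "z \<in> rel_zeros W" for z using that by (auto simp: rel_zeros_def)
  have "l z \<noteq> 0" if "z \<in> rel_zeros W" "coeff (p (\<lambda>e. z (Inl e))) 0 \<noteq> 0" for z
  proof
    assume "l z = 0"
    then show False using Q0[OF that(1)] that(2)
      by (simp add: Q_eq poly_0_coeff_0)
  qed
  then show ?thesis using that[of "\<lambda>y. coeff (p y) 0"] p polys_over_coeff[OF p(1)] by blast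
qed

text \<open>Extends a homomorphism to one more coordinate \<open>w\<close>. Take a relation
  \<open>p\<close> for \<open>w\<close> of least degree; where its leading coefficient survives,
  send \<open>w\<close> to a root \<open>t\<close> of \<open>p z\<close>. Any other relation for
  \<open>w\<close> is respected too, since its pseudo-remainder modulo \<open>p\<close> is trivial
  by minimality.\<close>

lemma rel_zeros_extend:
  assumes W: "insert w W \<subseteq> V" "w \<notin> W"
  obtains c where "c \<in> polyfuns E" "\<exists>y. c y \<noteq> 0"
    "\<And>z. z \<in> rel_zeros W \<Longrightarrow> c (\<lambda>e. z (Inl e)) \<noteq> 0 \<Longrightarrow> \<exists>t. z(Inr w := t) \<in> rel_zeros (insert w W)"
proof -
  let ?B = "polyfuns (coords W)"
  have coords_insert: "coords (insert w W) = insert (Inr w) (coords W)" by (auto simp: coords_def)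
  have w_notin: "Inr w \<notin> coords W" using W by (auto simp: coords_def)
  \<comment> \<open>Nontriviality of a relation is demanded along \<open>graph\<close>, that is,
    modulo the relations among the coordinates in \<open>W\<close>.\<close>
  define rel where "rel = (\<lambda>p n. p \<in> polys_over ?B \<and> (\<forall>z. degree (p z) \<le> n) \<and>
    (\<forall>x. poly (p (graph x)) (x w) = 0))"
  have "\<exists>n p. rel p n \<and> (\<exists>x. p (graph x) \<noteq> 0)"
  proof -
    have "(\<lambda>x. x w) \<in> polyfuns V" using W by (auto intro: polyfuns_intros)
    then obtain p where p: "p \<in> polys_over (polyfuns E)" "\<And>x. poly (p (\<lambda>e. F e x)) (x w) = 0"
      "\<exists>x. p (\<lambda>e. F e x) \<noteq> 0" using polyfun_algebraic by blast
    obtain n where n: "\<forall>y. degree (p y) \<le> n" using p(1) by (auto simp: polys_over_def)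
    have "rel (\<lambda>z. p (\<lambda>e. z (Inl e))) n"
      using p n polyfuns_Inl[OF polys_over_coeff[OF p(1)]]
      unfolding rel_def polys_over_def by (auto simp: graph_def)
    then show ?thesis using p(3)
      by (intro exI[of _ n] exI[of _ "\<lambda>z. p (\<lambda>e. z (Inl e))"]) (auto simp: graph_def)
  qed
  then obtain n where n: "\<exists>p. rel p n \<and> (\<exists>x. p (graph x) \<noteq> 0)"
    and min: "\<And>m. m < n \<Longrightarrow> \<not> (\<exists>p. rel p m \<and> (\<exists>x. p (graph x) \<noteq> 0))"
    using exists_least_iff[of "\<lambda>n. \<exists>p. rel p n \<and> (\<exists>x. p (graph x) \<noteq> 0)"] by blast
  obtain p where p: "rel p n" "\<exists>x. p (graph x) \<noteq> 0" using n by blast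
  have p1: "p \<in> polys_over ?B" "\<And>z. degree (p z) \<le> n" "\<And>x. poly (p (graph x)) (x w) = 0"
    using p(1) by (auto simp: rel_def)
  define l where "l = (\<lambda>z. coeff (p z) n)"
  have l: "l \<in> ?B" unfolding l_def by (rule polys_over_coeff[OF p1(1)])
  have deg0: "p (graph x) = [:l (graph x):]" if "n = 0" for x
    using p1(2)[of "graph x"] that by (auto simp: l_def elim!: degree_eq_zeroE)
  have npos: "n > 0"
  proof (rule ccontr)
    assume "\<not> n > 0"
    then have "p (graph x) = 0" for x using deg0[of x] p1(3)[of x] by simp
    then show False using p(2) by simp
  qed
  \<comment> \<open>Otherwise dropping the top term would give a nontrivial relation of smaller
    degree.\<close>
  have l_nz: "\<exists>x. l (graph x) \<noteq> 0"
  proof (rule ccontr)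
    assume contr: "\<not> ?thesis"
    define q where "q = (\<lambda>z. p z - monom (l z) n)"
    have "q \<in> polys_over ?B" unfolding q_def
      by (intro polys_over_diff polys_over_monom subalgebra_polyfuns p1 l)
    moreover have "degree (q z) \<le> n - 1" for z
    proof (rule degree_le, intro allI impI)
      fix i assume "n - 1 < i"
      then have "i = n \<or> degree (p z) < i" using p1(2)[of z] by linarith
      then show "coeff (q z) i = 0" by (auto simp: q_def l_def coeff_eq_0)
    qed
    moreover have "q (graph x) = p (graph x)" for x using contr by (simp add: q_def)
    ultimately have "rel q (n - 1)" "\<exists>x. q (graph x) \<noteq> 0" using p(2) p1(3) by (auto simp: rel_def)
    then show False using min[of "n - 1"] npos by auto
  qed
  obtain c where c: "c \<in> polyfuns E" "\<exists>y. c y \<noteq> 0"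
    "\<And>z. z \<in> rel_zeros W \<Longrightarrow> c (\<lambda>e. z (Inl e)) \<noteq> 0 \<Longrightarrow> l z \<noteq> 0"
    using nonvanishing_condition[OF l l_nz] W by auto
  have "\<exists>t. z(Inr w := t) \<in> rel_zeros (insert w W)"
    if z: "z \<in> rel_zeros W" "c (\<lambda>e. z (Inl e)) \<noteq> 0" for z
  proof -
    have lz: "l z \<noteq> 0" using c(3) z by blast
    then have "n \<le> degree (p z)" unfolding l_def by (rule le_degree)
    then have "degree (p z) > 0" using npos by linarith
    from alg_closed_imp_poly_has_root[OF this] obtain t where t: "poly (p z) t = 0" ..
    have "Q (z(Inr w := t)) = 0"
      if Q: "Q \<in> polyfuns (coords (insert w W))" "\<And>x. Q (graph x) = 0" for Q
    proof -
      have "Q \<in> polyfuns (insert (Inr w) (coords W))" using Q(1) by (simp add: coords_insert)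
      then obtain r where r: "r \<in> polys_over ?B" "\<And>z. Q z = poly (r z) (z (Inr w))"
        by (rule polyfuns_insert_poly) (rule that)
      obtain k s t' where st: "s \<in> polys_over ?B" "t' \<in> polys_over ?B" "\<And>z. degree (t' z) < n"
        "\<And>z. Polynomial.smult (l z ^ k) (r z) = p z * s z + t' z"
        using polys_over_pseudo_division[OF subalgebra_polyfuns p1(1,2) r(1) npos]
        unfolding l_def by blast
      have "poly (t' (graph x)) (x w) = 0" for x
      proof -
        have "poly (r (graph x)) (x w) = 0" using Q(2)[of x] r(2) by (simp add: graph_def)
        then have "poly (Polynomial.smult (l (graph x) ^ k) (r (graph x))) (x w) = 0" by simp
        then show ?thesis unfolding st(4) by (simp add: p1(3))
      qed
      moreover have "degree (t' z) \<le> n - 1" for z using st(3)[of z] by linarith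
      ultimately have "rel t' (n - 1)" using st(2) by (auto simp: rel_def)
      then have "t' (graph x) = 0" for x using min[of "n - 1"] npos by auto
      \<comment> \<open>Each coefficient of \<open>t'\<close> vanishes on the graph, hence also at
        \<open>z\<close>, which satisfies all relations over \<open>W\<close>.\<close>
      then have "coeff (t' z) i = 0" for i
        using z(1) polys_over_coeff[OF st(2), of i] by (auto simp: rel_zeros_def)
      then have "t' z = 0" by (intro poly_eqI) simp
      then have "poly (Polynomial.smult (l z ^ k) (r z)) t = 0" unfolding st(4) by (simp add: t)
      then have "poly (r z) t = 0" using lz by simp
      moreover have "r (z(Inr w := t)) = r z"
        by (rule poly_eqI, rule polyfuns_cong[OF polys_over_coeff[OF r(1)]]) (use w_notin in auto)
      ultimately show ?thesis by (simp add: r(2))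
    qed
    then show ?thesis by (auto simp: rel_zeros_def)
  qed
  with c that show ?thesis by blast
qed

text \<open>Before any coordinate is adjoined every point qualifies, because independence of
  \<open>F\<close> leaves only trivial relations. Each adjoined coordinate contributes one factor to
  \<open>g\<close>.\<close>

lemma rel_zeros_all:
  assumes "finite W" "W \<subseteq> V"
  shows "\<exists>g\<in>polyfuns E. (\<exists>y. g y \<noteq> 0) \<and>
    (\<forall>y. g y \<noteq> 0 \<longrightarrow> (\<exists>z\<in>rel_zeros W. \<forall>e. z (Inl e) = y e))"
  using assms
proof (induction W)
  case empty
  have "case_sum y (\<lambda>_. 0) \<in> rel_zeros {}" for y
  proof -
    have "Q (case_sum y (\<lambda>_. 0)) = 0"
      if Q: "Q \<in> polyfuns (coords {})" "\<forall>x. Q (graph x) = 0" for Q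
    proof -
      have "(\<lambda>y. Q (case_sum y (\<lambda>_. 0))) \<in> polyfuns E"
        by (rule polyfuns_compose[OF Q(1)]) (auto simp: coords_def intro: polyfuns_intros)
      moreover have "Q (case_sum (\<lambda>e. F e x) (\<lambda>_. 0)) = Q (graph x)" for x
        by (rule polyfuns_cong[OF Q(1)]) (auto simp: coords_def graph_def)
      ultimately show ?thesis using indep Q(2) by (auto simp: alg_indep_def)
    qed
    then show ?thesis by (auto simp: rel_zeros_def)
  qed
  then show ?case
    by (intro bexI[of _ "\<lambda>_. 1"] conjI allI impI bexI[of _ "case_sum _ (\<lambda>_. 0)"])
      (auto intro: polyfuns_intros)
next
  case (insert w W)
  then obtain g where g: "g \<in> polyfuns E" "\<exists>y. g y \<noteq> 0"
    "\<And>y. g y \<noteq> 0 \<Longrightarrow> \<exists>z\<in>rel_zeros W. \<forall>e. z (Inl e) = y e" by auto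
  obtain c where c: "c \<in> polyfuns E" "\<exists>y. c y \<noteq> 0"
    "\<And>z. z \<in> rel_zeros W \<Longrightarrow> c (\<lambda>e. z (Inl e)) \<noteq> 0 \<Longrightarrow> \<exists>t. z(Inr w := t) \<in> rel_zeros (insert w W)"
    using rel_zeros_extend insert.prems insert.hyps by blast
  have "\<exists>z\<in>rel_zeros (insert w W). \<forall>e. z (Inl e) = y e" if y: "g y * c y \<noteq> 0" for y
  proof -
    have "g y \<noteq> 0" using y by auto
    then obtain z where z: "z \<in> rel_zeros W" "\<forall>e. z (Inl e) = y e" using g(3) by blast
    then have "(\<lambda>e. z (Inl e)) = y" by auto
    then obtain t where "z(Inr w := t) \<in> rel_zeros (insert w W)" using c(3)[OF z(1)] y by auto
    then show ?thesis using z by (intro bexI[of _ "z(Inr w := t)"]) auto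
  qed
  moreover have "\<exists>y. g y * c y \<noteq> 0" using polyfuns_mult_eq_0[OF g(1) c(1)] g(2) c(2) by blast
  ultimately show ?case using g c by (intro bexI[of _ "\<lambda>y. g y * c y"]) (auto intro: polyfuns_intros)
qed

text \<open>Once all variables are adjoined, the equations saying that coordinate
  \<open>Inl e\<close> is the value of \<open>F e\<close> are among the relations, so the
  \<open>V\<close>-part of a point of \<open>rel_zeros V\<close> is a preimage.\<close>

theorem dominant_map_image:
  assumes v: "v \<in> polyfuns V" "\<exists>x. v x \<noteq> 0"
  obtains g where "g \<in> polyfuns E" "\<exists>y. g y \<noteq> 0"
    "\<And>y. g y \<noteq> 0 \<Longrightarrow> \<exists>x. (\<forall>e\<in>E. F e x = y e) \<and> v x \<noteq> 0"
proof -
  obtain g where g: "g \<in> polyfuns E" "\<exists>y. g y \<noteq> 0"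
    "\<And>y. g y \<noteq> 0 \<Longrightarrow> \<exists>z\<in>rel_zeros V. \<forall>e. z (Inl e) = y e"
    using rel_zeros_all[OF finV] by auto
  have Inr: "(\<lambda>z. f (\<lambda>i. z (Inr i))) \<in> polyfuns (coords V)" if "f \<in> polyfuns V" for f
    using that by (rule polyfuns_compose) (auto simp: coords_def intro: polyfuns_intros)
  obtain c where c: "c \<in> polyfuns E" "\<exists>y. c y \<noteq> 0"
    "\<And>z. z \<in> rel_zeros V \<Longrightarrow> c (\<lambda>e. z (Inl e)) \<noteq> 0 \<Longrightarrow> v (\<lambda>i. z (Inr i)) \<noteq> 0"
    using nonvanishing_condition[OF Inr[OF v(1)]] v(2) by (auto simp: graph_def)
  have "\<exists>x. (\<forall>e\<in>E. F e x = y e) \<and> v x \<noteq> 0" if y: "g y * c y \<noteq> 0" for y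
  proof -
    have "g y \<noteq> 0" using y by auto
    then obtain z where z: "z \<in> rel_zeros V" "\<forall>e. z (Inl e) = y e" using g(3) by blast
    then have "(\<lambda>e. z (Inl e)) = y" by auto
    then have "v (\<lambda>i. z (Inr i)) \<noteq> 0" using c(3)[OF z(1)] y by auto
    moreover have "F e (\<lambda>i. z (Inr i)) = y e" if e: "e \<in> E" for e
    proof -
      define Q where "Q = (\<lambda>z. F e (\<lambda>i. z (Inr i)) - z (Inl e))"
      have "Q \<in> polyfuns (coords V)" unfolding Q_def
        using e by (intro polyfuns_diff Inr F polyfuns.var) (auto simp: coords_def)
      moreover have "Q (graph x) = 0" for x by (simp add: Q_def graph_def)
      ultimately have "Q z = 0" using z(1) by (auto simp: rel_zeros_def)
      then show ?thesis using z(2) by (simp add: Q_def)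
    qed
    ultimately show ?thesis by blast
  qed
  moreover have "\<exists>y. g y * c y \<noteq> 0" using polyfuns_mult_eq_0[OF g(1) c(1)] g(2) c(2) by blast
  ultimately show ?thesis using g c that[of "\<lambda>y. g y * c y"] by (auto intro: polyfuns_intros)
qed

end

section \<open>Curves through a zero; almost sure nonvanishing\<close>


lemma isCont_polyfun:
  assumes "f \<in> polyfuns V" "\<And>i. i \<in> V \<Longrightarrow> isCont (\<lambda>t. \<gamma> t i) (a::complex)"
  shows "isCont (\<lambda>t. f (\<gamma> t)) a"
  using assms by induction auto

text \<open>\<open>c r\<close> plays the part of the homogeneous component of degree
  \<open>r\<close> at \<open>z0\<close>. Since \<open>t\<close> and \<open>w\<close> are independent
  in the identity, the direction may later be made to depend on \<open>t\<close>.\<close>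

lemma polyfun_homogeneous_expansion:
  assumes "f \<in> polyfuns V"
  obtains n c where "\<And>r. c r \<in> polyfuns V" "\<And>t w. f (\<lambda>i. z0 i + t * w i) = (\<Sum>r\<le>n. c r w * t ^ r)"
proof -
  define C where "C = {h. \<exists>g\<in>polyfuns V. h = (\<lambda>(t::complex, w). g w)}"
  have C: "subalgebra C"
    by (auto simp: C_def subalgebra_def case_prod_unfold intro: polyfuns_intros)
  have CI: "(\<lambda>x. g (snd x)) \<in> C" if "g \<in> polyfuns V" for g
    using that by (auto simp: C_def case_prod_unfold)
  have "\<exists>p\<in>polys_over C. \<forall>t w. f (\<lambda>i. z0 i + t * w i) = poly (p (t, w)) t"
    using assms
  proof induction
    case (const c)
    show ?case
      by (intro bexI[of _ "\<lambda>x. [:c:]"] polys_over_pCons[OF C]) (use C in \<open>auto simp: subalgebra_def\<close>)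
  next
    case (var i)
    have "(\<lambda>x. [:z0 i:] + monom (snd x i) 1) \<in> polys_over C"
      using var C
      by (intro polys_over_add[OF C] polys_over_pCons[OF C] polys_over_monom[OF C] CI)
        (auto simp: subalgebra_def intro: polyfuns_intros)
    then show ?case by (rule bexI[rotated]) (simp add: poly_monom mult.commute)
  next
    case (add f g)
    then obtain p q where "p \<in> polys_over C" "\<And>t w. f (\<lambda>i. z0 i + t * w i) = poly (p (t, w)) t"
      "q \<in> polys_over C" "\<And>t w. g (\<lambda>i. z0 i + t * w i) = poly (q (t, w)) t" by blast
    then show ?case by (intro bexI[OF _ polys_over_add[OF C, of p q]]) auto
  next
    case (mult f g)
    then obtain p q where "p \<in> polys_over C" "\<And>t w. f (\<lambda>i. z0 i + t * w i) = poly (p (t, w)) t"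
      "q \<in> polys_over C" "\<And>t w. g (\<lambda>i. z0 i + t * w i) = poly (q (t, w)) t" by blast
    then show ?case by (intro bexI[OF _ polys_over_mult[OF C, of p q]]) auto
  qed
  then obtain p where p: "p \<in> polys_over C" "\<And>t w. f (\<lambda>i. z0 i + t * w i) = poly (p (t, w)) t"
    by blast
  obtain n where n: "\<forall>x. degree (p x) \<le> n" using p(1) by (auto simp: polys_over_def)
  have "\<forall>r. \<exists>g\<in>polyfuns V. \<forall>t w. coeff (p (t, w)) r = g w"
  proof
    fix r
    have "(\<lambda>x. coeff (p x) r) \<in> C" by (rule polys_over_coeff[OF p(1)])
    then obtain g where "g \<in> polyfuns V" "(\<lambda>x. coeff (p x) r) = (\<lambda>(t, w). g w)"
      by (auto simp: C_def)
    then show "\<exists>g\<in>polyfuns V. \<forall>t w. coeff (p (t, w)) r = g w"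
      using fun_cong[of "\<lambda>x. coeff (p x) r"] by (intro bexI[of _ g] allI) (metis case_prod_conv)
  qed
  then obtain c where c: "\<And>r. c r \<in> polyfuns V" "\<And>r t w. coeff (p (t, w)) r = c r w" by metis
  have "f (\<lambda>i. z0 i + t * w i) = (\<Sum>r\<le>n. c r w * t ^ r)" for t w
    unfolding p(2) c(2)[symmetric, of _ w t] using n by (subst poly_altdef)
      (auto intro!: sum.mono_neutral_left intro: coeff_eq_0 le_degree)
  with c(1) show ?thesis by (rule that)
qed

text \<open>The lowest homogeneous part of \<open>P\<close> at \<open>z0\<close> would vanish in every direction. This replaces the
  Jacobian criterion for algebraic independence.\<close>

lemma polyfun_zero_by_curves:
  assumes P: "P \<in> polyfuns E"
    and curves: "\<And>w. \<exists>\<gamma>. (\<forall>t. P (\<gamma> t) = 0) \<and> (\<forall>e\<in>E. \<gamma> 0 e = z0 e) \<and>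
      (\<forall>e\<in>E. ((\<lambda>t. \<gamma> t e) has_field_derivative w e) (at 0))"
  shows "P y = 0"
proof -
  obtain n c where c: "\<And>r. c r \<in> polyfuns E"
    and P_eq: "\<And>t w. P (\<lambda>i. z0 i + t * w i) = (\<Sum>r\<le>n. c r w * t ^ r)"
    using polyfun_homogeneous_expansion[OF P, of z0 thesis] by blast
  have "\<forall>w. c r w = 0" if "r \<le> n" for r
    using that
  proof (induction r rule: less_induct)
    case (less r)
    show ?case
    proof
      fix w
      obtain \<gamma> where \<gamma>: "\<And>t. P (\<gamma> t) = 0" "\<And>e. e \<in> E \<Longrightarrow> \<gamma> 0 e = z0 e"
        "\<And>e. e \<in> E \<Longrightarrow> ((\<lambda>t. \<gamma> t e) has_field_derivative w e) (at 0)"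
        using curves[of w] by blast
      \<comment> \<open>The difference quotient, completed by the derivative at 0: it is continuous
        there, and the curve is \<open>z0 + t * \<delta> t\<close> for
        \<open>t \<noteq> 0\<close>.\<close>
      define \<delta> where "\<delta> = (\<lambda>t e. if t = 0 then w e else (\<gamma> t e - z0 e) / t)"
      have cont: "isCont (\<lambda>t. \<delta> t e) 0" if "e \<in> E" for e
      proof -
        have "((\<lambda>t. (\<gamma> t e - \<gamma> 0 e) / (t - 0)) \<longlongrightarrow> w e) (at 0)"
          using \<gamma>(3)[OF that] unfolding has_field_derivative_iff by simp
        then have "((\<lambda>t. \<delta> t e) \<longlongrightarrow> w e) (at 0)"
          by (rule Lim_transform_eventually)
            (auto simp: \<delta>_def \<gamma>(2)[OF that] eventually_at_filter)
        then show ?thesis by (simp add: isCont_def \<delta>_def)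
      qed
      \<comment> \<open>The expansion divided by \<open>t ^ r\<close>, the lower parts being zero by
        induction. It vanishes for \<open>t \<noteq> 0\<close>, so continuity gives
        \<open>c r w = 0\<close>.\<close>
      define h where "h = (\<lambda>t. \<Sum>s\<in>{r..n}. c s (\<delta> t) * t ^ (s - r))"
      have "h t = 0" if t: "t \<noteq> 0" for t
      proof -
        have "0 = P (\<lambda>e. z0 e + t * \<delta> t e)"
          using \<gamma>(1)[of t] t by (simp add: \<delta>_def)
        also have "\<dots> = (\<Sum>s\<le>n. c s (\<delta> t) * t ^ s)" by (rule P_eq)
        also have "\<dots> = (\<Sum>s\<in>{r..n}. c s (\<delta> t) * t ^ s)"
          using less by (intro sum.mono_neutral_right) auto
        also have "\<dots> = t ^ r * h t"
          unfolding h_def sum_distrib_left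
          by (intro sum.cong) (auto simp: power_add[symmetric] algebra_simps)
        finally show ?thesis using t by simp
      qed
      moreover have "isCont h 0"
        unfolding h_def by (intro continuous_intros isCont_polyfun[OF c] cont)
      ultimately have "h 0 = 0"
        using LIM_unique[of h "h 0" 0 0] Lim_transform_eventually[of "\<lambda>_. 0" 0 "at 0" h]
        by (auto simp: isCont_def eventually_at_filter)
      moreover have "h 0 = c r (\<delta> 0)"
      proof -
        have "h 0 = (\<Sum>s\<in>{r}. c s (\<delta> 0) * 0 ^ (s - r))"
          unfolding h_def using less.prems by (intro sum.mono_neutral_right) auto
        then show ?thesis by simp
      qed
      moreover have "\<delta> 0 = w" by (simp add: \<delta>_def)
      ultimately show "c r w = 0" by simp
    qed
  qed
  \<comment> \<open>At \<open>t = 1\<close> and in the direction \<open>y - z0\<close> the expansion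
    reaches the arbitrary point \<open>y\<close>.\<close>
  then have "P (\<lambda>i. z0 i + 1 * (y i - z0 i)) = 0" unfolding P_eq by simp
  then show ?thesis by simp
qed

section \<open>Almost sure nonvanishing of polynomials\<close>

lemma measurable_polyfun:
  assumes "f \<in> polyfuns V"
  shows "f \<in> borel_measurable (PiM V (\<lambda>_. borel))"
  using assms by induction auto

text \<open>Freeze coordinate \<open>i\<close> at a value for which \<open>f\<close> stays nonzero.
  For almost all values of the other coordinates, \<open>f\<close> is then a nonzero polynomial in
  coordinate \<open>i\<close>, with finitely many roots, each of measure zero; Fubini
  concludes.\<close>

lemma AE_polyfun_nonzero:
  assumes "finite V" "\<And>i. i \<in> V \<Longrightarrow> prob_space (D i)"
    "\<And>i. i \<in> V \<Longrightarrow> sets (D i) = sets borel" "\<And>i. i \<in> V \<Longrightarrow> continuous_distr (D i)"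
    "f \<in> polyfuns V" "\<exists>x. f x \<noteq> 0"
  shows "AE x in PiM V D. f x \<noteq> 0"
  using assms
proof (induction V arbitrary: f)
  case empty
  then obtain x where "f x \<noteq> 0" by blast
  then have "f y \<noteq> 0" for y using polyfuns_cong[OF empty.prems(4), of x y] by simp
  then show ?case by simp
next
  case (insert i V)
  \<comment> \<open>Point masses outside the index set, because the product locale asks for a
    sigma-finite measure at every index.\<close>
  define D' where "D' = (\<lambda>j. if j \<in> insert i V then D j else return borel 0)"
  have D'D: "PiM (insert i V) D' = PiM (insert i V) D" "PiM V D' = PiM V D" "D' i = D i"
    by (auto simp: D'_def intro!: PiM_cong)
  have D'_prob: "prob_space (D' j)" for j using insert.prems(1) by (auto simp: D'_def intro: prob_space_return)
  have D'_sets [measurable_cong]: "sets (D' j) = sets borel" for j using insert.prems(2) by (auto simp: D'_def)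
  interpret product_sigma_finite D'
    using D'_prob by (simp add: product_sigma_finite_def prob_space_imp_sigma_finite)
  interpret pV: prob_space "PiM V D'" by (intro prob_space_PiM D'_prob)
  interpret pi: prob_space "D' i" by (rule D'_prob)
  have sets_PiM': "sets (PiM W D') = sets (PiM W (\<lambda>_. borel))" for W
    by (intro sets_PiM_cong) (auto simp: D'_sets)
  have [measurable]: "f \<in> borel_measurable (PiM (insert i V) D')"
    using measurable_polyfun[OF insert.prems(4)] measurable_cong_sets[OF sets_PiM' refl] by blast
  obtain a where a: "f a \<noteq> 0" using insert.prems(5) by blast
  define g where "g = (\<lambda>x. f (x(i := a i)))"
  have g: "g \<in> polyfuns V" unfolding g_def
  proof (rule polyfuns_compose[OF insert.prems(4)])
    show "(\<lambda>x. (x(i := a i)) j) \<in> polyfuns V" if "j \<in> insert i V" for j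
      using that by (cases "j = i") (auto intro: polyfuns_intros)
  qed
  moreover have "g a \<noteq> 0" using a by (simp add: g_def)
  ultimately have "AE x in PiM V D'. g x \<noteq> 0"
    unfolding D'D using insert by (intro insert.IH) auto
  then have AE1: "AE x in PiM V D'. AE t in D' i. f (x(i := t)) \<noteq> 0"
  proof eventually_elim
    case (elim x)
    obtain P :: "complex poly" where P: "\<And>t. f (x(i := t)) = poly P t"
    proof -
      have "\<exists>P :: complex poly. \<forall>t. f (\<lambda>j. poly (((\<lambda>j. [:x j:])(i := [:0,1:])) j) t) = poly P t"
        by (rule polyfuns_along_line[OF insert.prems(4)])
      moreover have "(\<lambda>j. poly (((\<lambda>j. [:x j:])(i := [:0,1:])) j) t) = x(i := t)" for t by auto
      ultimately show ?thesis using that by auto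
    qed
    have "P \<noteq> 0" using elim P[of "a i"] by (auto simp: g_def)
    then have fin: "finite {t. poly P t = 0}" by (rule poly_roots_finite)
    have "AE t in D' i. \<forall>s\<in>{t. poly P t = 0}. t \<noteq> s"
    proof (rule AE_ball_countable[THEN iffD2])
      show "countable {t. poly P t = 0}" using fin by (rule countable_finite)
      show "\<forall>s\<in>{t. poly P t = 0}. AE t in D' i. t \<noteq> s"
      proof
        fix s
        have "{s} \<in> null_sets (D' i)"
          using insert.prems(2,3)[of i] by (auto simp: null_sets_def D'_sets D'D continuous_distr_def)
        then show "AE t in D' i. t \<noteq> s" by (rule AE_I') auto
      qed
    qed
    then show ?case by (auto simp: P elim: eventually_mono)
  qed
  have "(\<integral>\<^sup>+ x. indicator {x \<in> space (PiM (insert i V) D'). f x = 0} x \<partial>PiM (insert i V) D')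
     = (\<integral>\<^sup>+ x. (\<integral>\<^sup>+ t. indicator {x \<in> space (PiM (insert i V) D'). f x = 0} (x(i := t)) \<partial>D' i) \<partial>PiM V D')"
    using insert.hyps by (intro product_nn_integral_insert) auto
  also have "\<dots> = (\<integral>\<^sup>+ x. 0 \<partial>PiM V D')"
  proof (rule nn_integral_cong_AE, use AE1 in eventually_elim)
    case (elim x)
    then have "(\<integral>\<^sup>+ t. indicator {x \<in> space (PiM (insert i V) D'). f x = 0} (x(i := t)) \<partial>D' i)
        = (\<integral>\<^sup>+ t. 0 \<partial>D' i)"
      by (intro nn_integral_cong_AE) (auto elim!: eventually_mono)
    then show ?case by simp
  qed
  finally have "emeasure (PiM (insert i V) D') {x \<in> space (PiM (insert i V) D'). f x = 0} = 0"
    by simp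
  then have "AE x in PiM (insert i V) D'. f x \<noteq> 0"
    by (intro AE_I[of _ _ "{x \<in> space (PiM (insert i V) D'). f x = 0}"]) auto
  then show ?case by (simp only: D'D)
qed

text \<open>Independence identifies the joint law with the product of the marginal laws. That
  characterization requires a nonempty index set, whence the case distinction.\<close>

lemma (in prob_space) AE_polyfun_indep_vars_nonzero:
  fixes X :: "'i \<Rightarrow> 'a \<Rightarrow> complex"
  assumes "finite I" "indep_vars (\<lambda>_. borel) X I"
    "\<And>i. i \<in> I \<Longrightarrow> continuous_distr (distr M borel (X i))"
    "f \<in> polyfuns I" "\<exists>x. f x \<noteq> 0"
  shows "AE \<omega> in M. f (\<lambda>i. X i \<omega>) \<noteq> 0"
proof (cases "I = {}")
  case True
  obtain x where "f x \<noteq> 0" using assms(5) by blast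
  then have "f y \<noteq> 0" for y using polyfuns_cong[OF assms(4), of x y] True by simp
  then show ?thesis by simp
next
  case False
  have rv: "random_variable borel (X i)" if "i \<in> I" for i
    using assms(2) that by (auto simp: indep_vars_def)
  have meas: "(\<lambda>\<omega>. \<lambda>i\<in>I. X i \<omega>) \<in> measurable M (PiM I (\<lambda>_. borel))"
    using rv by (intro measurable_restrict) auto
  have "AE x in PiM I (\<lambda>i. distr M borel (X i)). f x \<noteq> 0"
    using assms rv by (intro AE_polyfun_nonzero) (auto intro: prob_space_distr)
  also have "PiM I (\<lambda>i. distr M borel (X i)) = distr M (PiM I (\<lambda>_. borel)) (\<lambda>\<omega>. \<lambda>i\<in>I. X i \<omega>)"
    using indep_vars_iff_distr_eq_PiM'[OF False, where M' = "\<lambda>_. borel" and X = X] rv assms(2) by simp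
  finally have "AE \<omega> in M. f (\<lambda>i\<in>I. X i \<omega>) \<noteq> 0"
    by (rule AE_distrD[OF meas])
  moreover have "f (\<lambda>i\<in>I. X i \<omega>) = f (\<lambda>i. X i \<omega>)" for \<omega>
    by (rule polyfuns_cong[OF assms(4)]) simp
  ultimately show ?thesis by simp
qed

section \<open>Hall's theorem and surjectivity of the linear part\<close>


text \<open>The Halmos-Vaughan induction. A tight proper subfamily is matched first, and its union
  is removed from the remaining sets. Without one, every nonempty proper subfamily has a spare
  element, so one index can be matched arbitrarily.\<close>

theorem hall_marriage:
  assumes "finite I" "\<And>i. i \<in> I \<Longrightarrow> finite (S i)"
    "\<And>J. J \<subseteq> I \<Longrightarrow> card J \<le> card (\<Union>j\<in>J. S j)"
  shows "\<exists>f. inj_on f I \<and> (\<forall>i\<in>I. f i \<in> S i)"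
  using assms
proof (induction "card I" arbitrary: I S rule: less_induct)
  case less
  note fin = less.prems(1,2) and hall = less.prems(3)
  show ?case
  proof (cases "\<exists>J. J \<subset> I \<and> J \<noteq> {} \<and> card (\<Union>j\<in>J. S j) = card J")
    case True
    then obtain J where J: "J \<subset> I" "J \<noteq> {}" "card (\<Union>j\<in>J. S j) = card J" by blast
    have finJ: "finite J" using J(1) fin(1) by (auto intro: finite_subset)
    define B where "B = (\<Union>j\<in>J. S j)"
    have finB: "finite B" using finJ J(1) fin(2) by (auto simp: B_def)
    have "card J < card I" using J(1) fin(1) by (rule psubset_card_mono[rotated])
    then obtain f where f: "inj_on f J" "\<forall>i\<in>J. f i \<in> S i"
      using less.hyps[of J S] finJ J(1) fin(2) hall by auto
    have "card (I - J) < card I" using J fin(1) finJ by (intro psubset_card_mono) auto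
    moreover have "card J' \<le> card (\<Union>j\<in>J'. S j - B)" if J': "J' \<subseteq> I - J" for J'
    proof -
      have finJ': "finite J'" using J' fin(1) by (auto intro: finite_subset)
      have "card J' + card J = card (J' \<union> J)" using finJ finJ' J' by (subst card_Un_disjoint) auto
      also have "\<dots> \<le> card (\<Union>j\<in>J' \<union> J. S j)" using J' J(1) by (intro hall) auto
      also have "(\<Union>j\<in>J' \<union> J. S j) = (\<Union>j\<in>J'. S j - B) \<union> B" by (auto simp: B_def)
      also have "card \<dots> \<le> card (\<Union>j\<in>J'. S j - B) + card B" by (rule card_Un_le)
      finally show ?thesis using J(3) by (simp add: B_def)
    qed
    ultimately obtain g where g: "inj_on g (I - J)" "\<forall>i\<in>I - J. g i \<in> S i - B"
      using less.hyps[of "I - J" "\<lambda>i. S i - B"] fin by auto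
    define h where "h = (\<lambda>i. if i \<in> J then f i else g i)"
    have "h ` J \<inter> h ` (I - J) = {}" using f(2) g(2) by (auto simp: h_def B_def)
    moreover have "inj_on h J" "inj_on h (I - J)" using f(1) g(1) by (auto simp: h_def inj_on_def)
    ultimately have "inj_on h (J \<union> (I - J))" by (subst inj_on_Un) blast
    then have "inj_on h I" using J(1) by (simp add: Un_absorb1 psubset_imp_subset)
    moreover have "\<forall>i\<in>I. h i \<in> S i" using f(2) g(2) by (auto simp: h_def)
    ultimately show ?thesis by blast
  next
    case False
    show ?thesis
    proof (cases "I = {}")
      case True then show ?thesis by simp
    next
      case nonempty: False
      then obtain i where i: "i \<in> I" by blast
      have "card {i} \<le> card (S i)" using hall[of "{i}"] i by simp
      then obtain x where x: "x \<in> S i" by fastforce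
      have "card (I - {i}) < card I" using i fin(1) by (intro psubset_card_mono) auto
      moreover have "card J \<le> card (\<Union>j\<in>J. S j - {x})" if J: "J \<subseteq> I - {i}" for J
      proof (cases "J = {}")
        case nonemptyJ: False
        have "card J \<le> card (\<Union>j\<in>J. S j)" using J by (intro hall) auto
        moreover have "card (\<Union>j\<in>J. S j) \<noteq> card J" using False J i nonemptyJ by blast
        moreover have "(\<Union>j\<in>J. S j - {x}) = (\<Union>j\<in>J. S j) - {x}" by auto
        moreover have "card ((\<Union>j\<in>J. S j) - {x}) \<ge> card (\<Union>j\<in>J. S j) - 1"
          by (simp add: card_Diff_singleton_if)
        ultimately show ?thesis by simp
      qed simp
      ultimately obtain f where f: "inj_on f (I - {i})" "\<forall>j\<in>I - {i}. f j \<in> S j - {x}"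
        using less.hyps[of "I - {i}" "\<lambda>j. S j - {x}"] fin by auto
      have "inj_on (f(i := x)) I" using f i by (auto simp: inj_on_def)
      moreover have "\<forall>j\<in>I. (f(i := x)) j \<in> S j" using f x by auto
      ultimately show ?thesis by blast
    qed
  qed
qed

text \<open>Newton interpolation: a multiple of \<open>Q\<close>, which vanishes at the old nodes,
  corrects the value at the new one. The bound is put on coefficients because
  \<open>degree P < card A\<close> is false for empty \<open>A\<close>.\<close>

lemma polynomial_interpolation:
  fixes A :: "complex set"
  assumes "finite A"
  shows "\<exists>P. (\<forall>x\<in>A. poly P x = g x) \<and> (\<forall>i\<ge>card A. coeff P i = 0)"
  using assms
proof (induction A)
  case empty
  show ?case by (intro exI[of _ 0]) simp
next
  case (insert x A)
  then obtain P where P: "\<forall>x\<in>A. poly P x = g x" "\<forall>i\<ge>card A. coeff P i = 0" by blast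
  define Q where "Q = (\<Prod>a\<in>A. [:-a, 1:])"
  have roots: "poly Q y = 0 \<longleftrightarrow> y \<in> A" for y
    using insert.hyps(1) by (auto simp: Q_def poly_prod)
  have "degree Q \<le> (\<Sum>a\<in>A. degree [:-a, 1:])"
    using degree_prod_sum_le[OF insert.hyps(1), of "\<lambda>a. [:-a, 1:]"] by (simp add: Q_def o_def)
  then have deg: "degree Q \<le> card A" by simp
  define R where "R = P + Polynomial.smult ((g x - poly P x) / poly Q x) Q"
  have "poly Q x \<noteq> 0" using roots insert.hyps(2) by simp
  then have "\<forall>y\<in>insert x A. poly R y = g y" using P roots by (auto simp: R_def)
  moreover have "\<forall>i\<ge>card (insert x A). coeff R i = 0"
    using P(2) deg insert.hyps by (auto simp: R_def intro: coeff_eq_0)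
  ultimately show ?case by blast
qed

text \<open>Splitting a link \<open>(k, j)\<close> into \<open>d\<close> rows, the capacity of receiver \<open>k\<close> becomes \<open>n k\<close> for
  each row, while transmitter \<open>j\<close> has capacity \<open>m j\<close> for all rows together. Averaging over the rows
  turns the feasibility condition into Hall's condition.\<close>

lemma row_assignment:
  fixes J :: "(nat \<times> nat) set" and m n :: "nat \<Rightarrow> nat"
  assumes finJ: "finite J" and d: "d > 0"
    and cond: "\<And>J'. J' \<subseteq> J \<Longrightarrow> d * card J' \<le> (\<Sum>j\<in>Tx_of J'. m j) + (\<Sum>k\<in>Rx_of J'. d * n k)"
  obtains f :: "nat \<times> nat \<times> nat \<Rightarrow> (nat \<times> nat) \<times> nat + nat \<times> nat"
  where "inj_on f ({..<d} \<times> J)"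
    "\<And>p k j. p < d \<Longrightarrow> (k, j) \<in> J \<Longrightarrow>
       f (p, k, j) \<in> Inl ` ({(p, k)} \<times> {..<n k}) \<union> Inr ` ({j} \<times> {..<m j})"
proof -
  \<comment> \<open>\<open>Inl ((p, k), i)\<close> is one of the \<open>n k\<close> slots that
    receiver \<open>k\<close> offers to row \<open>p\<close>; \<open>Inr (j, b)\<close> is a slot of
    transmitter \<open>j\<close>, for which all rows compete.\<close>
  define S :: "nat \<times> nat \<times> nat \<Rightarrow> ((nat \<times> nat) \<times> nat + nat \<times> nat) set" where
    "S = (\<lambda>(p, k, j). Inl ` ({(p, k)} \<times> {..<n k}) \<union> Inr ` ({j} \<times> {..<m j}))"
  have "card L \<le> card (\<Union>l\<in>L. S l)" if L: "L \<subseteq> {..<d} \<times> J" for L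
  proof -
    define A where "A = (\<lambda>p. {l. (p, l) \<in> L})"
    have L_eq: "L = Sigma {..<d} A" using L by (auto simp: A_def)
    have A: "A p \<subseteq> J" for p using L by (auto simp: A_def)
    have finA: "finite (A p)" for p using A finJ by (rule finite_subset)
    have finTR: "finite (Tx_of (A p))" "finite (Rx_of (A p))" for p
    proof -
      have "Tx_of (A p) = snd ` A p" "Rx_of (A p) = fst ` A p" by (force simp: Tx_of_def Rx_of_def)+
      then show "finite (Tx_of (A p))" "finite (Rx_of (A p))" using finA by auto
    qed
    define T where "T = (\<Union>p<d. Tx_of (A p))"
    define R where "R = Sigma {..<d} (\<lambda>p. Rx_of (A p))"
    have fin: "finite T" "finite R" using finTR by (auto simp: T_def R_def)
    have U: "(\<Union>l\<in>L. S l) = Inl ` Sigma R (\<lambda>r. {..<n (snd r)}) \<union> Inr ` Sigma T (\<lambda>j. {..<m j})"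
      unfolding L_eq S_def T_def R_def Tx_of_def Rx_of_def by force
    have "card (\<Union>l\<in>L. S l) = (\<Sum>r\<in>R. n (snd r)) + (\<Sum>j\<in>T. m j)"
      unfolding U using fin by (subst card_Un_disjoint) (auto simp: card_image)
    also have "(\<Sum>r\<in>R. n (snd r)) = (\<Sum>p<d. \<Sum>k\<in>Rx_of (A p). n k)"
      unfolding R_def using finTR by (subst sum.Sigma) (auto simp: case_prod_unfold)
    finally have card_U: "card (\<Union>l\<in>L. S l) = (\<Sum>p<d. \<Sum>k\<in>Rx_of (A p). n k) + (\<Sum>j\<in>T. m j)" .
    have "d * card L = (\<Sum>p<d. d * card (A p))"
      using finA by (simp add: L_eq sum_distrib_left)
    \<comment> \<open>Each of the \<open>d\<close> slices is charged the capacity of all of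
      \<open>T\<close>, so the total is \<open>d\<close> times the transmitter part of the
      union.\<close>
    also have "\<dots> \<le> (\<Sum>p<d. (\<Sum>j\<in>T. m j) + (\<Sum>k\<in>Rx_of (A p). d * n k))"
    proof (rule sum_mono)
      fix p assume "p \<in> {..<d}"
      then have "(\<Sum>j\<in>Tx_of (A p). m j) \<le> (\<Sum>j\<in>T. m j)"
        using fin by (intro sum_mono2) (auto simp: T_def)
      then show "d * card (A p) \<le> (\<Sum>j\<in>T. m j) + (\<Sum>k\<in>Rx_of (A p). d * n k)"
        using cond[OF A[of p]] by linarith
    qed
    also have "\<dots> = d * card (\<Union>l\<in>L. S l)"
      by (simp add: card_U sum.distrib sum_distrib_left algebra_simps)
    finally show ?thesis using d by simp
  qed
  then have "\<exists>f. inj_on f ({..<d} \<times> J) \<and> (\<forall>l\<in>{..<d} \<times> J. f l \<in> S l)"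
    using finJ by (intro hall_marriage) (auto simp: S_def)
  then obtain f where f: "inj_on f ({..<d} \<times> J)" "\<forall>l\<in>{..<d} \<times> J. f l \<in> S l" by blast
  show ?thesis
  proof (rule that[OF f(1)])
    show "f (p, k, j) \<in> Inl ` ({(p, k)} \<times> {..<n k}) \<union> Inr ` ({j} \<times> {..<m j})"
      if "p < d" "(k, j) \<in> J" for p k j
      using bspec[OF f(2), of "(p, k, j)"] that by (simp add: S_def)
  qed
qed

text \<open>Rows assigned to a receiver are solved by interpolation, since its matrices are block
  Vandermonde; rows assigned to a transmitter then get private coordinates, and the receiver's
  contribution is subtracted.\<close>

lemma onto_for_divisible_receivers:
  fixes J :: "(nat \<times> nat) set" and m n :: "nat \<Rightarrow> nat"
  assumes finJ: "finite J" and d: "d > 0"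
    and cond: "\<And>J'. J' \<subseteq> J \<Longrightarrow> d * card J' \<le> (\<Sum>j\<in>Tx_of J'. m j) + (\<Sum>k\<in>Rx_of J'. d * n k)"
  shows "\<exists>H2 H3 :: nat \<Rightarrow> nat \<Rightarrow> nat \<Rightarrow> nat \<Rightarrow> complex. \<forall>w. \<exists>xU xV. \<forall>k j p q.
    (k, j) \<in> J \<longrightarrow> p < d \<longrightarrow> q < d \<longrightarrow>
    (\<Sum>b<m j. H2 k j p b * xV j b q) + (\<Sum>a<d * n k. xU k p a * H3 k j a q) = w k j p q"
proof -
  obtain f :: "nat \<times> nat \<times> nat \<Rightarrow> (nat \<times> nat) \<times> nat + nat \<times> nat"
    where inj: "inj_on f ({..<d} \<times> J)"
    and f: "\<And>p k j. p < d \<Longrightarrow> (k, j) \<in> J \<Longrightarrow>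
       f (p, k, j) \<in> Inl ` ({(p, k)} \<times> {..<n k}) \<union> Inr ` ({j} \<times> {..<m j})"
    using row_assignment[OF finJ d cond] by blast
  \<comment> \<open>Column \<open>q\<close> owns the coordinates \<open>a = i * d + q\<close>, which
    carry the powers \<open>i < n k\<close> of the node \<open>j\<close>. Distinct transmitters are
    distinct nodes, and \<open>xU k p\<close> encodes one interpolating polynomial for each
    \<open>q\<close>.\<close>
  define H3 where "H3 = (\<lambda>(k::nat) j a q. if a mod d = q then of_nat j ^ (a div d) else 0 :: complex)"
  define H2 where "H2 = (\<lambda>k j p b. if f (p, k, j) = Inr (j, b) then 1 else 0 :: complex)"
  have "\<exists>xU xV. \<forall>k j p q. (k, j) \<in> J \<longrightarrow> p < d \<longrightarrow> q < d \<longrightarrow>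
    (\<Sum>b<m j. H2 k j p b * xV j b q) + (\<Sum>a<d * n k. xU k p a * H3 k j a q) = w k j p q"
    for w :: "nat \<Rightarrow> nat \<Rightarrow> nat \<Rightarrow> nat \<Rightarrow> complex"
  proof -
    \<comment> \<open>The links whose row \<open>p\<close> is served by receiver \<open>k\<close>;
      injectivity of \<open>f\<close> keeps their number within the \<open>n k\<close> available
      coefficients.\<close>
    define A where "A = (\<lambda>k p. {j. (k, j) \<in> J \<and> isl (f (p, k, j))})"
    have A: "finite (A k p)" "p < d \<Longrightarrow> card (A k p) \<le> n k" for k p
    proof -
      have "A k p \<subseteq> snd ` J" by (force simp: A_def)
      then show "finite (A k p)" using finJ by (meson finite_imageI finite_subset)
      assume p: "p < d"
      have "inj_on (\<lambda>j. f (p, k, j)) (A k p)"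
        using inj p by (auto simp: inj_on_def A_def)
      moreover have "(\<lambda>j. f (p, k, j)) ` A k p \<subseteq> Inl ` ({(p, k)} \<times> {..<n k})"
        using f[OF p] by (fastforce simp: A_def)
      ultimately have "card (A k p) \<le> card (Inl ` ({(p, k)} \<times> {..<n k}) :: (_ + nat \<times> nat) set)"
        by (intro card_inj_on_le) auto
      then show "card (A k p) \<le> n k" by (simp add: card_image)
    qed
    have "\<exists>P. (\<forall>j\<in>A k p. poly P (of_nat j) = w k j p q) \<and> (\<forall>i\<ge>card (A k p). coeff P i = 0)" for k p q
    proof -
      obtain P :: "complex poly" where P:
        "\<forall>x\<in>of_nat ` A k p. poly P x = w k (the_inv_into (A k p) of_nat x) p q"
        "\<forall>i\<ge>card (of_nat ` A k p :: complex set). coeff P i = 0"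
        using polynomial_interpolation[of "of_nat ` A k p"
            "\<lambda>x. w k (the_inv_into (A k p) of_nat x) p q"] A(1) by blast
      have "card (of_nat ` A k p :: complex set) = card (A k p)"
        by (intro card_image) (simp add: inj_on_def)
      then show ?thesis using P by (intro exI[of _ P]) (auto simp: the_inv_into_f_f inj_on_def)
    qed
    then obtain P where P: "\<And>k p q j. j \<in> A k p \<Longrightarrow> poly (P k p q) (of_nat j) = w k j p q"
      and P0: "\<And>k p q i. i \<ge> card (A k p) \<Longrightarrow> coeff (P k p q) i = 0"
      by metis
    define xU where "xU = (\<lambda>k p a. coeff (P k p (a mod d)) (a div d))"
    define s where "s = (\<lambda>k j p q. \<Sum>a<d * n k. xU k p a * H3 k j a q)"
    have s: "s k j p q = poly (P k p q) (of_nat j)" if p: "p < d" and q: "q < d" for k j p q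
    proof -
      have inj_a: "inj_on (\<lambda>i. i * d + q) {..<n k}" using d by (auto simp: inj_on_def)
      have img: "(\<lambda>i. i * d + q) ` {..<n k} = {a\<in>{..<d * n k}. a mod d = q}"
      proof safe
        fix i assume "i < n k"
        then have "i * d + q < (i + 1) * d" "(i + 1) * d \<le> n k * d" using q by (simp, intro mult_right_mono) auto
        then show "i * d + q < d * n k" by (simp add: mult.commute)
        show "(i * d + q) mod d = q" using q by simp
      next
        fix a assume a: "a < d * n k" "q = a mod d"
        show "a \<in> (\<lambda>i. i * d + a mod d) ` {..<n k}"
          using a by (intro image_eqI[of _ _ "a div d"]) (auto simp: less_mult_imp_div_less mult.commute)
      qed
      have "s k j p q = (\<Sum>a\<in>{a\<in>{..<d * n k}. a mod d = q}. xU k p a * H3 k j a q)"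
        unfolding s_def by (intro sum.mono_neutral_right) (auto simp: H3_def)
      also have "\<dots> = (\<Sum>i<n k. coeff (P k p q) i * of_nat j ^ i)"
        unfolding img[symmetric] using q by (subst sum.reindex[OF inj_a]) (simp add: xU_def H3_def)
      also have "\<dots> = (\<Sum>i\<le>degree (P k p q). coeff (P k p q) i * of_nat j ^ i)"
        using P0[of k p _ q] A(2)[OF p, of k]
        by (intro sum.mono_neutral_cong) (auto intro: coeff_eq_0)
      finally show ?thesis by (simp add: poly_altdef)
    qed
    \<comment> \<open>As \<open>f\<close> is injective, the slot \<open>(j, b)\<close> determines
      the only row that can use it.\<close>
    define xV where "xV = (\<lambda>j b q. case the_inv_into ({..<d} \<times> J) f (Inr (j, b)) of (p, k, _) \<Rightarrow>
      w k j p q - s k j p q)"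
    have "(\<Sum>b<m j. H2 k j p b * xV j b q) + s k j p q = w k j p q"
      if kj: "(k, j) \<in> J" and p: "p < d" and q: "q < d" for k j p q
    proof (cases "f (p, k, j)")
      case (Inl r)
      then have "j \<in> A k p" using kj by (simp add: A_def)
      then show ?thesis using Inl by (simp add: s p q P H2_def)
    next
      case (Inr r)
      then obtain b where b: "f (p, k, j) = Inr (j, b)" "b < m j" using f[OF p kj] by auto
      have "the_inv_into ({..<d} \<times> J) f (Inr (j, b)) = (p, k, j)"
        using the_inv_into_f_f[OF inj, of "(p, k, j)"] p kj b by simp
      then have "xV j b q = w k j p q - s k j p q" by (simp add: xV_def)
      moreover have "(\<Sum>b<m j. H2 k j p b * xV j b q) = xV j b q"
        using b by (simp add: H2_def if_distrib[of "\<lambda>x. x * _"] sum.delta' cong: if_cong)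
      ultimately show ?thesis by simp
    qed
    then show ?thesis unfolding s_def by blast
  qed
  then show ?thesis by blast
qed

text \<open>If the transmitters are the divisible side, the previous lemma is applied to the
  converse set of links, with the roles of rows and columns exchanged as well.\<close>

lemma onto_for_divisible_network:
  fixes J :: "(nat \<times> nat) set" and m n :: "nat \<Rightarrow> nat"
  assumes finJ: "finite J" and d: "d > 0"
    and cond: "\<And>J'. J' \<subseteq> J \<Longrightarrow> d * card J' \<le> (\<Sum>j\<in>Tx_of J'. m j) + (\<Sum>k\<in>Rx_of J'. n k)"
    and dvd: "(\<forall>k\<in>Rx_of J. d dvd n k) \<or> (\<forall>j\<in>Tx_of J. d dvd m j)"
  shows "\<exists>H2 H3 :: nat \<Rightarrow> nat \<Rightarrow> nat \<Rightarrow> nat \<Rightarrow> complex. \<forall>w. \<exists>xU xV. \<forall>k j p q.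
    (k, j) \<in> J \<longrightarrow> p < d \<longrightarrow> q < d \<longrightarrow>
    (\<Sum>b<m j. H2 k j p b * xV j b q) + (\<Sum>a<n k. xU k p a * H3 k j a q) = w k j p q"
  using dvd
proof
  assume "\<forall>k\<in>Rx_of J. d dvd n k"
  then have n: "d * (n k div d) = n k" if "k \<in> Rx_of J" for k using that by simp
  have "d * card J' \<le> (\<Sum>j\<in>Tx_of J'. m j) + (\<Sum>k\<in>Rx_of J'. d * (n k div d))" if "J' \<subseteq> J" for J'
  proof -
    have "Rx_of J' \<subseteq> Rx_of J" using that by (auto simp: Rx_of_def)
    then show ?thesis using cond[OF that] n by (simp add: subset_iff cong: sum.cong)
  qed
  from onto_for_divisible_receivers[OF finJ d this] obtain H2 H3 where
    H: "\<And>w :: nat \<Rightarrow> nat \<Rightarrow> nat \<Rightarrow> nat \<Rightarrow> complex. \<exists>xU xV. \<forall>k j p q. (k, j) \<in> J \<longrightarrow> p < d \<longrightarrow> q < d \<longrightarrow>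
    (\<Sum>b<m j. H2 k j p b * xV j b q) + (\<Sum>a<d * (n k div d). xU k p a * H3 k j a q) = w k j p q"
    by blast
  have "\<exists>xU xV. \<forall>k j p q. (k, j) \<in> J \<longrightarrow> p < d \<longrightarrow> q < d \<longrightarrow>
    (\<Sum>b<m j. H2 k j p b * xV j b q) + (\<Sum>a<n k. xU k p a * H3 k j a q) = w k j p q"
    for w :: "nat \<Rightarrow> nat \<Rightarrow> nat \<Rightarrow> nat \<Rightarrow> complex"
  proof -
    obtain xU xV where x: "\<And>k j p q. (k, j) \<in> J \<Longrightarrow> p < d \<Longrightarrow> q < d \<Longrightarrow>
      (\<Sum>b<m j. H2 k j p b * xV j b q) + (\<Sum>a<d * (n k div d). xU k p a * H3 k j a q) = w k j p q"
      using H[of w] by blast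
    have "d * (n k div d) = n k" if "(k, j) \<in> J" for k j
      using that by (intro n) (auto simp: Rx_of_def)
    then show ?thesis using x by (intro exI[of _ xU] exI[of _ xV]) auto
  qed
  then show ?thesis by blast
next
  assume "\<forall>j\<in>Tx_of J. d dvd m j"
  then have m: "d * (m j div d) = m j" if "j \<in> Tx_of J" for j using that by simp
  have conv: "Tx_of (J'\<inverse>) = Rx_of J'" "Rx_of (J'\<inverse>) = Tx_of J'" for J'
    by (auto simp: Tx_of_def Rx_of_def)
  have "d * card J' \<le> (\<Sum>j\<in>Tx_of J'. n j) + (\<Sum>k\<in>Rx_of J'. d * (m k div d))" if "J' \<subseteq> J\<inverse>" for J'
  proof -
    have sub: "J'\<inverse> \<subseteq> J" using that by auto
    then have "Rx_of J' \<subseteq> Tx_of J" by (force simp: Rx_of_def Tx_of_def)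
    then show ?thesis using cond[OF sub] m
      by (simp add: subset_iff conv cong: sum.cong)
  qed
  note C = onto_for_divisible_receivers[of "J\<inverse>", OF _ d this, unfolded converse_iff finite_converse, OF finJ]
  obtain H2 H3 where
    H: "\<And>w :: nat \<Rightarrow> nat \<Rightarrow> nat \<Rightarrow> nat \<Rightarrow> complex. \<exists>xU xV. \<forall>j k p q. (k, j) \<in> J \<longrightarrow> p < d \<longrightarrow> q < d \<longrightarrow>
    (\<Sum>b<n k. H2 j k p b * xV k b q) + (\<Sum>a<d * (m j div d). xU j p a * H3 j k a q) = w j k p q"
    using C by blast
  have j: "j \<in> Tx_of J" if "(k, j) \<in> J" for k j using that by (auto simp: Tx_of_def)
  have sol: "\<exists>xU xV. \<forall>k j p q. (k, j) \<in> J \<longrightarrow> p < d \<longrightarrow> q < d \<longrightarrow>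
    (\<Sum>b<m j. H3 j k b p * xV j b q) + (\<Sum>a<n k. xU k p a * H2 j k q a) = w k j p q"
    for w :: "nat \<Rightarrow> nat \<Rightarrow> nat \<Rightarrow> nat \<Rightarrow> complex"
  proof -
    obtain xU xV where x: "\<And>j k p q. (k, j) \<in> J \<Longrightarrow> p < d \<Longrightarrow> q < d \<Longrightarrow>
      (\<Sum>b<n k. H2 j k p b * xV k b q) + (\<Sum>a<d * (m j div d). xU j p a * H3 j k a q) = w k j q p"
      using H[of "\<lambda>j k p q. w k j q p"] by blast
    have eq: "d * (m j div d) = m j" if "(k, j) \<in> J" for k j
      by (rule m[OF j[OF that]])
    show ?thesis
    proof (rule exI[of _ "\<lambda>k p a. xV k a p"], rule exI[of _ "\<lambda>j b q. xU j q b"], intro allI impI)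
      fix k j p q assume kj: "(k, j) \<in> J" and "p < d" "q < d"
      then show "(\<Sum>b<m j. H3 j k b p * xU j q b) + (\<Sum>a<n k. xV k a p * H2 j k q a) = w k j p q"
        using x[OF kj, of q p] by (simp add: eq[OF kj] mult.commute add.commute)
    qed
  qed
  show ?thesis
    by (rule exI[of _ "\<lambda>k j p b. H3 j k b p"], rule exI[of _ "\<lambda>k j a q. H2 j k q a"],
        intro allI, rule sol)
qed

section \<open>Elimination of the normalized alignment equations\<close>


text \<open>\<open>UVar k p a\<close> is entry \<open>(p, d + a)\<close> of the adjoint of the
  receive beamformer, so that no conjugation enters the equations and they are polynomial;
  \<open>VVar j b q\<close> is entry \<open>(d + b, q)\<close> of the transmit beamformer.\<close>

datatype elim_var = Chan "nat \<times> nat \<times> nat \<times> nat" | UVar nat nat nat | VVar nat nat nat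

text \<open>An element is at once the name of an alignment equation and the channel entry for which
  that equation is solved.\<close>

definition pivots :: "nat \<Rightarrow> (nat \<times> nat) set \<Rightarrow> (nat \<times> nat \<times> nat \<times> nat) set" where
  "pivots d J = {(k, j, p, q). (k, j) \<in> J \<and> p < d \<and> q < d}"

definition urow :: "nat \<Rightarrow> (elim_var \<Rightarrow> complex) \<Rightarrow> nat \<Rightarrow> nat \<Rightarrow> nat \<Rightarrow> complex" where
  "urow d x k p a = (if a < d then if a = p then 1 else 0 else x (UVar k p (a - d)))"

definition vcol :: "nat \<Rightarrow> (elim_var \<Rightarrow> complex) \<Rightarrow> nat \<Rightarrow> nat \<Rightarrow> nat \<Rightarrow> complex" where
  "vcol d x j b q = (if b < d then if b = q then 1 else 0 else x (VVar j (b - d) q))"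

text \<open>With the leading \<open>d\<close> rows of all beamformers normalized to the identity, the alignment
  equation with index \<open>(k, j, p, q)\<close> can be solved for the channel entry \<open>(p, q)\<close>.\<close>

definition elim_map :: "nat \<Rightarrow> (nat \<Rightarrow> nat) \<Rightarrow> (nat \<Rightarrow> nat) \<Rightarrow> (nat \<times> nat) set \<Rightarrow>
    nat \<times> nat \<times> nat \<times> nat \<Rightarrow> (elim_var \<Rightarrow> complex) \<Rightarrow> complex" where
  "elim_map d M N J = (\<lambda>(k, j, p, q) x. if (k, j, p, q) \<in> pivots d J then
     - ((\<Sum>b<M j - d. x (Chan (k, j, p, d + b)) * x (VVar j b q))
       + (\<Sum>a<N k - d. x (UVar k p a) * x (Chan (k, j, d + a, q)))
       + (\<Sum>a<N k - d. \<Sum>b<M j - d.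
            x (UVar k p a) * x (Chan (k, j, d + a, d + b)) * x (VVar j b q)))
     else x (Chan (k, j, p, q)))"

definition beam_vars :: "nat \<Rightarrow> (nat \<Rightarrow> nat) \<Rightarrow> (nat \<Rightarrow> nat) \<Rightarrow> (nat \<times> nat) set \<Rightarrow> elim_var set" where
  "beam_vars d M N J = (\<lambda>(k, p, a). UVar k p a) ` (SIGMA k:Rx_of J. {..<d} \<times> {..<N k - d})
     \<union> (\<lambda>(j, b, q). VVar j b q) ` (SIGMA j:Tx_of J. {..<M j - d} \<times> {..<d})"

lemma finite_cross_links: "finite (cross_links K)"
  by (rule finite_subset[of _ "{1..K} \<times> {1..K}"]) (auto simp: cross_links_def)

lemma finite_channel_entries: "finite (channel_entries K M N)"
proof -
  have "channel_entries K M N \<subseteq> (SIGMA k:{1..K}. SIGMA j:{1..K}. {..<N k} \<times> {..<M j})"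
    by (auto simp: channel_entries_def)
  then show ?thesis by (rule finite_subset) auto
qed

lemma pivots_subset:
  assumes "J \<subseteq> cross_links K" "\<forall>k\<in>{1..K}. d \<le> M k \<and> d \<le> N k"
  shows "pivots d J \<subseteq> channel_entries K M N"
proof
  fix e assume "e \<in> pivots d J"
  then obtain k j p q where e: "e = (k, j, p, q)" "(k, j) \<in> J" "p < d" "q < d"
    by (auto simp: pivots_def)
  then have "k \<in> {1..K}" "j \<in> {1..K}" using assms(1) by (auto simp: cross_links_def)
  then show "e \<in> channel_entries K M N"
    using assms(2)[rule_format, of k] assms(2)[rule_format, of j] e by (simp add: channel_entries_def)
qed

lemma card_pivots: "finite J \<Longrightarrow> card (pivots d J) = card J * (d * d)"
proof -
  assume "finite J"
  have "pivots d J = (\<lambda>((k, j), p, q). (k, j, p, q)) ` (J \<times> {..<d} \<times> {..<d})"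
    by (force simp: pivots_def)
  moreover have "inj_on (\<lambda>((k, j), p, q). (k, j, p, q)) (J \<times> {..<d} \<times> {..<d})"
    by (auto simp: inj_on_def)
  ultimately show ?thesis by (simp add: card_image card_cartesian_product)
qed

lemma finite_Tx_Rx: "finite J \<Longrightarrow> finite (Tx_of J)" "finite J \<Longrightarrow> finite (Rx_of J)"
proof -
  assume J: "finite J"
  have "Tx_of J = snd ` J" "Rx_of J = fst ` J" by (force simp: Tx_of_def Rx_of_def)+
  then show "finite (Tx_of J)" "finite (Rx_of J)" using J by auto
qed

lemma finite_beam_vars: "finite J \<Longrightarrow> finite (beam_vars d M N J)"
  unfolding beam_vars_def by (intro finite_UnI finite_imageI finite_SigmaI finite_Tx_Rx) auto

lemma card_beam_vars:
  assumes "finite J"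
  shows "card (beam_vars d M N J) = d * ((\<Sum>j\<in>Tx_of J. M j - d) + (\<Sum>k\<in>Rx_of J. N k - d))"
proof -
  have "card (beam_vars d M N J) = (\<Sum>k\<in>Rx_of J. d * (N k - d)) + (\<Sum>j\<in>Tx_of J. (M j - d) * d)"
    unfolding beam_vars_def using finite_Tx_Rx[OF assms]
    by (subst card_Un_disjoint) (auto simp: card_image inj_on_def)
  then show ?thesis by (simp add: sum_distrib_left algebra_simps)
qed

lemma polyfun_elim_map:
  assumes "\<And>i. (\<lambda>x. g x i) \<in> polyfuns V"
  shows "(\<lambda>x. elim_map d M N J e (g x)) \<in> polyfuns V"
proof (cases "e \<in> pivots d J")
  case True
  then show ?thesis using assms
    by (cases e) (auto simp: elim_map_def intro!: polyfuns_intros)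
next
  case False
  then show ?thesis using assms by (cases e) (auto simp: elim_map_def)
qed

text \<open>Pivot entries do not occur as variables: every channel entry in the formula for a pivot
  has a row or column index of at least \<open>d\<close>.\<close>

lemma polyfun_elim_map_vars:
  assumes "J \<subseteq> cross_links K" "\<forall>k\<in>{1..K}. d \<le> M k \<and> d \<le> N k" "e \<in> channel_entries K M N"
  shows "elim_map d M N J e \<in> polyfuns (Chan ` (channel_entries K M N - pivots d J) \<union> beam_vars d M N J)"
    (is "_ \<in> polyfuns ?V")
proof -
  obtain k j p q where e: "e = (k, j, p, q)" by (cases e)
  show ?thesis
  proof (cases "e \<in> pivots d J")
    case False
    then show ?thesis using assms(3) by (auto simp: e elim_map_def intro!: polyfuns_intros)
  next
    case True
    then have kj: "(k, j) \<in> J" "p < d" "q < d" by (auto simp: pivots_def e)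
    then have TR: "j \<in> Tx_of J" "k \<in> Rx_of J" by (auto simp: Tx_of_def Rx_of_def)
    have ch: "(k, j, a, b) \<in> channel_entries K M N - pivots d J"
      if "a < N k" "b < M j" "a \<ge> d \<or> b \<ge> d" for a b
      using that kj assms(1) by (auto simp: channel_entries_def pivots_def cross_links_def)
    have "d \<le> N k" "d \<le> M j" using assms(1,2) kj by (auto simp: cross_links_def)
    note le' = this
    have mem1: "Chan (k, j, p, d + b) \<in> ?V" if "b < M j - d" for b
      by (rule UnI1, rule imageI, rule ch) (use that kj le' in auto)
    have mem2: "Chan (k, j, d + a, q) \<in> ?V" if "a < N k - d" for a
      by (rule UnI1, rule imageI, rule ch) (use that kj le' in auto)
    have mem3: "Chan (k, j, d + a, d + b) \<in> ?V" if "a < N k - d" "b < M j - d" for a b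
      by (rule UnI1, rule imageI, rule ch) (use that kj le' in auto)
    have mem4: "UVar k p a \<in> ?V" if "a < N k - d" for a
      unfolding beam_vars_def
      by (rule UnI2, rule UnI1, rule image_eqI[of _ _ "(k, p, a)"]) (use that kj TR in auto)
    have mem5: "VVar j b q \<in> ?V" if "b < M j - d" for b
      unfolding beam_vars_def
      by (rule UnI2, rule UnI2, rule image_eqI[of _ _ "(j, b, q)"]) (use that kj TR in auto)
    have "elim_map d M N J e = (\<lambda>x.
      - ((\<Sum>b<M j - d. x (Chan (k, j, p, d + b)) * x (VVar j b q))
       + (\<Sum>a<N k - d. x (UVar k p a) * x (Chan (k, j, d + a, q)))
       + (\<Sum>a<N k - d. \<Sum>b<M j - d.
            x (UVar k p a) * x (Chan (k, j, d + a, d + b)) * x (VVar j b q))))"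
      using True by (simp add: e elim_map_def fun_eq_iff)
    also have "\<dots> \<in> polyfuns ?V"
      by (intro polyfuns_minus polyfuns.add polyfuns_sum polyfuns.mult polyfuns.var) (use mem1 mem2 mem3 mem4 mem5 in auto)
    finally show ?thesis .
  qed
qed

lemma sum_lessThan_split:
  fixes f :: "nat \<Rightarrow> 'a::comm_monoid_add"
  assumes "d \<le> n" shows "(\<Sum>i<n. f i) = (\<Sum>i<d. f i) + (\<Sum>i<n - d. f (d + i))"
  using assms by (induction n rule: dec_induct) (simp_all add: Suc_diff_le add.assoc)

lemma normalized_bilinear_form:
  fixes u v :: "nat \<Rightarrow> complex"
  assumes "d \<le> N" "d \<le> M" "p < d" "q < d"
    and u: "\<And>a. a < d \<Longrightarrow> u a = (if a = p then 1 else 0)"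
    and v: "\<And>b. b < d \<Longrightarrow> v b = (if b = q then 1 else 0)"
  shows "(\<Sum>a<N. \<Sum>b<M. u a * h a b * v b) = h p q + ((\<Sum>b<M - d. h p (d + b) * v (d + b))
    + (\<Sum>a<N - d. u (d + a) * h (d + a) q) + (\<Sum>a<N - d. \<Sum>b<M - d. u (d + a) * h (d + a) (d + b) * v (d + b)))"
proof -
  have inner: "(\<Sum>b<M. c * h a b * v b) = c * h a q + (\<Sum>b<M - d. c * h a (d + b) * v (d + b))" for a c
  proof -
    have "(\<Sum>b<d. c * h a b * v b) = (\<Sum>b<d. if b = q then c * h a b else 0)"
      by (intro sum.cong) (auto simp: v)
    then show ?thesis using assms by (subst sum_lessThan_split[of d M]) simp_all
  qed
  have "(\<Sum>a<d. u a * h a q + (\<Sum>b<M - d. u a * h a (d + b) * v (d + b))) =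
    (\<Sum>a<d. if a = p then h a q + (\<Sum>b<M - d. h a (d + b) * v (d + b)) else 0)"
    by (intro sum.cong) (auto simp: u)
  then show ?thesis using assms(1-4) unfolding inner
    by (subst sum_lessThan_split[of d N]) (simp_all add: sum.distrib)
qed

text \<open>Owing to the identity blocks, entry \<open>(p, q)\<close> is the only one of the leading
  block in the bilinear form, and its coefficient is 1.\<close>

lemma elim_map_eq_iff:
  assumes "(k, j) \<in> J" "p < d" "q < d" "d \<le> N k" "d \<le> M j"
    and ch: "\<And>a b. a < N k \<Longrightarrow> b < M j \<Longrightarrow> a \<ge> d \<or> b \<ge> d \<Longrightarrow> x (Chan (k, j, a, b)) = h a b"
  shows "elim_map d M N J (k, j, p, q) x = h p q \<longleftrightarrow>
    (\<Sum>a<N k. \<Sum>b<M j. urow d x k p a * h a b * vcol d x j b q) = 0"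
proof -
  have ch1: "\<And>b. b < M j - d \<Longrightarrow> x (Chan (k, j, p, d + b)) = h p (d + b)"
    and ch2: "\<And>a. a < N k - d \<Longrightarrow> x (Chan (k, j, d + a, q)) = h (d + a) q"
    and ch3: "\<And>a b. a < N k - d \<Longrightarrow> b < M j - d \<Longrightarrow> x (Chan (k, j, d + a, d + b)) = h (d + a) (d + b)"
    using assms(2-5) by (auto intro!: ch)
  have "(k, j, p, q) \<in> pivots d J" using assms by (simp add: pivots_def)
  then have "elim_map d M N J (k, j, p, q) x =
     - ((\<Sum>b<M j - d. h p (d + b) * vcol d x j (d + b) q)
       + (\<Sum>a<N k - d. urow d x k p (d + a) * h (d + a) q)
       + (\<Sum>a<N k - d. \<Sum>b<M j - d. urow d x k p (d + a) * h (d + a) (d + b) * vcol d x j (d + b) q))"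
    using assms(2-5) ch1 ch2 ch3 unfolding elim_map_def by (simp add: urow_def vcol_def)
  moreover have "(\<Sum>a<N k. \<Sum>b<M j. urow d x k p a * h a b * vcol d x j b q) = h p q +
      ((\<Sum>b<M j - d. h p (d + b) * vcol d x j (d + b) q)
       + (\<Sum>a<N k - d. urow d x k p (d + a) * h (d + a) q)
       + (\<Sum>a<N k - d. \<Sum>b<M j - d. urow d x k p (d + a) * h (d + a) (d + b) * vcol d x j (d + b) q))"
    by (rule normalized_bilinear_form[OF assms(4,5,2,3)]) (auto simp: urow_def vcol_def)
  moreover have "- S = h p q \<longleftrightarrow> h p q + S = 0" for S by (metis eq_neg_iff_add_eq_0)
  ultimately show ?thesis by (simp only:)
qed

text \<open>The channels in question lie in the image of \<open>elim_map\<close>, whose variables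
  trade the \<open>d * d * card J\<close> pivots for a smaller number of beamformer entries.\<close>

lemma aligned_channels_dependent:
  assumes J: "J \<subseteq> cross_links K" and le: "\<forall>k\<in>{1..K}. d \<le> M k \<and> d \<le> N k" and "d > 0"
    and less: "(\<Sum>j\<in>Tx_of J. M j - d) + (\<Sum>k\<in>Rx_of J. N k - d) < d * card J"
  obtains Q where "Q \<in> polyfuns (channel_entries K M N)" "\<exists>y. Q y \<noteq> 0"
    "\<And>h x. (\<And>k j p q. (k, j) \<in> J \<Longrightarrow> p < d \<Longrightarrow> q < d \<Longrightarrow>
        (\<Sum>a<N k. \<Sum>b<M j. urow d x k p a * h (k, j, a, b) * vcol d x j b q) = 0) \<Longrightarrow> Q h = 0"
proof -
  let ?E = "channel_entries K M N"
  let ?V = "Chan ` (?E - pivots d J) \<union> beam_vars d M N J"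
  have finJ: "finite J" using J finite_cross_links by (rule finite_subset)
  have finE: "finite ?E" by (rule finite_channel_entries)
  have piv: "pivots d J \<subseteq> ?E" by (rule pivots_subset[OF J le])
  have "card ?V \<le> card (Chan ` (?E - pivots d J)) + card (beam_vars d M N J)" by (rule card_Un_le)
  also have "card (Chan ` (?E - pivots d J)) = card ?E - card (pivots d J)"
    using piv finE by (subst card_image) (auto simp: inj_on_def card_Diff_subset finite_subset)
  also have "card (beam_vars d M N J) < card (pivots d J)"
    using mult_strict_left_mono[OF less \<open>d > 0\<close>]
    by (simp only: card_beam_vars[OF finJ] card_pivots[OF finJ] mult_ac)
  finally have "card ?V < card ?E" using card_mono[OF finE piv] by linarith
  moreover have "finite ?V" using finE finite_beam_vars[OF finJ] by simp
  ultimately obtain Q where Q: "Q \<in> polyfuns ?E" "\<exists>y. Q y \<noteq> 0"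
    "\<And>x. Q (\<lambda>e. elim_map d M N J e x) = 0"
    using algebraic_dependence[of ?V ?E "elim_map d M N J"] finE polyfun_elim_map_vars[OF J le] by blast
  have "Q h = 0" if h: "\<And>k j p q. (k, j) \<in> J \<Longrightarrow> p < d \<Longrightarrow> q < d \<Longrightarrow>
        (\<Sum>a<N k. \<Sum>b<M j. urow d x k p a * h (k, j, a, b) * vcol d x j b q) = 0" for h x
  proof -
    define x' where "x' = (\<lambda>i. case i of Chan e \<Rightarrow> h e | _ \<Rightarrow> x i)"
    have uv: "urow d x' = urow d x" "vcol d x' = vcol d x"
      by (auto simp: fun_eq_iff urow_def vcol_def x'_def)
    have "elim_map d M N J e x' = h e" if e: "e \<in> ?E" for e
    proof -
      obtain k j p q where e': "e = (k, j, p, q)" by (cases e)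
      show ?thesis
      proof (cases "e \<in> pivots d J")
        case True
        then have kj: "(k, j) \<in> J" "p < d" "q < d" by (auto simp: pivots_def e')
        then have "d \<le> N k" "d \<le> M j" using J le by (auto simp: cross_links_def)
        then show ?thesis unfolding e'
          by (subst elim_map_eq_iff[where h = "\<lambda>a b. h (k, j, a, b)"])
            (use kj h uv in \<open>auto simp: x'_def\<close>)
      qed (auto simp: elim_map_def x'_def e')
    qed
    then have "Q h = Q (\<lambda>e. elim_map d M N J e x')" by (intro polyfuns_cong[OF Q(1)]) simp
    then show ?thesis by (simp add: Q(3))
  qed
  with Q show ?thesis using that by blast
qed

text \<open>The rows of \<open>A\<close> span, so \<open>d\<close> of them form a basis. The
  permutation moves these to the top, and \<open>C\<close> is the inverse of the resulting leading
  block.\<close>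

lemma onto_on_normalize_rows:
  fixes A :: "nat \<Rightarrow> nat \<Rightarrow> complex"
  assumes onto: "onto_on {..<d} {..<n} (\<lambda>q b. A b q)"
  obtains \<sigma> C where "\<sigma> permutes {..<n}"
    "\<And>b q. b < d \<Longrightarrow> q < d \<Longrightarrow> (\<Sum>r<d. A (\<sigma> b) r * C r q) = (if b = q then 1 else 0 :: complex)"
proof -
  obtain B where B: "B \<subseteq> {..<n}" "card B \<le> card {..<d}" "onto_on {..<d} B (\<lambda>q b. A b q)"
    by (rule onto_on_column_basis[OF _ _ onto]) auto
  have finB: "finite B" using B(1) by (rule finite_subset) simp
  \<comment> \<open>Fewer than \<open>d\<close> rows would all annihilate some nonzero vector
    \<open>c\<close>, contrary to spanning.\<close>
  have "card B = d"
  proof (rule ccontr)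
    assume "card B \<noteq> d"
    then have "card B < card {..<d}" using B(2) by simp
    then obtain c q0 where c: "q0 < d" "c q0 \<noteq> 0" "\<forall>b\<in>B. (\<Sum>q<d. A b q * c q) = 0"
      using homogeneous_system_nontrivial_solution[OF finB, of "{..<d}" "\<lambda>b q. A b q"] by auto
    obtain x where x: "\<forall>q\<in>{..<d}. (\<Sum>b\<in>B. A b q * x b) = (if q = q0 then 1 else 0)"
      using B(3)[unfolded onto_on_def, rule_format, of "\<lambda>q. if q = q0 then 1 else 0"] by blast
    have "c q0 = (\<Sum>q<d. (\<Sum>b\<in>B. A b q * x b) * c q)"
      using c(1) x by (simp add: if_distrib[of "\<lambda>z. z * _"] sum.delta cong: if_cong)
    also have "\<dots> = (\<Sum>b\<in>B. x b * (\<Sum>q<d. A b q * c q))"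
      unfolding sum_distrib_left sum_distrib_right by (subst sum.swap) (simp add: algebra_simps)
    also have "\<dots> = 0" using c(3) by simp
    finally show False using c(2) by simp
  qed
  then obtain f where f: "bij_betw f {..<d} B"
    using finB finite_same_card_bij[of "{..<d}" B] by auto
  have dn: "d \<le> n" using \<open>card B = d\<close> card_mono[OF _ B(1)] by simp
  have "card ({..<n} - B) = card {d..<n}" using B(1) finB \<open>card B = d\<close> by (simp add: card_Diff_subset)
  then obtain g where g: "bij_betw g {d..<n} ({..<n} - B)"
    using finite_same_card_bij[of "{d..<n}" "{..<n} - B"] by auto
  define \<sigma> where "\<sigma> = (\<lambda>b. if b < d then f b else if b < n then g b else b)"
  have "bij_betw \<sigma> {..<d} B" using f by (rule bij_betw_cong[THEN iffD1, rotated]) (auto simp: \<sigma>_def)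
  moreover have "bij_betw \<sigma> {d..<n} ({..<n} - B)"
    using g by (rule bij_betw_cong[THEN iffD1, rotated]) (auto simp: \<sigma>_def)
  ultimately have "bij_betw \<sigma> ({..<d} \<union> {d..<n}) (B \<union> ({..<n} - B))"
    by (rule bij_betw_combine) auto
  moreover have "{..<d} \<union> {d..<n} = {..<n}" "B \<union> ({..<n} - B) = {..<n}" using dn B(1) by auto
  ultimately have "\<sigma> permutes {..<n}" using dn by (intro bij_imp_permutes) (auto simp: \<sigma>_def)
  moreover have "\<exists>y. \<forall>q<d. (\<Sum>b<d. A (\<sigma> b) q * y b) = (if q = s then 1 else 0)" for s
  proof -
    obtain x where x: "\<forall>q\<in>{..<d}. (\<Sum>b\<in>B. A b q * x b) = (if q = s then 1 else 0)"
      using B(3)[unfolded onto_on_def, rule_format, of "\<lambda>q. if q = s then 1 else 0"] by blast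
    have "(\<Sum>b\<in>B. A b q * x b) = (\<Sum>b<d. A (\<sigma> b) q * x (\<sigma> b))" for q
      using sum.reindex_bij_betw[OF \<open>bij_betw \<sigma> {..<d} B\<close>, of "\<lambda>b. A b q * x b"] by simp
    then show ?thesis using x by (intro exI[of _ "\<lambda>b. x (\<sigma> b)"]) auto
  qed
  then obtain Y where Y: "\<And>s q. q < d \<Longrightarrow> (\<Sum>b<d. A (\<sigma> b) q * Y s b) = (if q = s then 1 else 0)"
    by metis
  define A' Y' where "A' = mat d d (\<lambda>(b, q). A (\<sigma> b) q)" and "Y' = mat d d (\<lambda>(s, b). Y s b)"
  have [simp]: "A' \<in> carrier_mat d d" "Y' \<in> carrier_mat d d" by (auto simp: A'_def Y'_def)
  have "(\<Sum>b<d. Y s b * A (\<sigma> b) q) = (if q = s then 1 else 0)" if "q < d" for s q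
    using Y[OF that, of s] by (subst mult.commute)
  then have "Y' * A' = 1\<^sub>m d"
    by (intro eq_matI) (auto simp: A'_def Y'_def scalar_prod_def atLeast0LessThan)
  \<comment> \<open>Spanning yields a left inverse of the block; for square matrices it is a right
    inverse too.\<close>
  then have AY: "A' * Y' = 1\<^sub>m d" by (rule mat_mult_left_right_inverse[rotated 2]) auto
  have "(\<Sum>r<d. A (\<sigma> b) r * Y r q) = (if b = q then 1 else 0)" if "b < d" "q < d" for b q
  proof -
    have "(A' * Y') $$ (b, q) = (\<Sum>r<d. A (\<sigma> b) r * Y r q)"
      using that by (simp add: A'_def Y'_def scalar_prod_def atLeast0LessThan)
    then show ?thesis using that by (simp add: AY)
  qed
  ultimately show ?thesis by (rule that)
qed

section \<open>Sufficiency\<close>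


lemma index_triple_product:
  fixes U H V :: "complex mat"
  assumes "U \<in> carrier_mat N d" "H \<in> carrier_mat N M" "V \<in> carrier_mat M d'" "p < d" "q < d'"
  shows "(mat_adjoint U * H * V) $$ (p, q) = (\<Sum>a<N. \<Sum>b<M. cnj (U $$ (a, p)) * H $$ (a, b) * V $$ (b, q))"
proof -
  have UH: "mat_adjoint U \<in> carrier_mat d N" "\<And>i j. i < d \<Longrightarrow> j < N \<Longrightarrow> mat_adjoint U $$ (i, j) = cnj (U $$ (j, i))"
    using assms(1) by (auto simp: mat_adjoint_def mat_of_rows_def)
  define A where "A = mat_adjoint U * H"
  have A: "A \<in> carrier_mat d M" using assms UH by (simp add: A_def)
  have "(A * V) $$ (p, q) = (\<Sum>b<M. A $$ (p, b) * V $$ (b, q))"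
    using assms A by (simp add: scalar_prod_def atLeast0LessThan)
  also have "\<dots> = (\<Sum>b<M. (\<Sum>a<N. cnj (U $$ (a, p)) * H $$ (a, b)) * V $$ (b, q))"
    using assms UH by (intro sum.cong) (auto simp: A_def scalar_prod_def atLeast0LessThan)
  also have "\<dots> = (\<Sum>a<N. \<Sum>b<M. cnj (U $$ (a, p)) * H $$ (a, b) * V $$ (b, q))"
    unfolding sum_distrib_right by (rule sum.swap)
  finally show ?thesis by (simp only: A_def)
qed

text \<open>The matrix of the rank condition, written in the normalized beamformer variables so that
  its determinant is a polynomial in them and in the direct channel.\<close>

definition direct_mat :: "nat \<Rightarrow> (nat \<Rightarrow> nat) \<Rightarrow> (nat \<Rightarrow> nat) \<Rightarrow> nat \<Rightarrow> (elim_var \<Rightarrow> complex) \<Rightarrow> complex mat" where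
  "direct_mat d M N k x = mat d d (\<lambda>(p, q).
     \<Sum>a<N k. \<Sum>b<M k. urow d x k p a * x (Chan (k, k, a, b)) * vcol d x k b q)"

lemma polyfun_det_direct_mat:
  assumes "\<And>i. (\<lambda>x. g x i) \<in> polyfuns V"
  shows "(\<lambda>x. det (direct_mat d M N k (g x))) \<in> polyfuns V"
proof -
  have u: "(\<lambda>x. urow d (g x) k p a) \<in> polyfuns V" for p a
    using assms by (cases "a < d") (auto simp: urow_def intro: polyfuns_intros)
  have v: "(\<lambda>x. vcol d (g x) k b q) \<in> polyfuns V" for b q
    using assms by (cases "b < d") (auto simp: vcol_def intro: polyfuns_intros)
  have "det (direct_mat d M N k (g x)) = (\<Sum>\<pi> | \<pi> permutes {0..<d}. signof \<pi> * (\<Prod>i\<in>{0..<d}.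
      \<Sum>a<N k. \<Sum>b<M k. urow d (g x) k i a * g x (Chan (k, k, a, b)) * vcol d (g x) k b (\<pi> i)))" for x
  proof -
    have "direct_mat d M N k (g x) \<in> carrier_mat d d" by (simp add: direct_mat_def)
    note det = det_def'[OF this]
    have "\<pi> i < d" if "\<pi> permutes {0..<d}" "i < d" for \<pi> i
      using permutes_in_image[OF that(1), of i] that(2) by simp
    then show ?thesis
      unfolding det by (intro sum.cong arg_cong2[where f = "(*)"] prod.cong refl) (auto simp: direct_mat_def)
  qed
  then show ?thesis by (simp only:) (intro polyfuns_sum polyfuns.mult polyfuns.const polyfuns_prod u v assms)
qed

locale ia_network =
  fixes K d :: nat and M N :: "nat \<Rightarrow> nat"
  assumes d_pos: "d > 0" and d_le: "\<forall>k\<in>{1..K}. d \<le> M k \<and> d \<le> N k"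
begin

abbreviation "chans \<equiv> channel_entries K M N"
abbreviation "links \<equiv> cross_links K"

lemma finite_pivots: "finite (pivots d links)"
  using pivots_subset[OF order_refl d_le] finite_channel_entries by (rule finite_subset)

lemma nonpivot_chan:
  assumes "k \<in> {1..K}" "j \<in> {1..K}" "a < N k" "b < M j" "a \<ge> d \<or> b \<ge> d \<or> k = j"
  shows "(k, j, a, b) \<in> chans - pivots d links"
  using assms by (auto simp: channel_entries_def pivots_def cross_links_def)

text \<open>Up to sign, the linear part of \<open>elim_map\<close> in the beamformer variables at
  zero beamformers, when the cross channel has \<open>H2 k j\<close> to the right of its leading
  block and \<open>H3 k j\<close> below it.\<close>

definition lin_coeff :: "(nat \<Rightarrow> nat \<Rightarrow> nat \<Rightarrow> nat \<Rightarrow> complex) \<Rightarrow> (nat \<Rightarrow> nat \<Rightarrow> nat \<Rightarrow> nat \<Rightarrow> complex) \<Rightarrow>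
    nat \<times> nat \<times> nat \<times> nat \<Rightarrow> elim_var \<Rightarrow> complex" where
  "lin_coeff H2 H3 = (\<lambda>(k, j, p, q) i. case i of
     Chan _ \<Rightarrow> 0
   | UVar k' p' a \<Rightarrow> if k' = k \<and> p' = p then H3 k j a q else 0
   | VVar j' b q' \<Rightarrow> if j' = j \<and> q' = q then H2 k j p b else 0)"

lemma sum_lin_coeff:
  assumes "(k, j, p, q) \<in> pivots d links"
  shows "(\<Sum>i\<in>beam_vars d M N links. lin_coeff H2 H3 (k, j, p, q) i * x i) =
    (\<Sum>b<M j - d. H2 k j p b * x (VVar j b q)) + (\<Sum>a<N k - d. x (UVar k p a) * H3 k j a q)"
proof -
  have kj: "(k, j) \<in> links" "p < d" "q < d" using assms by (auto simp: pivots_def)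
  then have TR: "j \<in> Tx_of links" "k \<in> Rx_of links" by (auto simp: Tx_of_def Rx_of_def)
  let ?A = "(\<lambda>a. UVar k p a) ` {..<N k - d}" and ?B = "(\<lambda>b. VVar j b q) ` {..<M j - d}"
  let ?L = "\<lambda>i. lin_coeff H2 H3 (k, j, p, q) i * x i"
  have "?A \<subseteq> beam_vars d M N links"
    unfolding beam_vars_def
  proof (rule le_supI1, safe)
    fix a assume "a < N k - d"
    then show "UVar k p a \<in> (\<lambda>(k, p, a). UVar k p a) ` (SIGMA k:Rx_of links. {..<d} \<times> {..<N k - d})"
      using kj TR by (intro image_eqI[of _ _ "(k, p, a)"]) auto
  qed
  moreover have "?B \<subseteq> beam_vars d M N links"
    unfolding beam_vars_def
  proof (rule le_supI2, safe)
    fix b assume "b < M j - d"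
    then show "VVar j b q \<in> (\<lambda>(j, b, q). VVar j b q) ` (SIGMA j:Tx_of links. {..<M j - d} \<times> {..<d})"
      using kj TR by (intro image_eqI[of _ _ "(j, b, q)"]) auto
  qed
  moreover have "?L i = 0" if "i \<in> beam_vars d M N links - (?A \<union> ?B)" for i
    using that by (auto simp: beam_vars_def lin_coeff_def)
  ultimately have "sum ?L (beam_vars d M N links) = sum ?L (?A \<union> ?B)"
    by (intro sum.mono_neutral_right finite_beam_vars finite_cross_links) auto
  also have "\<dots> = sum ?L ?A + sum ?L ?B" by (intro sum.union_disjoint) auto
  also have "sum ?L ?A = (\<Sum>a<N k - d. x (UVar k p a) * H3 k j a q)"
    by (subst sum.reindex) (auto simp: inj_on_def lin_coeff_def mult.commute)
  also have "sum ?L ?B = (\<Sum>b<M j - d. H2 k j p b * x (VVar j b q))"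
    by (subst sum.reindex) (auto simp: inj_on_def lin_coeff_def)
  finally show ?thesis by (simp add: add.commute)
qed

text \<open>Beamformer variables outside the chosen set are fixed to zero, so that there are at most
  as many variables as equations.\<close>

definition used_vars :: "elim_var set \<Rightarrow> elim_var set" where
  "used_vars B = Chan ` (chans - pivots d links) \<union> B"

definition zero_ext :: "elim_var set \<Rightarrow> (elim_var \<Rightarrow> complex) \<Rightarrow> elim_var \<Rightarrow> complex" where
  "zero_ext B x i = (if i \<in> used_vars B then x i else 0)"

lemma polyfun_zero_ext: "(\<lambda>x. zero_ext B x i) \<in> polyfuns (used_vars B)"
  by (cases "i \<in> used_vars B") (auto simp: zero_ext_def intro: polyfuns_intros)

lemma zero_ext_chan: "e \<in> chans - pivots d links \<Longrightarrow> zero_ext B x (Chan e) = x (Chan e)"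
  by (auto simp: zero_ext_def used_vars_def)

text \<open>Every velocity \<open>w\<close> is realized by a curve in the image through one fixed
  point: channel variables move with the prescribed slope, and the pivots are steered by the
  beamformer variables because the linear part is onto.\<close>

lemma elim_map_alg_indep:
  assumes onto: "onto_on (pivots d links) B (lin_coeff H2 H3)" and B: "B \<subseteq> beam_vars d M N links"
  shows "alg_indep chans (\<lambda>e x. elim_map d M N links e (zero_ext B x))"
  unfolding alg_indep_def
proof (intro ballI impI allI)
  fix P y assume P: "P \<in> polyfuns chans" and zero: "\<forall>x. P (\<lambda>e. elim_map d M N links e (zero_ext B x)) = 0"
  have UV_used: "UVar k p a \<in> used_vars B \<longleftrightarrow> UVar k p a \<in> B" "VVar j b q \<in> used_vars B \<longleftrightarrow> VVar j b q \<in> B"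
    for k p a j b q by (auto simp: used_vars_def)
  \<comment> \<open>At zero beamformers the pivots depend on the beamformer variables to first order
    only through the two off-diagonal blocks; the trailing block affects higher orders.\<close>
  define x0 :: "elim_var \<Rightarrow> complex" where "x0 = (\<lambda>i. case i of
      Chan (k, j, a, b) \<Rightarrow> if a < d \<and> b \<ge> d then H2 k j a (b - d)
        else if a \<ge> d \<and> b < d then H3 k j (a - d) b else 0
    | _ \<Rightarrow> 0)"
  define z0 where "z0 = (\<lambda>e. elim_map d M N links e (zero_ext B x0))"
  show "P y = 0"
  proof (rule polyfun_zero_by_curves[OF P, of z0])
    fix w :: "nat \<times> nat \<times> nat \<times> nat \<Rightarrow> complex"
    \<comment> \<open>The sign compensates for the negation in \<open>elim_map\<close>.\<close>
    obtain t where t: "\<forall>e\<in>pivots d links. (\<Sum>i\<in>B. lin_coeff H2 H3 e i * t i) = - w e"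
      using onto[unfolded onto_on_def, rule_format, of "\<lambda>e. - w e"] by blast
    define t' where "t' = (\<lambda>i. if i \<in> B then t i else 0)"
    have t': "(\<Sum>i\<in>beam_vars d M N links. lin_coeff H2 H3 e i * t' i) = - w e" if "e \<in> pivots d links" for e
    proof -
      have "(\<Sum>i\<in>beam_vars d M N links. lin_coeff H2 H3 e i * t' i) = (\<Sum>i\<in>B. lin_coeff H2 H3 e i * t' i)"
        using B finite_beam_vars[OF finite_cross_links]
        by (intro sum.mono_neutral_right) (auto simp: t'_def)
      then show ?thesis using t that by (simp add: t'_def)
    qed
    define dir where "dir = (\<lambda>i. case i of Chan e \<Rightarrow> w e | _ \<Rightarrow> t' i)"
    define \<gamma> where "\<gamma> = (\<lambda>s e. elim_map d M N links e (zero_ext B (\<lambda>i. x0 i + s * dir i)))"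
    have beam: "zero_ext B (\<lambda>i. x0 i + s * dir i) (UVar k p a) = s * t' (UVar k p a)"
      "zero_ext B (\<lambda>i. x0 i + s * dir i) (VVar k p a) = s * t' (VVar k p a)" for s k p a
      by (auto simp: zero_ext_def UV_used x0_def dir_def t'_def)
    have deriv: "((\<lambda>s. \<gamma> s e) has_field_derivative w e) (at 0)" if e: "e \<in> chans" for e
    proof -
      obtain k j p q where e': "e = (k, j, p, q)" by (cases e)
      show ?thesis
      proof (cases "e \<in> pivots d links")
        case False
        then have "\<gamma> s e = x0 (Chan e) + s * w e" for s
          using e by (simp add: \<gamma>_def elim_map_def e' zero_ext_chan dir_def)
        then show ?thesis by (auto intro!: derivative_eq_intros)
      next
        case True
        then have kj: "(k, j) \<in> links" "p < d" "q < d" by (auto simp: pivots_def e')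
        then have kj': "k \<in> {1..K}" "j \<in> {1..K}" by (auto simp: cross_links_def)
        then have le: "d \<le> N k" "d \<le> M j" using d_le by auto
        have ch: "zero_ext B (\<lambda>i. x0 i + s * dir i) (Chan (k, j, a, b)) = x0 (Chan (k, j, a, b)) + s * w (k, j, a, b)"
          if "a < N k" "b < M j" "a \<ge> d \<or> b \<ge> d" for a b s
        proof -
          have "(k, j, a, b) \<in> chans - pivots d links"
            using that(3) by (intro nonpivot_chan kj' that(1,2)) auto
          then show ?thesis by (simp add: zero_ext_chan dir_def)
        qed
        have \<gamma>_eq: "\<gamma> s e = - ((\<Sum>b<M j - d. (H2 k j p b + s * w (k, j, p, d + b)) * (s * t' (VVar j b q)))
          + (\<Sum>a<N k - d. (s * t' (UVar k p a)) * (H3 k j a q + s * w (k, j, d + a, q)))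
          + (\<Sum>a<N k - d. \<Sum>b<M j - d.
               (s * t' (UVar k p a)) * (s * w (k, j, d + a, d + b)) * (s * t' (VVar j b q))))" for s
        proof -
          have "zero_ext B (\<lambda>i. x0 i + s * dir i) (Chan (k, j, p, d + b)) = H2 k j p b + s * w (k, j, p, d + b)"
            if "b < M j - d" for b
            using that kj le by (subst ch) (auto simp: x0_def)
          moreover have "zero_ext B (\<lambda>i. x0 i + s * dir i) (Chan (k, j, d + a, q)) = H3 k j a q + s * w (k, j, d + a, q)"
            if "a < N k - d" for a
            using that kj le by (subst ch) (auto simp: x0_def)
          moreover have "zero_ext B (\<lambda>i. x0 i + s * dir i) (Chan (k, j, d + a, d + b)) = s * w (k, j, d + a, d + b)"
            if "a < N k - d" "b < M j - d" for a b
            using that kj le by (subst ch) (auto simp: x0_def)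
          ultimately show ?thesis using True by (simp add: \<gamma>_def elim_map_def e' beam)
        qed
        have "(\<Sum>b<M j - d. H2 k j p b * t' (VVar j b q)) + (\<Sum>a<N k - d. t' (UVar k p a) * H3 k j a q) = - w e"
          using t'[OF True] sum_lin_coeff[of k j p q H2 H3 t'] True by (simp add: e')
        moreover have "((\<lambda>s. \<gamma> s e) has_field_derivative
            - ((\<Sum>b<M j - d. H2 k j p b * t' (VVar j b q)) + (\<Sum>a<N k - d. t' (UVar k p a) * H3 k j a q) +
               (\<Sum>a<N k - d. \<Sum>b<M j - d. 0))) (at 0)"
          unfolding \<gamma>_eq
          by (intro DERIV_minus DERIV_add DERIV_sum) (auto intro!: derivative_eq_intros)
        ultimately show ?thesis by simp
      qed
    qed
    have "\<gamma> 0 = z0" by (simp add: \<gamma>_def z0_def)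
    moreover have "P (\<gamma> s) = 0" for s unfolding \<gamma>_def using zero by blast
    ultimately show "\<exists>\<gamma>. (\<forall>t. P (\<gamma> t) = 0) \<and> (\<forall>e\<in>chans. \<gamma> 0 e = z0 e) \<and>
      (\<forall>e\<in>chans. ((\<lambda>t. \<gamma> t e) has_field_derivative w e) (at 0))"
      using deriv by (intro exI[of _ \<gamma>]) simp
  qed
qed

text \<open>Direct channel entries are never pivots and can be chosen freely. Identity leading
  blocks and zero beamformer variables make every determinant equal to 1.\<close>

lemma direct_mat_nonzero:
  "\<exists>x. (\<Prod>k\<in>{1..K}. det (direct_mat d M N k (zero_ext B x))) \<noteq> 0"
proof -
  define x :: "elim_var \<Rightarrow> complex" where
    "x = (\<lambda>i. case i of Chan (k, j, a, b) \<Rightarrow> if a = b \<and> a < d then 1 else 0 | _ \<Rightarrow> 0)"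
  have "direct_mat d M N k (zero_ext B x) = 1\<^sub>m d" if k: "k \<in> {1..K}" for k
  proof (rule eq_matI)
    fix p q assume pq: "p < dim_row (1\<^sub>m d)" "q < dim_col (1\<^sub>m d)"
    then have pq: "p < d" "q < d" by auto
    have le: "d \<le> N k" "d \<le> M k" using d_le k by auto
    have "zero_ext B x (Chan (k, k, a, b)) = (if a = b \<and> a < d then 1 else 0)"
      if "a < N k" "b < M k" for a b
      using nonpivot_chan[OF k k that] by (simp add: zero_ext_chan x_def)
    moreover have "zero_ext B x (UVar k' p' a) = 0" "zero_ext B x (VVar k' p' a) = 0" for k' p' a
      by (simp_all add: zero_ext_def x_def)
    ultimately have "(\<Sum>a<N k. \<Sum>b<M k. urow d (zero_ext B x) k p a * zero_ext B x (Chan (k, k, a, b)) *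
        vcol d (zero_ext B x) k b q) = (\<Sum>a<N k. \<Sum>b<M k. if a = p then if b = q then if p = q then 1 else 0 else 0 else 0)"
      using pq by (intro sum.cong refl) (auto simp: urow_def vcol_def)
    also have "\<dots> = (\<Sum>a<N k. if a = p then (\<Sum>b<M k. if b = q then if p = q then 1 else 0 else 0) else 0)"
      by (intro sum.cong) auto
    also have "\<dots> = (if p = q then 1 else 0)"
      using pq le by (simp add: sum.delta)
    finally show "direct_mat d M N k (zero_ext B x) $$ (p, q) = 1\<^sub>m d $$ (p, q)"
      using pq by (simp add: direct_mat_def)
  qed (auto simp: direct_mat_def)
  then have "(\<Prod>k\<in>{1..K}. det (direct_mat d M N k (zero_ext B x))) = 1" by simp
  then show ?thesis by (intro exI[of _ x]) simp
qed

lemma IA_solvable_from_elim_map: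
  assumes H: "\<And>k j. k \<in> {1..K} \<Longrightarrow> j \<in> {1..K} \<Longrightarrow> H k j \<in> carrier_mat (N k) (M j)"
    and x: "\<And>k j a b. (k, j, a, b) \<in> chans \<Longrightarrow> elim_map d M N links (k, j, a, b) x = H k j $$ (a, b)"
    and det: "\<And>k. k \<in> {1..K} \<Longrightarrow> det (direct_mat d M N k x) \<noteq> 0"
  shows "IA_solvable K M N (\<lambda>_. d) H"
proof -
  \<comment> \<open>Conjugated because \<open>urow\<close> describes a row of the adjoint.\<close>
  define U where "U = (\<lambda>k. mat (N k) d (\<lambda>(a, p). cnj (urow d x k p a)))"
  define V where "V = (\<lambda>j. mat (M j) d (\<lambda>(b, q). vcol d x j b q))"
  have carrier: "U k \<in> carrier_mat (N k) d" "V k \<in> carrier_mat (M k) d" for k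
    by (auto simp: U_def V_def)
  have ch: "x (Chan (k, j, a, b)) = H k j $$ (a, b)"
    if "k \<in> {1..K}" "j \<in> {1..K}" "a < N k" "b < M j" "a \<ge> d \<or> b \<ge> d \<or> k = j" for k j a b
    using nonpivot_chan[OF that] x[of k j a b] by (simp add: elim_map_def)
  have index: "(mat_adjoint (U k) * H k j * V j) $$ (p, q) =
      (\<Sum>a<N k. \<Sum>b<M j. urow d x k p a * H k j $$ (a, b) * vcol d x j b q)"
    if "k \<in> {1..K}" "j \<in> {1..K}" "p < d" "q < d" for k j p q
    using that by (subst index_triple_product[OF carrier(1) H carrier(2)]) (auto simp: U_def V_def)
  have dims: "mat_adjoint (U k) * H k j * V j \<in> carrier_mat d d" for k j
    by (auto simp: U_def V_def mat_adjoint_def)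
  have "mat_adjoint (U k) * H k j * V j = 0\<^sub>m d d" if kj: "k \<in> {1..K}" "j \<in> {1..K}" "k \<noteq> j" for k j
  proof (rule eq_matI)
    fix p q assume "p < dim_row (0\<^sub>m d d)" "q < dim_col (0\<^sub>m d d)"
    then have pq: "p < d" "q < d" by auto
    have le: "d \<le> N k" "d \<le> M j" using kj d_le by auto
    have link: "(k, j) \<in> links" using kj by (simp add: cross_links_def)
    have "(k, j, p, q) \<in> chans" using kj pq le by (simp add: channel_entries_def)
    then have "elim_map d M N links (k, j, p, q) x = H k j $$ (p, q)" by (rule x)
    then have "(\<Sum>a<N k. \<Sum>b<M j. urow d x k p a * H k j $$ (a, b) * vcol d x j b q) = 0"
      by (subst (asm) elim_map_eq_iff[where h = "\<lambda>a b. H k j $$ (a, b)"])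
        (use link pq le ch[OF kj(1,2)] in auto)
    then show "(mat_adjoint (U k) * H k j * V j) $$ (p, q) = 0\<^sub>m d d $$ (p, q)"
      using index[OF kj(1,2) pq] pq by simp
  qed (auto simp: U_def V_def mat_adjoint_def)
  moreover have "vec_space.rank d (mat_adjoint (U k) * H k k * V k) = d" if k: "k \<in> {1..K}" for k
  proof -
    have "mat_adjoint (U k) * H k k * V k = direct_mat d M N k x"
    proof (rule eq_matI)
      fix p q assume "p < dim_row (direct_mat d M N k x)" "q < dim_col (direct_mat d M N k x)"
      then have pq: "p < d" "q < d" by (auto simp: direct_mat_def)
      show "(mat_adjoint (U k) * H k k * V k) $$ (p, q) = direct_mat d M N k x $$ (p, q)"
        using pq ch[OF k k] by (simp add: index[OF k k] direct_mat_def)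
    qed (use dims[of k k] in \<open>auto simp: direct_mat_def\<close>)
    then show ?thesis using det[OF k] vec_space.det_rank_iff[OF dims[of k k]] by simp
  qed
  ultimately show ?thesis using carrier unfolding IA_solvable_def IA_solution_def by blast
qed

text \<open>The onto linear part keeps its rank on at most one beamformer variable per equation. The
  map restricted to these is square and independent, and the nonvanishing function handed to
  \<open>dominant_map_image\<close> is the product of the direct determinants.\<close>

theorem generic_IA_solvable:
  assumes cond: "\<And>J. J \<subseteq> links \<Longrightarrow> d * card J \<le> (\<Sum>j\<in>Tx_of J. M j - d) + (\<Sum>k\<in>Rx_of J. N k - d)"
    and dvd: "(\<forall>k\<in>{1..K}. d dvd N k) \<or> (\<forall>k\<in>{1..K}. d dvd M k)"
  obtains g where "g \<in> polyfuns chans" "\<exists>y. g y \<noteq> 0"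
    "\<And>H. (\<And>k j. k \<in> {1..K} \<Longrightarrow> j \<in> {1..K} \<Longrightarrow> H k j \<in> carrier_mat (N k) (M j)) \<Longrightarrow>
       g (\<lambda>(k, j, a, b). H k j $$ (a, b)) \<noteq> 0 \<Longrightarrow> IA_solvable K M N (\<lambda>_. d) H"
proof -
  have users: "Tx_of links \<subseteq> {1..K}" "Rx_of links \<subseteq> {1..K}"
    by (auto simp: Tx_of_def Rx_of_def cross_links_def)
  \<comment> \<open>The capacities are the numbers of antennas beyond the identity block, and they
    inherit divisibility by \<open>d\<close>.\<close>
  have "(\<forall>k\<in>Rx_of links. d dvd N k - d) \<or> (\<forall>j\<in>Tx_of links. d dvd M j - d)"
    using dvd users by (auto intro!: dvd_diff_nat)
  then obtain H2 H3 where H23: "\<And>w. \<exists>xU xV. \<forall>k j p q. (k, j) \<in> links \<longrightarrow> p < d \<longrightarrow> q < d \<longrightarrow>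
    (\<Sum>b<M j - d. H2 k j p b * xV j b q) + (\<Sum>a<N k - d. xU k p a * H3 k j a q) = (w k j p q :: complex)"
    using onto_for_divisible_network[OF finite_cross_links d_pos cond] by blast
  have "onto_on (pivots d links) (beam_vars d M N links) (lin_coeff H2 H3)"
    unfolding onto_on_def
  proof
    fix w
    obtain xU xV where x: "\<forall>k j p q. (k, j) \<in> links \<longrightarrow> p < d \<longrightarrow> q < d \<longrightarrow>
      (\<Sum>b<M j - d. H2 k j p b * xV j b q) + (\<Sum>a<N k - d. xU k p a * H3 k j a q) = w (k, j, p, q)"
      using H23[of "\<lambda>k j p q. w (k, j, p, q)"] by blast
    define y where "y = (\<lambda>i. case i of Chan _ \<Rightarrow> 0 | UVar k p a \<Rightarrow> xU k p a | VVar j b q \<Rightarrow> xV j b q)"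
    have "(\<Sum>i\<in>beam_vars d M N links. lin_coeff H2 H3 e i * y i) = w e" if "e \<in> pivots d links" for e
    proof -
      obtain k j p q where e: "e = (k, j, p, q)" by (cases e)
      then have "(k, j) \<in> links" "p < d" "q < d" using that by (auto simp: pivots_def)
      then show ?thesis using x that by (simp add: e sum_lin_coeff y_def)
    qed
    then show "\<exists>y. \<forall>e\<in>pivots d links. (\<Sum>i\<in>beam_vars d M N links. lin_coeff H2 H3 e i * y i) = w e"
      by blast
  qed
  then obtain B where B: "B \<subseteq> beam_vars d M N links" "card B \<le> card (pivots d links)"
    "onto_on (pivots d links) B (lin_coeff H2 H3)"
    using onto_on_column_basis[OF finite_beam_vars[OF finite_cross_links] finite_pivots] by blast
  have finB: "finite B" using B(1) finite_beam_vars[OF finite_cross_links] by (rule finite_subset)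
  have fin: "finite chans" by (rule finite_channel_entries)
  have piv: "pivots d links \<subseteq> chans" by (rule pivots_subset[OF order_refl d_le])
  interpret square_alg_indep chans "used_vars B" "\<lambda>e x. elim_map d M N links e (zero_ext B x)"
  proof
    show "finite chans" by fact
    show "finite (used_vars B)" using fin finB by (simp add: used_vars_def)
    have "card (used_vars B) \<le> card (Chan ` (chans - pivots d links)) + card B"
      unfolding used_vars_def by (rule card_Un_le)
    also have "card (Chan ` (chans - pivots d links)) = card chans - card (pivots d links)"
      using piv fin by (subst card_image) (auto simp: inj_on_def card_Diff_subset finite_subset)
    finally show "card (used_vars B) \<le> card chans" using B(2) card_mono[OF fin piv] by linarith
    show "(\<lambda>x. elim_map d M N links e (zero_ext B x)) \<in> polyfuns (used_vars B)" for e
      by (intro polyfun_elim_map polyfun_zero_ext)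
    show "alg_indep chans (\<lambda>e x. elim_map d M N links e (zero_ext B x))"
      by (rule elim_map_alg_indep[OF B(3,1)])
  qed
  have "(\<lambda>x. \<Prod>k\<in>{1..K}. det (direct_mat d M N k (zero_ext B x))) \<in> polyfuns (used_vars B)"
    by (intro polyfuns_prod polyfun_det_direct_mat polyfun_zero_ext)
  from dominant_map_image[OF this direct_mat_nonzero] obtain g where
    g: "g \<in> polyfuns chans" "\<exists>y. g y \<noteq> 0" "\<And>y. g y \<noteq> 0 \<Longrightarrow>
      \<exists>x. (\<forall>e\<in>chans. elim_map d M N links e (zero_ext B x) = y e) \<and>
        (\<Prod>k\<in>{1..K}. det (direct_mat d M N k (zero_ext B x))) \<noteq> 0"
    by blast
  show ?thesis
  proof (rule that[OF g(1,2)])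
    fix H :: "nat \<Rightarrow> nat \<Rightarrow> complex mat"
    assume H: "\<And>k j. k \<in> {1..K} \<Longrightarrow> j \<in> {1..K} \<Longrightarrow> H k j \<in> carrier_mat (N k) (M j)"
      and "g (\<lambda>(k, j, a, b). H k j $$ (a, b)) \<noteq> 0"
    from g(3)[OF this(2)] obtain x where
      "\<forall>e\<in>chans. elim_map d M N links e (zero_ext B x) = (case e of (k, j, a, b) \<Rightarrow> H k j $$ (a, b))"
      "(\<Prod>k\<in>{1..K}. det (direct_mat d M N k (zero_ext B x))) \<noteq> 0" by blast
    then show "IA_solvable K M N (\<lambda>_. d) H"
      by (intro IA_solvable_from_elim_map[OF H, of "zero_ext B x"]) auto
  qed
qed

end

section \<open>Necessity and the main theorem\<close>


text \<open>An inverse of \<open>A * B\<close> supplies a right inverse of \<open>A\<close> and a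
  left inverse of \<open>B\<close>. In this way the rank condition on a direct link forces both of
  its beamformers to have full column rank.\<close>

lemma full_rank_product_onto:
  fixes A B :: "complex mat"
  assumes A: "A \<in> carrier_mat d n" and B: "B \<in> carrier_mat n d"
    and rank: "vec_space.rank d (A * B) = d"
  shows "onto_on {..<d} {..<n} (\<lambda>p a. A $$ (p, a))" "onto_on {..<d} {..<n} (\<lambda>q b. B $$ (b, q))"
proof -
  have AB: "A * B \<in> carrier_mat d d" using A B by simp
  then have "det (A * B) \<noteq> 0" using rank vec_space.det_rank_iff[OF AB] by simp
  then obtain C where C: "C \<in> carrier_mat d d" "A * B * C = 1\<^sub>m d" "C * (A * B) = 1\<^sub>m d"
    using det_non_zero_imp_unit[OF AB] by (auto simp: Units_def ring_mat_def)
  define Y where "Y = B * C"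
  define X where "X = C * A"
  have XY: "Y \<in> carrier_mat n d" "X \<in> carrier_mat d n" using A B C by (auto simp: X_def Y_def)
  have AY: "A * Y = 1\<^sub>m d"
    unfolding Y_def using assoc_mult_mat[OF A B C(1), symmetric] C(2) by (rule trans)
  have XB: "X * B = 1\<^sub>m d"
    unfolding X_def using assoc_mult_mat[OF C(1) A B] C(3) by (rule trans)
  show "onto_on {..<d} {..<n} (\<lambda>p a. A $$ (p, a))"
    unfolding onto_on_def
  proof
    fix w :: "nat \<Rightarrow> complex"
    have 1: "(\<Sum>a<n. A $$ (p, a) * Y $$ (a, q)) = (if p = q then 1 else 0)" if "p < d" "q < d" for p q
      using arg_cong[OF AY, of "\<lambda>Z. Z $$ (p, q)"] that A XY by (simp add: scalar_prod_def atLeast0LessThan)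
    have "(\<Sum>a<n. A $$ (p, a) * (\<Sum>q<d. Y $$ (a, q) * w q)) = w p" if p: "p < d" for p
    proof -
      have "(\<Sum>a<n. A $$ (p, a) * (\<Sum>q<d. Y $$ (a, q) * w q)) =
          (\<Sum>q<d. (\<Sum>a<n. A $$ (p, a) * Y $$ (a, q)) * w q)"
        unfolding sum_distrib_left sum_distrib_right by (subst sum.swap) (simp add: mult.assoc)
      also have "\<dots> = (\<Sum>q<d. if p = q then w q else 0)" using p by (intro sum.cong) (auto simp: 1)
      finally show ?thesis using p by simp
    qed
    then show "\<exists>x. \<forall>p\<in>{..<d}. (\<Sum>a<n. A $$ (p, a) * x a) = w p"
      by (intro exI[of _ "\<lambda>a. \<Sum>q<d. Y $$ (a, q) * w q"]) auto
  qed
  show "onto_on {..<d} {..<n} (\<lambda>q b. B $$ (b, q))"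
    unfolding onto_on_def
  proof
    fix w :: "nat \<Rightarrow> complex"
    have 1: "(\<Sum>b<n. X $$ (p, b) * B $$ (b, q)) = (if p = q then 1 else 0)" if "p < d" "q < d" for p q
      using arg_cong[OF XB, of "\<lambda>Z. Z $$ (p, q)"] that B XY by (simp add: scalar_prod_def atLeast0LessThan)
    have "(\<Sum>b<n. B $$ (b, q) * (\<Sum>p<d. w p * X $$ (p, b))) = w q" if q: "q < d" for q
    proof -
      have "(\<Sum>b<n. B $$ (b, q) * (\<Sum>p<d. w p * X $$ (p, b))) =
          (\<Sum>p<d. w p * (\<Sum>b<n. X $$ (p, b) * B $$ (b, q)))"
        unfolding sum_distrib_left by (subst sum.swap) (simp add: mult_ac)
      also have "\<dots> = (\<Sum>p<d. if p = q then w p else 0)" using q by (intro sum.cong) (auto simp: 1)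
      finally show ?thesis using q by simp
    qed
    then show "\<exists>x. \<forall>q\<in>{..<d}. (\<Sum>b<n. B $$ (b, q) * x b) = w q"
      by (intro exI[of _ "\<lambda>b. \<Sum>p<d. w p * X $$ (p, b)"]) auto
  qed
qed

text \<open>Permuting the antennas only reorders the double sum, and mixing the streams by
  \<open>C\<close> and \<open>D\<close> gives a linear combination of forms that vanish.\<close>

lemma bilinear_form_permuted:
  fixes h :: "nat \<Rightarrow> nat \<Rightarrow> complex"
  assumes "\<pi> permutes {..<n}" "\<sigma> permutes {..<m}"
    and zero: "\<And>r s. r < d \<Longrightarrow> s < d \<Longrightarrow> (\<Sum>a<n. \<Sum>b<m. u r a * h a b * v b s) = 0"
  shows "(\<Sum>a<n. \<Sum>b<m. (\<Sum>r<d. u r (\<pi> a) * C r) * h (\<pi> a) (\<sigma> b) * (\<Sum>s<d. v (\<sigma> b) s * D s)) = 0"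
proof -
  have perm: "(\<Sum>a<n. \<Sum>b<m. f (\<pi> a) (\<sigma> b)) = (\<Sum>a<n. \<Sum>b<m. f a b)" for f :: "nat \<Rightarrow> nat \<Rightarrow> complex"
  proof -
    have "(\<Sum>a<n. \<Sum>b<m. f (\<pi> a) (\<sigma> b)) = (\<Sum>a<n. \<Sum>b<m. f (\<pi> a) b)"
      using sum.permute[OF assms(2), symmetric, of "f _"] by (simp add: o_def)
    also have "\<dots> = (\<Sum>a<n. \<Sum>b<m. f a b)"
      using sum.permute[OF assms(1), symmetric, of "\<lambda>a. \<Sum>b<m. f a b"] by (simp add: o_def)
    finally show ?thesis .
  qed
  have "(\<Sum>a<n. \<Sum>b<m. (\<Sum>r<d. u r (\<pi> a) * C r) * h (\<pi> a) (\<sigma> b) * (\<Sum>s<d. v (\<sigma> b) s * D s)) =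
     (\<Sum>a<n. \<Sum>b<m. (\<Sum>r<d. u r a * C r) * h a b * (\<Sum>s<d. v b s * D s))"
    by (rule perm)
  also have "\<dots> = (\<Sum>a<n. \<Sum>b<m. \<Sum>r<d. \<Sum>s<d. C r * D s * (u r a * h a b * v b s))"
    by (simp add: sum_distrib_left sum_distrib_right mult_ac)
  also have "\<dots> = (\<Sum>a<n. \<Sum>r<d. \<Sum>b<m. \<Sum>s<d. C r * D s * (u r a * h a b * v b s))"
    by (intro sum.cong refl sum.swap)
  also have "\<dots> = (\<Sum>r<d. \<Sum>a<n. \<Sum>b<m. \<Sum>s<d. C r * D s * (u r a * h a b * v b s))"
    by (rule sum.swap)
  also have "\<dots> = (\<Sum>r<d. \<Sum>a<n. \<Sum>s<d. \<Sum>b<m. C r * D s * (u r a * h a b * v b s))"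
    by (intro sum.cong refl sum.swap)
  also have "\<dots> = (\<Sum>r<d. \<Sum>s<d. \<Sum>a<n. \<Sum>b<m. C r * D s * (u r a * h a b * v b s))"
    by (intro sum.cong refl sum.swap)
  also have "\<dots> = (\<Sum>r<d. \<Sum>s<d. C r * D s * (\<Sum>a<n. \<Sum>b<m. u r a * h a b * v b s))"
    by (simp only: sum_distrib_left)
  also have "\<dots> = 0" by (simp add: zero)
  finally show ?thesis .
qed

context ia_network
begin

text \<open>Multiplying beamformers on the right by invertible matrices preserves alignment. The row
  permutations depend on the solution and are moved onto the channel; taking them extensional leaves
  finitely many choices.\<close>

lemma IA_solvable_normalized:
  assumes H: "\<And>k j. k \<in> {1..K} \<Longrightarrow> j \<in> {1..K} \<Longrightarrow> H k j \<in> carrier_mat (N k) (M j)"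
    and solvable: "IA_solvable K M N (\<lambda>_. d) H"
  obtains \<pi> \<sigma> x where "\<pi> \<in> (\<Pi>\<^sub>E k\<in>{1..K}. {\<pi>. \<pi> permutes {..<N k}})"
    "\<sigma> \<in> (\<Pi>\<^sub>E j\<in>{1..K}. {\<sigma>. \<sigma> permutes {..<M j}})"
    "\<And>k j p q. (k, j) \<in> links \<Longrightarrow> p < d \<Longrightarrow> q < d \<Longrightarrow> (\<Sum>a<N k. \<Sum>b<M j.
       urow d x k p a * H k j $$ (\<pi> k a, \<sigma> j b) * vcol d x j b q) = 0"
proof -
  from solvable obtain U V where sol: "IA_solution K M N (\<lambda>_. d) H U V"
    unfolding IA_solvable_def by blast
  have UV: "\<And>k. k \<in> {1..K} \<Longrightarrow> U k \<in> carrier_mat (N k) d"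
    "\<And>k. k \<in> {1..K} \<Longrightarrow> V k \<in> carrier_mat (M k) d"
    and rank: "\<And>k. k \<in> {1..K} \<Longrightarrow> vec_space.rank d (mat_adjoint (U k) * H k k * V k) = d"
    and zero: "\<And>k j. k \<in> {1..K} \<Longrightarrow> j \<in> {1..K} \<Longrightarrow> k \<noteq> j \<Longrightarrow> mat_adjoint (U k) * H k j * V j = 0\<^sub>m d d"
    using sol unfolding IA_solution_def by blast+
  have UH: "mat_adjoint (U k) \<in> carrier_mat d (N k)" if "k \<in> {1..K}" for k
    using UV(1)[OF that] by (auto simp: mat_adjoint_def)
  have UH_index: "mat_adjoint (U k) $$ (p, a) = cnj (U k $$ (a, p))" if "k \<in> {1..K}" "p < d" "a < N k" for k p a
    using UV(1)[OF that(1)] that by (auto simp: mat_adjoint_def mat_of_rows_def)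
  have "\<exists>\<sigma> C. \<sigma> permutes {..<M j} \<and> (\<forall>b<d. \<forall>q<d. (\<Sum>r<d. V j $$ (\<sigma> b, r) * C r q) = (if b = q then 1 else 0))"
    if j: "j \<in> {1..K}" for j
  proof -
    have "onto_on {..<d} {..<M j} (\<lambda>q b. V j $$ (b, q))"
      using UH[OF j] UV(2)[OF j] H[OF j j] rank[OF j]
      by (intro full_rank_product_onto(2)[of "mat_adjoint (U j) * H j j"]) auto
    from onto_on_normalize_rows[OF this] show ?thesis by metis
  qed
  then obtain \<sigma> D where \<sigma>: "\<And>j. j \<in> {1..K} \<Longrightarrow> \<sigma> j permutes {..<M j}"
    and D: "\<And>j b q. j \<in> {1..K} \<Longrightarrow> b < d \<Longrightarrow> q < d \<Longrightarrow> (\<Sum>r<d. V j $$ (\<sigma> j b, r) * D j r q) = (if b = q then 1 else 0)"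
    by metis
  have "\<exists>\<pi> C. \<pi> permutes {..<N k} \<and> (\<forall>a<d. \<forall>p<d. (\<Sum>r<d. mat_adjoint (U k) $$ (r, \<pi> a) * C r p) = (if a = p then 1 else 0))"
    if k: "k \<in> {1..K}" for k
  proof -
    have "mat_adjoint (U k) * H k k * V k = mat_adjoint (U k) * (H k k * V k)"
      using UH[OF k] UV(2)[OF k] H[OF k k] by (intro assoc_mult_mat) auto
    then have "onto_on {..<d} {..<N k} (\<lambda>p a. mat_adjoint (U k) $$ (p, a))"
      using UH[OF k] UV(2)[OF k] H[OF k k] rank[OF k]
      by (intro full_rank_product_onto(1)[of _ _ _ "H k k * V k"]) auto
    from onto_on_normalize_rows[OF this] show ?thesis by metis
  qed
  then obtain \<pi> C where \<pi>: "\<And>k. k \<in> {1..K} \<Longrightarrow> \<pi> k permutes {..<N k}"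
    and C: "\<And>k a p. k \<in> {1..K} \<Longrightarrow> a < d \<Longrightarrow> p < d \<Longrightarrow>
      (\<Sum>r<d. mat_adjoint (U k) $$ (r, \<pi> k a) * C k r p) = (if a = p then 1 else 0)"
    by metis
  define x where "x = (\<lambda>i. case i of Chan _ \<Rightarrow> 0
    | UVar k p a \<Rightarrow> \<Sum>r<d. mat_adjoint (U k) $$ (r, \<pi> k (d + a)) * C k r p
    | VVar j b q \<Rightarrow> \<Sum>r<d. V j $$ (\<sigma> j (d + b), r) * D j r q)"
  have u: "urow d x k p a = (\<Sum>r<d. mat_adjoint (U k) $$ (r, \<pi> k a) * C k r p)" if "k \<in> {1..K}" "p < d" for k p a
    using C[OF that(1) _ that(2)] by (cases "a < d") (auto simp: urow_def x_def)
  have v: "vcol d x j b q = (\<Sum>s<d. V j $$ (\<sigma> j b, s) * D j s q)" if "j \<in> {1..K}" "q < d" for j b q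
    using D[OF that(1) _ that(2)] by (cases "b < d") (auto simp: vcol_def x_def)
  show ?thesis
  proof (rule that[of "restrict \<pi> {1..K}" "restrict \<sigma> {1..K}" x])
    fix k j p q assume kj: "(k, j) \<in> links" and pq: "p < d" "q < d"
    then have k: "k \<in> {1..K}" and j: "j \<in> {1..K}" and "k \<noteq> j" by (auto simp: cross_links_def)
    have "(\<Sum>a<N k. \<Sum>b<M j. mat_adjoint (U k) $$ (r, a) * H k j $$ (a, b) * V j $$ (b, s)) = 0"
      if "r < d" "s < d" for r s
      using index_triple_product[OF UV(1)[OF k] H[OF k j] UV(2)[OF j] that] zero[OF k j \<open>k \<noteq> j\<close>] that
      by (simp add: UH_index[OF k])
    from bilinear_form_permuted[where u = "\<lambda>r a. mat_adjoint (U k) $$ (r, a)"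
        and h = "\<lambda>a b. H k j $$ (a, b)" and v = "\<lambda>b s. V j $$ (b, s)" and C = "\<lambda>r. C k r p"
        and D = "\<lambda>s. D j s q", OF \<pi>[OF k] \<sigma>[OF j] this]
    show "(\<Sum>a<N k. \<Sum>b<M j. urow d x k p a *
        H k j $$ (restrict \<pi> {1..K} k a, restrict \<sigma> {1..K} j b) * vcol d x j b q) = 0"
      using k j by (simp add: u[OF k pq(1)] v[OF j pq(2)])
  qed (use \<pi> \<sigma> in auto)
qed

text \<open>Which permutations will normalize a solution is not known beforehand, so
  \<open>g\<close> is the product of the relation \<open>Q\<close> over all of them.\<close>

theorem generic_not_IA_solvable:
  assumes J: "J \<subseteq> links"
    and less: "(\<Sum>j\<in>Tx_of J. M j - d) + (\<Sum>k\<in>Rx_of J. N k - d) < d * card J"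
  obtains g where "g \<in> polyfuns chans" "\<exists>y. g y \<noteq> 0"
    "\<And>H. (\<And>k j. k \<in> {1..K} \<Longrightarrow> j \<in> {1..K} \<Longrightarrow> H k j \<in> carrier_mat (N k) (M j)) \<Longrightarrow>
       g (\<lambda>(k, j, a, b). H k j $$ (a, b)) \<noteq> 0 \<Longrightarrow> \<not> IA_solvable K M N (\<lambda>_. d) H"
proof -
  obtain Q where Q: "Q \<in> polyfuns chans" "\<exists>y. Q y \<noteq> 0"
    "\<And>h x. (\<And>k j p q. (k, j) \<in> J \<Longrightarrow> p < d \<Longrightarrow> q < d \<Longrightarrow>
        (\<Sum>a<N k. \<Sum>b<M j. urow d x k p a * h (k, j, a, b) * vcol d x j b q) = 0) \<Longrightarrow> Q h = 0"
    using aligned_channels_dependent[OF J d_le d_pos less] by blast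
  define perms where "perms = (\<Pi>\<^sub>E k\<in>{1..K}. {\<pi>. \<pi> permutes {..<N k}}) \<times> (\<Pi>\<^sub>E j\<in>{1..K}. {\<sigma>. \<sigma> permutes {..<M j}})"
  define act where "act = (\<lambda>(\<pi>, \<sigma>) (h :: nat \<times> nat \<times> nat \<times> nat \<Rightarrow> complex)
    (k :: nat, j :: nat, a :: nat, b :: nat). h (k, j, \<pi> k a, \<sigma> j b))"
  define g where "g = (\<lambda>h. \<Prod>\<tau>\<in>perms. Q (act \<tau> h))"
  have fin: "finite perms" unfolding perms_def
    by (intro finite_cartesian_product finite_PiE finite_permutations) auto
  have poly: "(\<lambda>h. Q (act \<tau> h)) \<in> polyfuns chans" if \<tau>: "\<tau> \<in> perms" for \<tau>
  proof (rule polyfuns_compose[OF Q(1)])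
    fix e assume e: "e \<in> chans"
    obtain \<pi> \<sigma> where \<tau>': "\<tau> = (\<pi>, \<sigma>)" by (cases \<tau>)
    obtain k j a b where e': "e = (k, j, a, b)" by (cases e)
    have kj: "k \<in> {1..K}" "j \<in> {1..K}" "a < N k" "b < M j" using e by (auto simp: e' channel_entries_def)
    have "\<pi> k permutes {..<N k}" "\<sigma> j permutes {..<M j}"
      using \<tau> kj by (auto simp: perms_def \<tau>')
    from permutes_in_image[OF this(1), of a] permutes_in_image[OF this(2), of b]
    have "(k, j, \<pi> k a, \<sigma> j b) \<in> chans" using kj by (simp add: channel_entries_def)
    then show "(\<lambda>h. act \<tau> h e) \<in> polyfuns chans" by (auto simp: act_def \<tau>' e' intro: polyfuns_intros)
  qed
  have nz: "\<exists>h. Q (act \<tau> h) \<noteq> 0" if \<tau>: "\<tau> \<in> perms" for \<tau>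
  proof -
    obtain \<pi> \<sigma> where \<tau>': "\<tau> = (\<pi>, \<sigma>)" by (cases \<tau>)
    obtain y where y: "Q y \<noteq> 0" using Q(2) by blast
    \<comment> \<open>A point where \<open>Q\<close> is nonzero is pulled back by the inverse
      permutations.\<close>
    have "Q (act \<tau> (act (\<lambda>k. inv_into UNIV (\<pi> k), \<lambda>j. inv_into UNIV (\<sigma> j)) y)) = Q y"
    proof (rule polyfuns_cong[OF Q(1)])
      fix e assume e: "e \<in> chans"
      obtain k j a b where e': "e = (k, j, a, b)" by (cases e)
      have "k \<in> {1..K}" "j \<in> {1..K}" using e by (auto simp: e' channel_entries_def)
      then have "\<pi> k permutes {..<N k}" "\<sigma> j permutes {..<M j}"
        using \<tau> by (auto simp: perms_def \<tau>')
      then show "act \<tau> (act (\<lambda>k. inv_into UNIV (\<pi> k), \<lambda>j. inv_into UNIV (\<sigma> j)) y) e = y e"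
        by (simp add: act_def \<tau>' e' permutes_inverses)
    qed
    then show ?thesis using y by metis
  qed
  have "g \<in> polyfuns chans" unfolding g_def by (intro polyfuns_prod poly)
  moreover have "\<exists>y. g y \<noteq> 0" unfolding g_def by (rule polyfuns_prod_nonzero[OF fin poly nz])
  moreover have "\<not> IA_solvable K M N (\<lambda>_. d) H"
    if H: "\<And>k j. k \<in> {1..K} \<Longrightarrow> j \<in> {1..K} \<Longrightarrow> H k j \<in> carrier_mat (N k) (M j)"
      and nz: "g (\<lambda>(k, j, a, b). H k j $$ (a, b)) \<noteq> 0" for H :: "nat \<Rightarrow> nat \<Rightarrow> complex mat"
  proof
    assume "IA_solvable K M N (\<lambda>_. d) H"
    from IA_solvable_normalized[OF H this] obtain \<pi> \<sigma> x
      where "\<pi> \<in> (\<Pi>\<^sub>E k\<in>{1..K}. {\<pi>. \<pi> permutes {..<N k}})" "\<sigma> \<in> (\<Pi>\<^sub>E j\<in>{1..K}. {\<sigma>. \<sigma> permutes {..<M j}})"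
      and zero: "\<And>k j p q. (k, j) \<in> links \<Longrightarrow> p < d \<Longrightarrow> q < d \<Longrightarrow> (\<Sum>a<N k. \<Sum>b<M j.
       urow d x k p a * H k j $$ (\<pi> k a, \<sigma> j b) * vcol d x j b q) = 0" by blast
    then have "(\<pi>, \<sigma>) \<in> perms" by (simp add: perms_def)
    moreover have "Q (act (\<pi>, \<sigma>) (\<lambda>(k, j, a, b). H k j $$ (a, b))) = 0"
      by (rule Q(3)[of x]) (use zero J in \<open>auto simp: act_def\<close>)
    ultimately have "g (\<lambda>(k, j, a, b). H k j $$ (a, b)) = 0"
      unfolding g_def using fin by (intro prod_zero) auto
    then show False using nz by simp
  qed
  ultimately show ?thesis by (rule that)
qed

end

theorem mainTheorem6:
  fixes K d :: nat and M N ds :: "nat \<Rightarrow> nat"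
    and P :: "'w measure" and H :: "'w \<Rightarrow> nat \<Rightarrow> nat \<Rightarrow> complex mat"
  assumes "network_config K M N ds"
    and "\<forall>k\<in>{1..K}. ds k \<le> min (M k) (N k)"
    and "prob_space P"
    and "random_channels P K M N H"
    and "\<forall>k\<in>{1..K}. ds k = d"
    and "(\<forall>k\<in>{1..K}. d dvd N k) \<or> (\<forall>k\<in>{1..K}. d dvd M k)"
  shows "(AE \<omega> in P. IA_solvable K M N ds (H \<omega>)) \<longleftrightarrow>
    (\<forall>J \<subseteq> cross_links K.
       (\<Sum>j\<in>Tx_of J. int (M j) - int d) + (\<Sum>k\<in>Rx_of J. int (N k) - int d)
         \<ge> int d * int (card J))"
proof -
  interpret prob_space P by fact
  have "1 \<in> {1..K}" using assms(1) by (simp add: network_config_def)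
  then have d_pos: "d > 0" using assms(1,5) unfolding network_config_def by metis
  have d_le: "\<forall>k\<in>{1..K}. d \<le> M k \<and> d \<le> N k" using assms(2,5) by auto
  interpret ia_network K d M N by unfold_locales fact+
  have solvable_eq: "IA_solvable K M N ds h = IA_solvable K M N (\<lambda>_. d) h" for h
    unfolding IA_solvable_def IA_solution_def using assms(5) by simp
  \<comment> \<open>As \<open>d\<close> is at most every \<open>M j\<close> and \<open>N k\<close>,
    truncated and integer subtraction agree.\<close>
  have cond_iff: "(\<Sum>j\<in>Tx_of J. int (M j) - int d) + (\<Sum>k\<in>Rx_of J. int (N k) - int d) \<ge> int d * int (card J)
      \<longleftrightarrow> d * card J \<le> (\<Sum>j\<in>Tx_of J. M j - d) + (\<Sum>k\<in>Rx_of J. N k - d)" if J: "J \<subseteq> links" for J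
  proof -
    have "Tx_of J \<subseteq> {1..K}" "Rx_of J \<subseteq> {1..K}"
      using J by (auto simp: Tx_of_def Rx_of_def cross_links_def)
    then have "(\<Sum>j\<in>Tx_of J. int (M j) - int d) = int (\<Sum>j\<in>Tx_of J. M j - d)"
      "(\<Sum>k\<in>Rx_of J. int (N k) - int d) = int (\<Sum>k\<in>Rx_of J. N k - d)"
      using d_le unfolding of_nat_sum by (auto intro!: sum.cong simp: of_nat_diff)
    then show ?thesis by (simp only: of_nat_add[symmetric] of_nat_mult[symmetric] of_nat_le_iff)
  qed
  have H: "H \<omega> k j \<in> carrier_mat (N k) (M j)" if "\<omega> \<in> space P" "k \<in> {1..K}" "j \<in> {1..K}" for \<omega> k j
    using assms(4) that by (auto simp: random_channels_def)
  have entries: "channel_entry H e \<omega> = (case e of (k, j, a, b) \<Rightarrow> H \<omega> k j $$ (a, b))" for e \<omega>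
    by (simp add: channel_entry_def case_prod_unfold)
  have generic: "AE \<omega> in P. g (\<lambda>(k, j, a, b). H \<omega> k j $$ (a, b)) \<noteq> 0"
    if "g \<in> polyfuns chans" "\<exists>y. g y \<noteq> 0" for g
    using AE_polyfun_indep_vars_nonzero[OF finite_channel_entries _ _ that, of "channel_entry H"] assms(4)
    by (simp add: random_channels_def entries)
  show ?thesis
  proof (intro iffI allI impI)
    assume cond: "\<forall>J\<subseteq>links. int d * int (card J) \<le> (\<Sum>j\<in>Tx_of J. int (M j) - int d) + (\<Sum>k\<in>Rx_of J. int (N k) - int d)"
    obtain g where g: "g \<in> polyfuns chans" "\<exists>y. g y \<noteq> 0"
      "\<And>H. (\<And>k j. k \<in> {1..K} \<Longrightarrow> j \<in> {1..K} \<Longrightarrow> H k j \<in> carrier_mat (N k) (M j)) \<Longrightarrow>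
       g (\<lambda>(k, j, a, b). H k j $$ (a, b)) \<noteq> 0 \<Longrightarrow> IA_solvable K M N (\<lambda>_. d) H"
      by (rule generic_IA_solvable) (use cond cond_iff assms(6) in auto)
    show "AE \<omega> in P. IA_solvable K M N ds (H \<omega>)"
      using generic[OF g(1,2)] AE_space
      by eventually_elim (auto simp: solvable_eq intro!: g(3) H)
  next
    fix J assume AE: "AE \<omega> in P. IA_solvable K M N ds (H \<omega>)" and J: "J \<subseteq> links"
    show "int d * int (card J) \<le> (\<Sum>j\<in>Tx_of J. int (M j) - int d) + (\<Sum>k\<in>Rx_of J. int (N k) - int d)"
    proof (rule ccontr)
      assume "\<not> ?thesis"
      then have "(\<Sum>j\<in>Tx_of J. M j - d) + (\<Sum>k\<in>Rx_of J. N k - d) < d * card J"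
        using cond_iff[OF J] by simp
      from generic_not_IA_solvable[OF J this] obtain g where g: "g \<in> polyfuns chans" "\<exists>y. g y \<noteq> 0"
        "\<And>H. (\<And>k j. k \<in> {1..K} \<Longrightarrow> j \<in> {1..K} \<Longrightarrow> H k j \<in> carrier_mat (N k) (M j)) \<Longrightarrow>
         g (\<lambda>(k, j, a, b). H k j $$ (a, b)) \<noteq> 0 \<Longrightarrow> \<not> IA_solvable K M N (\<lambda>_. d) H" by blast
      \<comment> \<open>Almost sure solvability and almost sure unsolvability exclude each other in
        a probability space.\<close>
      have "AE \<omega> in P. False"
        using generic[OF g(1,2)] AE AE_space
        by eventually_elim (use g(3) H in \<open>auto simp: solvable_eq\<close>)
      then show False by simp
    qed
  qed
qed

end
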